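(* Let $d=2n>0$ be even, let $b_{2n}$ be the Weyl symbol of the inverse of the harmonic oscillator $H=-\Delta+|x|^2$ on $\mathbf R^{2n}$, and let $p_j(t)=\sum_{k=0}^{j}t^k/k!$ be the Taylor polynomial of $e^t$ of order $j$ centered at $t=0$. Then $$b_{2n}(X)=\sum_{j=0}^{n-1}\binom{n-1}{j}(-1)^j(2j)!\,\frac{1-e^{-|X|^2}p_{2j}(|X|^2)}{|X|^{2+4j}},\qquad X=(x,\xi)\in\mathbf R^{4n},$$ where the right-hand side at $X=0$ is understood by continuous extension.
   Context: The harmonic oscillator $H=-\Delta+|x|^2$ on $\mathbf R^d$ is strictly positive on $L^2(\mathbf R^d)$ and invertible. The Weyl symbol of $H^{-1}$ is the (unique, smooth) function $b_d$ on $\mathbf R^{2d}$ such that, in the sense of Weyl quantization (oscillatory integrals), $$H^{-1}f(x)=(2\pi)^{-d}\iint e^{i\langle x-y,\xi\rangle}\,b_d\big((x+y)/2,\xi\big)f(y)\,dy\,d\xi,\qquad f\in\mathscr S(\mathbf R^d).$$ *)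

theory Defs
  imports "HOL-Analysis.Analysis"
begin

section \<open>Smooth functions, Schwartz functions and symbols\<close>

definition partial_deriv ::
    "'a::euclidean_space \<Rightarrow> ('a \<Rightarrow> complex) \<Rightarrow> 'a \<Rightarrow> complex" where
  "partial_deriv i f = (\<lambda>x. frechet_derivative f (at x) i)"

text \<open>A multi-index is a list of basis vectors, one entry per differentiation.\<close>

definition iter_deriv ::
    "'a::euclidean_space list \<Rightarrow> ('a \<Rightarrow> complex) \<Rightarrow> 'a \<Rightarrow> complex" where
  "iter_deriv bs f = foldr partial_deriv bs f"

definition smooth :: "('a::euclidean_space \<Rightarrow> complex) \<Rightarrow> bool" where
  "smooth f \<longleftrightarrow> (\<forall>bs \<in> lists Basis. iter_deriv bs f differentiable_on UNIV)"

definition schwartz :: "('a::euclidean_space \<Rightarrow> complex) \<Rightarrow> bool" where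
  "schwartz f \<longleftrightarrow> smooth f \<and>
     (\<forall>bs \<in> lists Basis. \<forall>k::nat. \<exists>C::real. \<forall>x.
        (1 + norm x) ^ k * norm (iter_deriv bs f x) \<le> C)"

text \<open>
  The smooth functions all of whose derivatives are bounded by a common power of \<open>1 + |X|\<close>:
  the amplitudes for which the oscillatory integral of Weyl quantization is defined.
  Natural exponents suffice, since the condition becomes weaker as \<open>m\<close> grows.
\<close>

definition amplitude :: "('a::euclidean_space \<Rightarrow> complex) \<Rightarrow> bool" where
  "amplitude a \<longleftrightarrow> smooth a \<and>
     (\<exists>m::nat. \<forall>bs \<in> lists Basis. \<exists>C::real. \<forall>X.
        norm (iter_deriv bs a X) \<le> C * (1 + norm X) ^ m)"


section \<open>The harmonic oscillator\<close>

definition laplacian :: "('a::euclidean_space \<Rightarrow> complex) \<Rightarrow> 'a \<Rightarrow> complex" where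
  "laplacian f x = (\<Sum>i\<in>Basis. partial_deriv i (partial_deriv i f) x)"

definition harmonic_expr :: "('a::euclidean_space \<Rightarrow> complex) \<Rightarrow> 'a \<Rightarrow> complex" where
  "harmonic_expr f x = - laplacian f x + of_real ((norm x)\<^sup>2) * f x"

definition square_integrable :: "('a::euclidean_space \<Rightarrow> complex) \<Rightarrow> bool" where
  "square_integrable u \<longleftrightarrow>
     u \<in> borel_measurable lborel \<and> integrable lborel (\<lambda>x. (norm (u x))\<^sup>2)"

text \<open>
  The graph of the self-adjoint operator \<open>H = -\<Delta> + |x|\<^sup>2\<close> on \<open>L\<^sup>2\<close>: its domain consists of
  the \<open>u \<in> L\<^sup>2\<close> for which \<open>H u\<close>, taken in the distributional sense, is in \<open>L\<^sup>2\<close>.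
  Elements of \<open>L\<^sup>2\<close> are represented by functions, so the graph is
  closed under changing either component on a null set.  The inverse operator is the converse
  of this relation.
\<close>

definition harmonic_oscillator ::
    "(('a::euclidean_space \<Rightarrow> complex) \<times> ('a \<Rightarrow> complex)) set" where
  "harmonic_oscillator = {(u, f). square_integrable u \<and> square_integrable f \<and>
     (\<forall>\<phi>. schwartz \<phi> \<longrightarrow>
        (\<integral>x. u x * cnj (harmonic_expr \<phi> x) \<partial>lborel) = (\<integral>x. f x * cnj (\<phi> x) \<partial>lborel))}"


section \<open>Weyl quantization\<close>

text \<open>
  \<open>\<integral>\<integral> F y \<xi> dy d\<xi> = I\<close> as an oscillatory integral: the integral is regularized by cutoffs
  \<open>\<psi>(\<epsilon>\<xi>)\<close> in the frequency variable, and the limit \<open>\<epsilon> \<rightarrow> 0\<close> has to be \<open>I\<close> for every cutoff.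
\<close>

definition has_oscillatory_integral ::
    "('a::euclidean_space \<Rightarrow> 'b::euclidean_space \<Rightarrow> complex) \<Rightarrow> complex \<Rightarrow> bool" where
  "has_oscillatory_integral F I \<longleftrightarrow>
     (\<forall>\<psi>. schwartz \<psi> \<and> \<psi> 0 = 1 \<longrightarrow>
        (\<forall>\<epsilon>>0. integrable lborel (\<lambda>(y, \<xi>). \<psi> (\<epsilon> *\<^sub>R \<xi>) * F y \<xi>)) \<and>
        ((\<lambda>\<epsilon>. integral\<^sup>L lborel (\<lambda>(y, \<xi>). \<psi> (\<epsilon> *\<^sub>R \<xi>) * F y \<xi>)) \<longlongrightarrow> I) (at_right 0))"

text \<open>
  \<open>has_weyl_value a f x v\<close> says that
  \<open>v = (2\<pi>)^(-d) \<integral>\<integral> exp(i\<langle>x - y, \<xi>\<rangle>) a((x+y)/2, \<xi>) f(y) dy d\<xi>\<close>.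
\<close>

definition has_weyl_value ::
    "('a::euclidean_space \<times> 'a \<Rightarrow> complex) \<Rightarrow> ('a \<Rightarrow> complex) \<Rightarrow> 'a \<Rightarrow> complex \<Rightarrow> bool" where
  "has_weyl_value a f x v \<longleftrightarrow>
     (\<exists>I. has_oscillatory_integral
            (\<lambda>y \<xi>. cis ((x - y) \<bullet> \<xi>) * a ((x + y) /\<^sub>R 2, \<xi>) * f y) I \<and>
          v = I / of_real ((2 * pi) ^ DIM('a)))"

text \<open>
  The Weyl symbol of an operator on \<open>L\<^sup>2\<close>, given by its graph \<open>A\<close> (as above, up to null sets):
  for every Schwartz function \<open>f\<close>, the image of \<open>f\<close> has a representative \<open>u\<close> that is given
  pointwise everywhere by the Weyl quantization formula.
\<close>

definition is_weyl_symbol ::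
    "(('a::euclidean_space \<Rightarrow> complex) \<times> ('a \<Rightarrow> complex)) set \<Rightarrow>
     ('a \<times> 'a \<Rightarrow> complex) \<Rightarrow> bool" where
  "is_weyl_symbol A a \<longleftrightarrow> amplitude a \<and>
     (\<forall>f. schwartz f \<longrightarrow> (\<exists>u. (f, u) \<in> A \<and> (\<forall>x. has_weyl_value a f x (u x))))"

definition weyl_symbol ::
    "(('a::euclidean_space \<Rightarrow> complex) \<times> ('a \<Rightarrow> complex)) set \<Rightarrow> 'a \<times> 'a \<Rightarrow> complex" where
  "weyl_symbol A = (THE a. is_weyl_symbol A a)"


section \<open>The explicit formula\<close>

definition exp_taylor :: "nat \<Rightarrow> real \<Rightarrow> real" where
  "exp_taylor j t = (\<Sum>k\<le>j. t ^ k / fact k)"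

text \<open>Only meaningful for \<open>X \<noteq> 0\<close>: at the origin, division by zero makes this \<open>0\<close>.\<close>

definition harmonic_inverse_formula :: "nat \<Rightarrow> 'a::real_normed_vector \<Rightarrow> real" where
  "harmonic_inverse_formula n X =
     (\<Sum>j\<le>n - 1. real ((n - 1) choose j) * (- 1) ^ j * fact (2 * j) *
        ((1 - exp (- (norm X)\<^sup>2) * exp_taylor (2 * j) ((norm X)\<^sup>2)) / norm X ^ (2 + 4 * j)))"

end

theory Submission
  imports Defs "HOL-Probability.Probability"
begin

text \<open>
  Since \<open>H\<^sup>-\<^sup>1 = \<integral>\<^sub>0\<^sup>\<infinity> e\<^bsup>-tH\<^esup> dt\<close> and \<open>e\<^bsup>-tH\<^esup>\<close> has the Weyl symbol \<open>(cosh t)\<^bsup>-d\<^esup> exp (- tanh t |X|\<^sup>2)\<close>,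
  the substitution \<open>s = tanh t\<close> suggests, for \<open>d = 2n\<close>, the symbol
  \<open>\<integral>\<^sub>0\<^sup>1 (1 - s\<^sup>2)\<^bsup>n-1\<^esup> exp (- s |X|\<^sup>2) ds\<close>; expanding \<open>(1 - s\<^sup>2)\<^bsup>n-1\<^esup>\<close> gives the stated formula.
  That this function is a Weyl symbol of the inverse follows from the corresponding superposition of
  Mehler kernels being a fundamental solution of \<open>H\<close>.  For uniqueness, the matrix elements of the inverse between
  coherent states, which lie in the range of \<open>H\<close> on Schwartz functions, determine the Fourier
  transform of \<open>exp (- |X|\<^sup>2) a(X)\<close> for every Weyl symbol \<open>a\<close>.
\<close>

section \<open>Integration on Euclidean spaces\<close>

text \<open>The oscillatory integral must have the same limit for every Schwartz cutoff. Integrating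
  over \<open>y\<close> first, and by parts, yields an absolutely convergent iterated integral for
  any amplitude, which settles this once and for all. Afterwards a single Gaussian cutoff identifies
  the value, and its only effect is to lengthen the heat time in the Mehler kernel.

  The kernel is singular at s = 0. Truncating the s-integral at a positive \<open>r\<close> makes
  Fubini and the integrations by parts harmless; the heat equation then leaves one boundary term,
  which is an approximate identity as \<open>r\<close> tends to 0.

  The Gaussian exp (- s |X|^2) loses its decay at s = 0 as well, so the derivatives of the symbol
  need bounds uniform in s. They exist because every factor X created by a derivative comes with a
  factor s.

  \<open>harmonic_oscillator\<close> is a weak relation between functions. Membership follows from
  L^1 and sup bounds together with Fubini against test functions. For uniqueness the relation is
  tested with \<phi> such that H \<phi> is a coherent state, so every representative of the image
  yields the same number.\<close>

lemma fixes F :: "'a::euclidean_space \<Rightarrow> 'b::euclidean_space \<Rightarrow> complex"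
  assumes F: "integrable lborel (\<lambda>(x, y). F x y)"
  shows integrable_iterated: "integrable lborel (\<lambda>x. LBINT y. F x y)"
    and integrable_iterated': "integrable lborel (\<lambda>y. LBINT x. F x y)"
    and integral_iterated: "(LBINT x. (LBINT y. F x y)) = (LBINT z. (case z of (x, y) \<Rightarrow> F x y))"
    and integral_iterated_swap:
      "(LBINT x. (LBINT y. F x y)) = (LBINT y. (LBINT x. F x y))"
proof -
  have *: "integrable (lborel \<Otimes>\<^sub>M lborel) (case_prod F)"
    using F by (simp add: lborel_prod)
  show "integrable lborel (\<lambda>x. LBINT y. F x y)"
    by (rule lborel_pair.integrable_fst[OF *])
  show "integrable lborel (\<lambda>y. LBINT x. F x y)"
    by (rule lborel_pair.integrable_snd[OF *])
  show "(LBINT x. (LBINT y. F x y)) = (LBINT z. (case z of (x, y) \<Rightarrow> F x y))"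
    using lborel_pair.integral_fst[OF *] by (simp add: lborel_prod)
  show "(LBINT x. (LBINT y. F x y)) = (LBINT y. (LBINT x. F x y))"
    by (rule lborel_pair.Fubini_integral[OF *, symmetric])
qed

lemma integrable_pair_mult:
  fixes g :: "'a::euclidean_space \<Rightarrow> real" and h :: "'b::euclidean_space \<Rightarrow> real"
  assumes g: "integrable lborel g" and h: "integrable lborel h"
  shows "integrable lborel (\<lambda>(x, y). g x * h y)"
proof -
  note [measurable] = borel_measurable_integrable[OF g] borel_measurable_integrable[OF h]
  have "integrable (lborel \<Otimes>\<^sub>M lborel) (\<lambda>(x, y). g x * h y)"
  proof (rule lborel_pair.Fubini_integrable)
    show "(\<lambda>(x, y). g x * h y) \<in> borel_measurable (lborel \<Otimes>\<^sub>M lborel)"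
      by measurable
    have "integrable lborel (\<lambda>x. \<bar>g x\<bar> * (LBINT y. \<bar>h y\<bar>))"
      using g by auto
    then show "integrable lborel (\<lambda>x. LBINT y. norm (case (x, y) of (x, y) \<Rightarrow> g x * h y))"
      by (simp add: abs_mult)
    show "AE x in lborel. integrable lborel (\<lambda>y. case (x, y) of (x, y) \<Rightarrow> g x * h y)"
      using h by auto
  qed
  then show ?thesis by (simp add: lborel_prod)
qed

lemma integrable_pair_bound:
  fixes F :: "'a::euclidean_space \<Rightarrow> 'b::euclidean_space \<Rightarrow> complex"
  assumes F: "(\<lambda>(x, y). F x y) \<in> borel_measurable borel"
    and g: "integrable lborel g" and h: "integrable lborel h"
    and bound: "\<And>x y. norm (F x y) \<le> g x * h y"
  shows "integrable lborel (\<lambda>(x, y). F x y)"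
  by (rule Bochner_Integration.integrable_bound[OF integrable_pair_mult[OF g h]])
    (use F bound in \<open>force intro: order_trans[OF bound] simp: abs_mult[symmetric]\<close>)+

lemma fixes f :: "'a::euclidean_space \<Rightarrow> 'b::{banach, second_countable_topology}"
  assumes "c \<noteq> 0"
  shows lborel_integrable_affine: "integrable lborel f \<Longrightarrow> integrable lborel (\<lambda>x. f (t + c *\<^sub>R x))"
    and lborel_integral_affine: "f \<in> borel_measurable borel \<Longrightarrow>
      (LBINT x. f (t + c *\<^sub>R x)) = (LBINT x. f x) /\<^sub>R \<bar>c\<bar> ^ DIM('a)"
proof -
  assume f: "integrable lborel f"
  note [measurable] = borel_measurable_integrable[OF f]
  have "integrable (density (distr lborel borel (\<lambda>x. t + c *\<^sub>R x)) (\<lambda>_. ennreal (\<bar>c\<bar> ^ DIM('a)))) f"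
    using f by (subst (asm) lborel_affine[OF assms, of t]) simp
  then have "integrable (distr lborel borel (\<lambda>x. t + c *\<^sub>R x)) (\<lambda>x. \<bar>c\<bar> ^ DIM('a) *\<^sub>R f x)"
    by (subst (asm) integrable_density) auto
  then show "integrable lborel (\<lambda>x. f (t + c *\<^sub>R x))"
    proof (subst (asm) integrable_distr_eq)
    assume "integrable lborel (\<lambda>x. \<bar>c\<bar> ^ DIM('a) *\<^sub>R f (t + c *\<^sub>R x))"
    from integrable_scaleR_right[OF this, of "inverse (\<bar>c\<bar> ^ DIM('a))"] show ?thesis
      using assms by simp
  qed auto
next
  assume [measurable]: "f \<in> borel_measurable borel"
  have "(LBINT x. f x) = (\<integral>x. f x \<partial>density (distr lborel borel (\<lambda>x. t + c *\<^sub>R x)) (\<lambda>_. \<bar>c\<bar>^DIM('a)))"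
    using lborel_affine[OF assms, of t] by simp
  also have "\<dots> = \<bar>c\<bar> ^ DIM('a) *\<^sub>R (LBINT x. f (t + c *\<^sub>R x))"
    by (subst integral_density) (auto simp: integral_distr)
  finally show "(LBINT x. f (t + c *\<^sub>R x)) = (LBINT x. f x) /\<^sub>R \<bar>c\<bar> ^ DIM('a)"
    using assms by simp
qed

lemma fixes f :: "'a::euclidean_space \<Rightarrow> real \<Rightarrow> complex"
  assumes f: "\<And>b. b \<in> Basis \<Longrightarrow> integrable lborel (f b)"
  shows lborel_integrable_prod: "integrable lborel (\<lambda>x::'a. \<Prod>b\<in>Basis. f b (x \<bullet> b))"
    and lborel_integral_prod:
      "(LBINT (x::'a). (\<Prod>b\<in>Basis. f b (x \<bullet> b))) = (\<Prod>b\<in>Basis. (LBINT t. f b t))"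
proof -
  interpret product_sigma_finite "\<lambda>_::'a. lborel :: real measure" ..
  have [measurable]: "\<And>b. b \<in> Basis \<Longrightarrow> f b \<in> borel_measurable borel"
    using borel_measurable_integrable[OF f] by simp
  have eq: "(\<Prod>b\<in>Basis. f b ((\<Sum>i\<in>Basis. g i *\<^sub>R i) \<bullet> b)) = (\<Prod>b\<in>Basis. f b (g b))" for g
    by (intro prod.cong) auto
  have m: "(\<lambda>x::'a. \<Prod>b\<in>Basis. f b (x \<bullet> b)) \<in> borel_measurable borel"
    by measurable
  show "integrable lborel (\<lambda>x::'a. \<Prod>b\<in>Basis. f b (x \<bullet> b))"
    unfolding lborel_eq[where 'a='a] using m
    by (subst integrable_distr_eq) (auto simp: eq intro!: product_integrable_prod f)
  show "(LBINT (x::'a). (\<Prod>b\<in>Basis. f b (x \<bullet> b))) = (\<Prod>b\<in>Basis. (LBINT t. f b t))"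
    unfolding lborel_eq[where 'a='a] using m
    by (subst integral_distr) (auto simp: eq intro!: product_integral_prod f)
qed

section \<open>Gaussian integrals and their Fourier transforms\<close>

lemma norm_power2_eq_sum_Basis: "(norm x)\<^sup>2 = (\<Sum>b\<in>Basis. (x \<bullet> b)\<^sup>2)"
  unfolding power2_norm_eq_inner by (subst euclidean_inner) (simp add: power2_eq_square)

text \<open>The characteristic function of the standard normal distribution, rescaled by
  \<open>sqrt (2 * \<sigma>)\<close>.\<close>

lemma fixes k :: real assumes "\<sigma> > 0"
  shows integrable_gaussian_real: "integrable lborel (\<lambda>x::real. exp (\<i> * (k * x) - \<sigma> * x\<^sup>2))"
    and gaussian_fourier_real: "(LBINT x. exp (\<i> * (k * x) - \<sigma> * x\<^sup>2)) = sqrt (pi / \<sigma>) * exp (- k\<^sup>2 / (4 * \<sigma>))"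
proof -
  define r where "r = sqrt (2 * \<sigma>)"
  have r: "r > 0" "r\<^sup>2 = 2 * \<sigma>" using assms by (auto simp: r_def)
  let ?g = "\<lambda>t x::real. iexp (t * x) * exp (- x\<^sup>2 / 2)"
  have std: "std_normal_density x = exp (- x\<^sup>2 / 2) / sqrt (2 * pi)" for x
    by (simp add: std_normal_density_def)
  have i0: "integrable lborel (\<lambda>x::real. exp (- x\<^sup>2 / 2))"
    using integrable_mult_right[OF integrable_normal_density[of 1 0], of "sqrt (2 * pi)"]
    by (simp add: std)
  have i1: "integrable lborel (?g t)" for t
  proof (rule Bochner_Integration.integrable_bound[OF i0])
    show "?g t \<in> borel_measurable lborel"
      by simp
  qed (auto simp: norm_mult)
  have g: "(LBINT x. ?g t x) = sqrt (2 * pi) * exp (- t\<^sup>2 / 2)" for t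
  proof -
    have "char std_normal_distribution t = (LBINT x. std_normal_density x *\<^sub>R iexp (t * x))"
      unfolding char_def by (subst integral_density) auto
    also have "\<dots> = (LBINT x. ?g t x / sqrt (2 * pi))"
      by (intro Bochner_Integration.integral_cong) (auto simp: std scaleR_conv_of_real)
    also have "\<dots> = (LBINT x. ?g t x) / sqrt (2 * pi)"
      by simp
    finally show ?thesis
      unfolding char_std_normal_distribution by (simp add: field_simps)
  qed
  have eq: "exp (\<i> * (k * x) - \<sigma> * x\<^sup>2) = ?g (k / r) (r * x)" for x
    using r by (simp add: exp_of_real[symmetric] exp_add[symmetric] power_mult_distrib)
  have eq': "exp (\<i> * (k * x) - \<sigma> * x\<^sup>2) = ?g (k / r) (0 + r *\<^sub>R x)" for x
    unfolding eq by simp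
  show "integrable lborel (\<lambda>x::real. exp (\<i> * (k * x) - \<sigma> * x\<^sup>2))"
    unfolding eq' by (rule lborel_integrable_affine[OF _ i1]) (use r in auto)
  have m: "?g t \<in> borel_measurable borel" for t
    by simp
  have "sqrt (2 * pi) / r = sqrt (pi / \<sigma>)"
    using r assms by (simp add: r_def real_sqrt_divide[symmetric])
  then have "(sqrt (2 * pi) * exp (- (k / r)\<^sup>2 / 2)) / r = sqrt (pi / \<sigma>) * exp (- k\<^sup>2 / (4 * \<sigma>))"
    using r by (simp add: power_divide) (simp add: field_simps)
  moreover have "(LBINT x. exp (\<i> * (k * x) - \<sigma> * x\<^sup>2))
      = complex_of_real ((sqrt (2 * pi) * exp (- (k / r)\<^sup>2 / 2)) / r)"
    unfolding eq' by (subst lborel_integral_affine[OF _ m])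
      (use r g[of "k / r"] in \<open>auto simp: scaleR_conv_of_real field_simps\<close>)
  ultimately show "(LBINT x. exp (\<i> * (k * x) - \<sigma> * x\<^sup>2)) = sqrt (pi / \<sigma>) * exp (- k\<^sup>2 / (4 * \<sigma>))"
    by simp
qed

lemma fixes k :: "'a::euclidean_space" assumes "\<sigma> > 0"
  shows integrable_gaussian_fourier: "integrable lborel (\<lambda>x::'a. cis (k \<bullet> x) * exp (- (\<sigma> * (norm x)\<^sup>2)))"
    and gaussian_fourier: "(LBINT (x::'a). cis (k \<bullet> x) * exp (- (\<sigma> * (norm x)\<^sup>2)))
        = sqrt (pi / \<sigma>) ^ DIM('a) * exp (- (norm k)\<^sup>2 / (4 * \<sigma>))"
proof -
  let ?f = "\<lambda>b x::real. exp (\<i> * ((k \<bullet> b) * x) - \<sigma> * x\<^sup>2)"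
  have eq: "cis (k \<bullet> x) * exp (- (\<sigma> * (norm x)\<^sup>2)) = (\<Prod>b\<in>Basis. ?f b (x \<bullet> b))" for x
    by (simp add: exp_sum[symmetric] cis_conv_exp exp_of_real[symmetric] exp_add[symmetric] del: of_real_power of_real_mult)
      (simp add: norm_power2_eq_sum_Basis euclidean_inner[of k x] sum_subtractf sum_distrib_left sum_distrib_right)
  show "integrable lborel (\<lambda>x::'a. cis (k \<bullet> x) * exp (- (\<sigma> * (norm x)\<^sup>2)))"
    unfolding eq by (rule lborel_integrable_prod) (rule integrable_gaussian_real[OF assms])
  have "(LBINT (x::'a). cis (k \<bullet> x) * exp (- (\<sigma> * (norm x)\<^sup>2)))
     = (\<Prod>b\<in>Basis. complex_of_real (sqrt (pi / \<sigma>) * exp (- (k \<bullet> b)\<^sup>2 / (4 * \<sigma>))))"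
    unfolding eq by (subst lborel_integral_prod[OF integrable_gaussian_real[OF assms]])
      (intro prod.cong refl gaussian_fourier_real[OF assms])
  also have "\<dots> = sqrt (pi / \<sigma>) ^ DIM('a) * exp (- (norm k)\<^sup>2 / (4 * \<sigma>))"
    by (simp add: prod.distrib norm_power2_eq_sum_Basis sum_divide_distrib exp_sum sum_negf[symmetric] del: sum_negf)
  finally show "(LBINT (x::'a). cis (k \<bullet> x) * exp (- (\<sigma> * (norm x)\<^sup>2)))
        = sqrt (pi / \<sigma>) ^ DIM('a) * exp (- (norm k)\<^sup>2 / (4 * \<sigma>))" .
qed

lemma fixes \<sigma> :: real assumes "\<sigma> > 0"
  shows integrable_gaussian: "integrable lborel (\<lambda>x::'a::euclidean_space. exp (- (\<sigma> * (norm x)\<^sup>2)))"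
    and gaussian_integral: "(LBINT (x::'a). exp (- (\<sigma> * (norm x)\<^sup>2))) = sqrt (pi / \<sigma>) ^ DIM('a)"
proof -
  show i: "integrable lborel (\<lambda>x::'a::euclidean_space. exp (- (\<sigma> * (norm x)\<^sup>2)))"
    using integrable_norm[OF integrable_gaussian_fourier[OF assms, of "0::'a"]] by (simp add: norm_mult)
  show "(LBINT (x::'a). exp (- (\<sigma> * (norm x)\<^sup>2))) = sqrt (pi / \<sigma>) ^ DIM('a)"
  proof -
    have "complex_of_real (LBINT (x::'a). exp (- (\<sigma> * (norm x)\<^sup>2))) = of_real (sqrt (pi / \<sigma>) ^ DIM('a))"
      unfolding integral_complex_of_real[symmetric]
      using gaussian_fourier[OF assms, of "0::'a"] by (simp del: integral_complex_of_real)
    then show ?thesis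
      by (simp only: of_real_eq_iff)
  qed
qed

text \<open>Each factor 1 + (x . b)^2 is at most (1 + |x|)^2, so two powers per coordinate are
  dominated by a product of one-dimensional Cauchy densities. This is where the exponent
  \<open>2 * DIM('a)\<close> in the later decay estimates comes from.\<close>

lemma integrable_inverse_power:
  "integrable lborel (\<lambda>x::'a::euclidean_space. 1 / (1 + norm x) ^ (2 * DIM('a)))"
proof -
  have "set_integrable lborel UNIV (\<lambda>x::real. inverse (1 + x\<^sup>2))"
    using integrable_inverse_1_plus_square by (simp add: einterval_def)
  then have "integrable lborel (\<lambda>x::real. complex_of_real (inverse (1 + x\<^sup>2)))"
    unfolding set_integrable_def by (subst complex_of_real_integrable_eq) simp
  from lborel_integrable_prod[where f="\<lambda>_::'a. \<lambda>x::real. complex_of_real (inverse (1 + x\<^sup>2))", OF this]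
  have i: "integrable lborel (\<lambda>x::'a. \<Prod>b\<in>Basis. complex_of_real (inverse (1 + (x \<bullet> b)\<^sup>2)))" .
  show ?thesis
  proof (rule Bochner_Integration.integrable_bound[OF i])
    show "(\<lambda>x::'a. 1 / (1 + norm x) ^ (2 * DIM('a))) \<in> borel_measurable lborel"
      by measurable
    have "1 / (1 + norm x) ^ (2 * DIM('a)) \<le> (\<Prod>b\<in>Basis. inverse (1 + (x \<bullet> b)\<^sup>2))" for x :: 'a
    proof -
      have "(\<Prod>b\<in>(Basis::'a set). inverse ((1 + norm x)\<^sup>2)) \<le> (\<Prod>b\<in>Basis. inverse (1 + (x \<bullet> b)\<^sup>2))"
      proof (rule prod_mono, intro conjI le_imp_inverse_le)
        fix b :: 'a assume "b \<in> Basis"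
        then have "(x \<bullet> b)\<^sup>2 \<le> (norm x)\<^sup>2"
          using Basis_le_norm[of b x] by (simp add: abs_le_square_iff[symmetric])
        then show "1 + (x \<bullet> b)\<^sup>2 \<le> (1 + norm x)\<^sup>2"
          using norm_ge_zero[of x] by (simp add: power2_eq_square algebra_simps del: norm_ge_zero)
      qed (auto simp: add_pos_nonneg)
      then show ?thesis
        by (simp add: power_mult[symmetric] divide_inverse power_inverse[symmetric])
    qed
    then show "AE x::'a in lborel. norm (1 / (1 + norm x) ^ (2 * DIM('a)))
        \<le> norm (\<Prod>b\<in>Basis. complex_of_real (inverse (1 + (x \<bullet> b)\<^sup>2)))"
      unfolding of_real_prod[symmetric] norm_of_real
      by (auto intro: order_trans[OF _ abs_ge_self])
  qed
qed

section \<open>Limits and integrability criteria for integrals with a parameter\<close>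

lemma integral_dominated_convergence_at_right:
  fixes s :: "real \<Rightarrow> 'a \<Rightarrow> complex"
  assumes "f \<in> borel_measurable M" "\<And>t. t > 0 \<Longrightarrow> s t \<in> borel_measurable M" "integrable M w"
    and lim: "AE x in M. ((\<lambda>t. s t x) \<longlongrightarrow> f x) (at_right 0)"
    and bound: "\<And>t x. t > 0 \<Longrightarrow> norm (s t x) \<le> w x"
  shows "((\<lambda>t. integral\<^sup>L M (s t)) \<longlongrightarrow> integral\<^sup>L M f) (at_right 0)"
proof -
  \<comment> \<open>The inversion of \<open>t\<close> moves the limit from 0 to infinity. For
    nonpositive \<open>t\<close> the value \<open>s 1\<close> is a dummy that keeps
    \<open>s' t\<close> measurable and dominated for all \<open>t\<close>.\<close>
  define s' where "s' t = (if t > 0 then s (inverse t) else s 1)" for t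
  have "((\<lambda>t. integral\<^sup>L M (s' t)) \<longlongrightarrow> integral\<^sup>L M f) at_top"
  proof (rule integral_dominated_convergence_at_top)
    show "AE x in M. ((\<lambda>t. s' t x) \<longlongrightarrow> f x) at_top"
      using lim
    proof eventually_elim
      case (elim x)
      then have "((\<lambda>t. s (inverse t) x) \<longlongrightarrow> f x) at_top"
        by (simp add: filterlim_at_right_to_top)
      moreover have "\<forall>\<^sub>F t in at_top. s (inverse t) x = s' t x"
        using eventually_gt_at_top[of 0] by eventually_elim (simp add: s'_def)
      ultimately show ?case by (rule Lim_transform_eventually)
    qed
    show "\<forall>\<^sub>F t in at_top. AE x in M. norm (s' t x) \<le> w x"
      by (rule always_eventually) (auto simp: s'_def intro!: bound)
    show "s' t \<in> borel_measurable M" for t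
      using assms(2)[of 1] assms(2)[of "inverse t"] by (cases "t > 0") (simp_all add: s'_def cong: measurable_cong)
  qed (use assms in auto)
  moreover have "\<forall>\<^sub>F t in at_top. integral\<^sup>L M (s' t) = integral\<^sup>L M (s (inverse t))"
    using eventually_gt_at_top[of 0] by eventually_elim (simp add: s'_def)
  ultimately have "((\<lambda>t. integral\<^sup>L M (s (inverse t))) \<longlongrightarrow> integral\<^sup>L M f) at_top"
    by (rule Lim_transform_eventually)
  then show ?thesis
    by (simp add: filterlim_at_right_to_top)
qed

text \<open>The common core of two approximate-identity arguments, for the Mehler kernel and for
  Fourier inversion: after rescaling, the concentrating Gaussian becomes the fixed weight exp (-
  |z|^2), and the concentration moves into the argument of a bounded function that is continuous in
  the parameter.\<close>

lemma gaussian_average_limit: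
  fixes G :: "real \<Rightarrow> 'a::euclidean_space \<Rightarrow> complex"
  assumes cont: "\<And>z. continuous_on UNIV (\<lambda>r. G r z)" and [measurable]: "\<And>r. G r \<in> borel_measurable borel"
    and M: "\<And>r z. r > 0 \<Longrightarrow> norm (G r z) \<le> M" and G0: "\<And>z. G 0 z = c"
  shows "((\<lambda>r. LBINT z. of_real (exp (- (norm z)\<^sup>2)) * G r z) \<longlongrightarrow> of_real (sqrt pi ^ DIM('a)) * c) (at_right 0)"
proof -
  have "((\<lambda>r. LBINT z. of_real (exp (- (norm z)\<^sup>2)) * G r z) \<longlongrightarrow> (LBINT (z::'a). of_real (exp (- (norm z)\<^sup>2)) * c)) (at_right 0)"
  proof (rule integral_dominated_convergence_at_right)
    show "integrable lborel (\<lambda>z::'a. exp (- (norm z)\<^sup>2) * M)" using integrable_gaussian[of 1, where 'a='a] by auto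
    show "norm (of_real (exp (- (norm z)\<^sup>2)) * G r z) \<le> exp (- (norm z)\<^sup>2) * M" if "r > 0" for r z
      unfolding norm_mult norm_of_real using M[OF that] by (intro mult_mono) auto
    show "AE z in lborel. ((\<lambda>r. of_real (exp (- (norm z)\<^sup>2)) * G r z) \<longlongrightarrow> of_real (exp (- (norm z)\<^sup>2)) * c) (at_right 0)"
    proof (intro AE_I2 tendsto_mult_left)
      show "((\<lambda>r. G r z) \<longlongrightarrow> c) (at_right 0)" for z
        using cont[of z] unfolding G0[of z, symmetric] by (meson UNIV_I continuous_on tendsto_within_subset subset_UNIV)
    qed
  qed auto
  moreover have "(LBINT (z::'a). exp (- (norm z)\<^sup>2)) = sqrt pi ^ DIM('a)"
    using gaussian_integral[of 1, where 'a='a] by simp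
  ultimately show ?thesis
    unfolding integral_mult_left_zero integral_complex_of_real by simp
qed

text \<open>For integrands such as a heat kernel at small times, which have no convenient product
  majorant but whose fibres have controlled mass.\<close>

lemma integrable_pair_iterated:
  fixes F :: "'a::euclidean_space \<Rightarrow> 'b::euclidean_space \<Rightarrow> complex"
  assumes F: "(\<lambda>(x, y). F x y) \<in> borel_measurable borel"
    and int: "\<And>x. integrable lborel (F x)" and g: "integrable lborel g"
    and bound: "\<And>x. (LBINT y. norm (F x y)) \<le> g x"
  shows "integrable lborel (\<lambda>(x, y). F x y)"
proof -
  have F': "case_prod F \<in> borel_measurable (lborel \<Otimes>\<^sub>M lborel)"
    using F by (simp add: lborel_prod)
  then have m: "(\<lambda>(x, y). norm (F x y)) \<in> borel_measurable (lborel \<Otimes>\<^sub>M lborel)"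
    by (simp add: split_beta)
  have "integrable (lborel \<Otimes>\<^sub>M lborel) (case_prod F)"
  proof (rule lborel_pair.Fubini_integrable[OF F'])
    show "integrable lborel (\<lambda>x. LBINT y. norm (case (x, y) of (x, y) \<Rightarrow> F x y))"
    proof (rule Bochner_Integration.integrable_bound[OF g])
      show "(\<lambda>x. LBINT y. norm (case (x, y) of (x, y) \<Rightarrow> F x y)) \<in> borel_measurable lborel"
        using lborel.borel_measurable_lebesgue_integral[OF m] by simp
      show "AE x in lborel. norm (LBINT y. norm (case (x, y) of (x, y) \<Rightarrow> F x y)) \<le> norm (g x)"
      proof (rule AE_I2)
        fix x
        have "0 \<le> (LBINT y. norm (F x y))" by (rule Bochner_Integration.integral_nonneg) auto
        then show "norm (LBINT y. norm (case (x, y) of (x, y) \<Rightarrow> F x y)) \<le> norm (g x)"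
          using bound[of x] by simp
      qed
    qed
  qed (use int in auto)
  then show ?thesis by (simp add: lborel_prod)
qed

lemma integrable_dominated:
  fixes f :: "'a::euclidean_space \<Rightarrow> complex"
  assumes "integrable lborel g" "f \<in> borel_measurable borel" "\<And>x. norm (f x) \<le> g x"
  shows "integrable lborel f"
  by (rule Bochner_Integration.integrable_bound[OF assms(1)])
    (use assms in \<open>auto intro!: AE_I2 order_trans[OF assms(3)]\<close>)

lemma integral_01_eq:
  fixes f :: "real \<Rightarrow> complex"
  assumes "continuous_on {a..b} f"
  shows "integral {a..b} f = (LBINT s. of_real (indicator {a..b} s) * f s)"
  using set_borel_integral_eq_integral(2)[OF borel_integrable_atLeastAtMost'[OF assms]]
  by (simp add: set_lebesgue_integral_def scaleR_conv_of_real)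

lemma measurable_cis [measurable]: "cis \<in> borel_measurable borel"
  by (intro borel_measurable_continuous_onI continuous_intros)

lemma measurable_fst_borel [measurable (raw)]:
  fixes f :: "'c \<Rightarrow> 'a::second_countable_topology \<times> 'b::second_countable_topology"
  shows "f \<in> borel_measurable M \<Longrightarrow> (\<lambda>x. fst (f x)) \<in> borel_measurable M"
  by (rule measurable_compose[of f _ borel]) (auto intro!: borel_measurable_continuous_onI continuous_intros)

lemma measurable_snd_borel [measurable (raw)]:
  fixes f :: "'c \<Rightarrow> 'a::second_countable_topology \<times> 'b::second_countable_topology"
  shows "f \<in> borel_measurable M \<Longrightarrow> (\<lambda>x. snd (f x)) \<in> borel_measurable M"
  by (rule measurable_compose[of f _ borel]) (auto intro!: borel_measurable_continuous_onI continuous_intros)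

section \<open>Schwartz functions and amplitudes\<close>

lemma partial_deriv_eq: "(f has_derivative f') (at x) \<Longrightarrow> partial_deriv i f x = f' i"
  unfolding partial_deriv_def by (metis frechet_derivative_at)

lemma iter_deriv_Nil [simp]: "iter_deriv [] f = f"
  and iter_deriv_Cons [simp]: "iter_deriv (b # bs) f = partial_deriv b (iter_deriv bs f)"
  and iter_deriv_snoc: "iter_deriv (bs @ [b]) f = iter_deriv bs (partial_deriv b f)"
  by (simp_all add: iter_deriv_def)

lemma smooth_has_derivative: "smooth f \<Longrightarrow> (f has_derivative frechet_derivative f (at x)) (at x)"
  unfolding smooth_def by (drule bspec[of _ _ "[]"])
    (auto simp: differentiable_on_def frechet_derivative_works)

lemma smooth_continuous: "smooth f \<Longrightarrow> continuous_on UNIV f"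
  by (auto intro!: continuous_at_imp_continuous_on has_derivative_continuous smooth_has_derivative)

lemma smooth_partial_deriv:
  assumes "smooth f" "i \<in> Basis" shows "smooth (partial_deriv i f)"
  unfolding smooth_def
proof
  fix bs :: "'a list" assume "bs \<in> lists Basis"
  then have "bs @ [i] \<in> lists Basis" using assms by auto
  then show "iter_deriv bs (partial_deriv i f) differentiable_on UNIV"
    using assms unfolding smooth_def iter_deriv_snoc[symmetric] by blast
qed

lemma iter_deriv_closed:
  assumes "P f" and "\<And>g i. P g \<Longrightarrow> i \<in> Basis \<Longrightarrow> P (partial_deriv i g)" and "bs \<in> lists Basis"
  shows "P (iter_deriv bs f)"
  using assms(3) by (induction bs) (auto intro: assms)

text \<open>Smoothness by coinduction: it suffices to exhibit a class of differentiable functions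
  that is closed under partial derivatives, and higher derivatives need never be written
  down.\<close>

lemma smooth_coinduct:
  assumes "P f" and "\<And>g i. P g \<Longrightarrow> i \<in> Basis \<Longrightarrow> P (partial_deriv i g)"
    and "\<And>g. P g \<Longrightarrow> g differentiable_on UNIV"
  shows "smooth f"
  unfolding smooth_def by (intro ballI assms(3)) (rule iter_deriv_closed[where P=P, OF assms(1,2)])

lemma schwartz_smooth: "schwartz f \<Longrightarrow> smooth f"
  by (simp add: schwartz_def)

lemma schwartz_partial_deriv:
  assumes f: "schwartz f" and i: "i \<in> Basis" shows "schwartz (partial_deriv i f)"
  unfolding schwartz_def
proof (intro conjI ballI)
  show "smooth (partial_deriv i f)" using assms by (simp add: smooth_partial_deriv schwartz_smooth)
  fix bs :: "'a list" assume "bs \<in> lists Basis"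
  then have "bs @ [i] \<in> lists Basis" using assms by auto
  then show "\<forall>k::nat. \<exists>C. \<forall>x. (1 + norm x) ^ k * norm (iter_deriv bs (partial_deriv i f) x) \<le> C"
    using f unfolding schwartz_def iter_deriv_snoc[symmetric] by blast
qed

lemma schwartz_bound:
  assumes "schwartz f"
  obtains C where "C \<ge> 0" "\<And>x. norm (f x) \<le> C / (1 + norm x) ^ k"
proof -
  obtain C where C: "\<And>x. (1 + norm x) ^ k * norm (f x) \<le> C"
    using assms unfolding schwartz_def by (metis iter_deriv_Nil lists.Nil)
  have "0 \<le> C" using C[of 0] norm_ge_zero[of "f 0"] by (simp del: norm_ge_zero)
  moreover have "norm (f x) \<le> C / (1 + norm x) ^ k" for x
    using C[of x] by (simp add: pos_le_divide_eq add_pos_nonneg mult.commute)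
  ultimately show thesis by (rule that)
qed

lemma schwartz_bounded:
  assumes "schwartz f" obtains C where "C \<ge> 0" "\<And>x. norm (f x) \<le> C"
  by (rule schwartz_bound[OF assms, of 0]) (rule that, auto)

lemma schwartz_continuous: "schwartz f \<Longrightarrow> continuous_on UNIV f"
  by (simp add: schwartz_smooth smooth_continuous)

lemma schwartz_measurable: "schwartz f \<Longrightarrow> f \<in> borel_measurable borel"
  by (simp add: borel_measurable_continuous_onI schwartz_continuous)

lemma schwartz_integrable_power:
  fixes f :: "'a::euclidean_space \<Rightarrow> complex"
  assumes f: "schwartz f" shows "integrable lborel (\<lambda>x. (1 + norm x) ^ k * norm (f x))"
proof -
  note [measurable] = schwartz_measurable[OF f]
  obtain C where C: "C \<ge> 0" "\<And>x. norm (f x) \<le> C / (1 + norm x) ^ (k + 2 * DIM('a))"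
    using schwartz_bound[OF f] by metis
  have "integrable lborel (\<lambda>x::'a. C * (1 / (1 + norm x) ^ (2 * DIM('a))))"
    by (intro integrable_mult_right integrable_inverse_power)
  then show ?thesis
  proof (rule Bochner_Integration.integrable_bound)
    have "(1 + norm x) ^ k * norm (f x) \<le> C * (1 / (1 + norm x) ^ (2 * DIM('a)))" for x
    proof -
      have p: "(1 + norm x) ^ k > 0" by (simp add: add_pos_nonneg)
      show ?thesis
        using mult_left_mono[OF C(2)[of x] less_imp_le[OF p]] p unfolding power_add
        by (metis mult.right_neutral mult_divide_mult_cancel_left not_less_iff_gr_or_eq times_divide_eq_right)
    qed
    then show "AE x in lborel. norm ((1 + norm x) ^ k * norm (f x)) \<le> norm (C * (1 / (1 + norm x) ^ (2 * DIM('a))))"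
      using C(1) by auto
  qed measurable
qed

lemma schwartz_integrable: "schwartz f \<Longrightarrow> integrable lborel f"
  by (rule integrable_norm_cancel) (use schwartz_integrable_power[of f 0] schwartz_measurable[of f] in auto)

lemma schwartz_integrable_mult:
  fixes \<phi> :: "'a::euclidean_space \<Rightarrow> complex"
  assumes \<phi>: "schwartz \<phi>" and p: "p \<in> borel_measurable borel" "\<And>x. norm (p x) \<le> C * (1 + norm x) ^ k"
  shows "integrable lborel (\<lambda>x. p x * \<phi> x)"
proof (rule integrable_dominated[OF integrable_mult_right[OF schwartz_integrable_power[OF \<phi>, of k], of C]])
  show "(\<lambda>x. p x * \<phi> x) \<in> borel_measurable borel"
    using schwartz_measurable[OF \<phi>] p(1) by measurable
  show "norm (p x * \<phi> x) \<le> C * ((1 + norm x) ^ k * norm (\<phi> x))" for x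
    unfolding norm_mult mult.assoc[symmetric] by (intro mult_right_mono p) auto
qed

text \<open>Averaging \<open>G (x + v) - G x\<close> over \<open>x\<close> in two ways.\<close>

lemma integral_directional_derivative:
  fixes G :: "'a::euclidean_space \<Rightarrow> complex"
  assumes G: "\<And>x. (G has_derivative G' x) (at x)"
    and cont: "continuous_on UNIV (\<lambda>x. G' x v)"
    and int: "integrable lborel G" "integrable lborel (\<lambda>x. G' x v)"
  shows "(LBINT x. G' x v) = 0"
proof -
  let ?I = "LBINT x. G' x v"
  define F where "F s x = indicator {0..1} s *\<^sub>R G' (x + s *\<^sub>R v) v" for s x
  have cont': "continuous_on S (\<lambda>s. G' (x + s *\<^sub>R v) v)" for x S
    by (rule continuous_on_compose2[OF cont]) (auto intro!: continuous_intros)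
  have [measurable]: "(\<lambda>x. G' x v) \<in> borel_measurable borel"
    by (rule borel_measurable_continuous_onI[OF cont])
  have FTC: "(LBINT s. F s x) = G (x + v) - G x" for x
  proof -
    have "((\<lambda>s. G (x + s *\<^sub>R v)) has_vector_derivative G' (x + s *\<^sub>R v) v) (at s within {0..1})" for s
    proof -
      have "((\<lambda>s. G (x + s *\<^sub>R v)) has_derivative (\<lambda>h. G' (x + s *\<^sub>R v) (h *\<^sub>R v))) (at s within {0..1})"
        by (rule has_derivative_compose[OF _ G]) (auto intro!: derivative_eq_intros)
      then show ?thesis
        by (simp add: has_vector_derivative_def linear_scale[OF has_derivative_linear[OF G]])
    qed
    then show ?thesis
      unfolding F_def by (subst integral_FTC_Icc) (auto intro!: cont')
  qed
  have shift: "integrable lborel (\<lambda>x. G' (x + s *\<^sub>R v) v)" "(LBINT x. G' (x + s *\<^sub>R v) v) = ?I"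
    "(LBINT x. norm (G' (x + s *\<^sub>R v) v)) = (LBINT x. norm (G' x v))" for s
    using lborel_integrable_affine[OF _ int(2), of 1 "s *\<^sub>R v"]
      lborel_integral_affine[of 1 "\<lambda>x. G' x v" "s *\<^sub>R v"]
      lborel_integral_affine[of 1 "\<lambda>x. norm (G' x v)" "s *\<^sub>R v"] by (simp_all add: add.commute)
  have shiftG: "integrable lborel (\<lambda>x. G (x + v))" "(LBINT x. G (x + v)) = (LBINT x. G x)"
    using lborel_integrable_affine[OF _ int(1), of 1 v] borel_measurable_integrable[OF int(1)]
      lborel_integral_affine[of 1 G v] by (simp_all add: add.commute)
  have ind: "integrable lborel (\<lambda>s::real. indicator {0..1} s * c)" for c :: real
    by (intro integrable_mult_left integrable_real_indicator) auto
  have "integrable (lborel \<Otimes>\<^sub>M lborel) (\<lambda>(s, x). F s x)"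
  proof (rule lborel_pair.Fubini_integrable)
    show "(\<lambda>(s, x). F s x) \<in> borel_measurable (lborel \<Otimes>\<^sub>M lborel)"
      unfolding F_def by measurable
    show "integrable lborel (\<lambda>s. LBINT x. norm (case (s, x) of (s, x) \<Rightarrow> F s x))"
      using ind[of "LBINT x. norm (G' x v)"] shift(3) by (simp add: F_def)
    show "AE s in lborel. integrable lborel (\<lambda>x. case (s, x) of (s, x) \<Rightarrow> F s x)"
      using shift(1) by (simp add: F_def)
  qed
  then have int': "integrable lborel (\<lambda>(s, x). F s x)" by (simp add: lborel_prod)
  have "?I = (LBINT s. indicator {0..1::real} s *\<^sub>R ?I)"
  proof -
    have "has_bochner_integral lborel (\<lambda>s::real. indicator {0..1} s *\<^sub>R ?I) (measure lborel {0..1::real} *\<^sub>R ?I)"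
      by (rule has_bochner_integral_indicator) auto
    from has_bochner_integral_integral_eq[OF this, symmetric] show ?thesis by simp
  qed
  also have "\<dots> = (LBINT s. (LBINT x. F s x))"
    by (simp add: F_def shift)
  also have "\<dots> = (LBINT x. G (x + v) - G x)"
    unfolding integral_iterated_swap[OF int'] FTC ..
  also have "\<dots> = 0"
    using shiftG int by simp
  finally show ?thesis .
qed

text \<open>Fixing the common exponent \<open>m\<close> gives a class closed under partial
  derivatives with the same \<open>m\<close>; repeated integration by parts relies on this.\<close>

definition amplitude_of_order :: "nat \<Rightarrow> ('a::euclidean_space \<Rightarrow> complex) \<Rightarrow> bool" where
  "amplitude_of_order m a \<longleftrightarrow> smooth a \<and>
     (\<forall>bs \<in> lists Basis. \<exists>C. \<forall>X. norm (iter_deriv bs a X) \<le> C * (1 + norm X) ^ m)"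

lemma amplitude_iff: "amplitude a \<longleftrightarrow> (\<exists>m. amplitude_of_order m a)"
  unfolding amplitude_def amplitude_of_order_def by blast

lemma amplitude_of_order_partial_deriv:
  assumes a: "amplitude_of_order m a" and i: "i \<in> Basis"
  shows "amplitude_of_order m (partial_deriv i a)"
  unfolding amplitude_of_order_def
proof (intro conjI ballI)
  show "smooth (partial_deriv i a)" using assms by (simp add: smooth_partial_deriv amplitude_of_order_def)
  fix bs :: "'a list" assume "bs \<in> lists Basis"
  then have "bs @ [i] \<in> lists Basis" using assms by auto
  then show "\<exists>C. \<forall>x. norm (iter_deriv bs (partial_deriv i a) x) \<le> C * (1 + norm x) ^ m"
    using a unfolding amplitude_of_order_def iter_deriv_snoc[symmetric] by blast
qed

lemma amplitude_continuous: "amplitude_of_order m a \<Longrightarrow> continuous_on UNIV a"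
  by (simp add: amplitude_of_order_def smooth_continuous)

lemma amplitude_bound:
  assumes "amplitude_of_order m a"
  obtains C where "C \<ge> 0" "\<And>X. norm (a X) \<le> C * (1 + norm X) ^ m"
proof -
  obtain C where C: "\<And>X. norm (a X) \<le> C * (1 + norm X) ^ m"
    using assms unfolding amplitude_of_order_def by (metis iter_deriv_Nil lists.Nil)
  have "0 \<le> C" using C[of 0] norm_ge_zero[of "a 0"] by (simp del: norm_ge_zero)
  then show thesis using C by (rule that)
qed

text \<open>1 + |x| + |y| + |\<xi>| is at most the product of the three factors. Separating the
  variables lets each be paid for on its own: \<open>y\<close> by the Schwartz function, \<xi> by
  the cutoff, while \<open>x\<close> is a parameter.\<close>

lemma amplitude_bound_midpoint:
  fixes a :: "'a::euclidean_space \<times> 'a \<Rightarrow> complex"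
  assumes "amplitude_of_order m a"
  obtains C where "C \<ge> 0"
    "\<And>x y \<xi>. norm (a ((x + y) /\<^sub>R 2, \<xi>)) \<le> C * (1 + norm x) ^ m * (1 + norm y) ^ m * (1 + norm \<xi>) ^ m"
proof -
  obtain C where C: "C \<ge> 0" "\<And>X. norm (a X) \<le> C * (1 + norm X) ^ m"
    using amplitude_bound[OF assms] by blast
  have "norm (a ((x + y) /\<^sub>R 2, \<xi>)) \<le> C * (1 + norm x) ^ m * (1 + norm y) ^ m * (1 + norm \<xi>) ^ m" for x y \<xi>
  proof -
    have n: "norm x \<ge> 0" "norm y \<ge> 0" "norm \<xi> \<ge> 0" by auto
    have "norm ((x + y) /\<^sub>R 2, \<xi>) \<le> norm ((x + y) /\<^sub>R 2) + norm \<xi>"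
      by (rule norm_Pair_le)
    also have "norm ((x + y) /\<^sub>R 2) \<le> norm x + norm y"
    proof -
      have "norm ((x + y) /\<^sub>R 2) = norm (x + y) / 2"
        by (simp only: norm_scaleR) simp
      then show ?thesis using norm_triangle_ineq[of x y] n by linarith
    qed
    finally have "1 + norm ((x + y) /\<^sub>R 2, \<xi>) \<le> 1 + (norm x + norm y + norm \<xi>)" by simp
    also have "\<dots> \<le> (1 + norm x) * (1 + norm y) * (1 + norm \<xi>)"
      using n by (simp add: algebra_simps)
    finally have "(1 + norm ((x + y) /\<^sub>R 2, \<xi>)) ^ m \<le> ((1 + norm x) * (1 + norm y) * (1 + norm \<xi>)) ^ m"
      by (intro power_mono) auto
    from order_trans[OF C(2) mult_left_mono[OF this C(1)]] show ?thesis
      by (simp add: power_mult_distrib mult_ac)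
  qed
  with C(1) show thesis by (rule that)
qed


section \<open>Weyl quantization of amplitudes\<close>

text \<open>The \<open>y\<close>-integral is absolutely convergent at fixed frequency. The factor
  \<open>cis (x \<bullet> \<xi>)\<close> is left outside, so that \<open>x\<close> enters only
  through the amplitude.\<close>

definition inner_integral ::
    "('a::euclidean_space \<times> 'a \<Rightarrow> complex) \<Rightarrow> ('a \<Rightarrow> complex) \<Rightarrow> 'a \<Rightarrow> 'a \<Rightarrow> complex" where
  "inner_integral a f x \<xi> = (LBINT y. cis (- (y \<bullet> \<xi>)) * (a ((x + y) /\<^sub>R 2, \<xi>) * f y))"

lemma continuous_on_UNIV_compose:
  "continuous_on UNIV f \<Longrightarrow> continuous_on S g \<Longrightarrow> continuous_on S (\<lambda>x. f (g x))"
  by (rule continuous_on_compose2) auto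

lemma borel_measurable_parameter_integral:
  fixes F :: "'a::euclidean_space \<Rightarrow> 'b::euclidean_space \<Rightarrow> complex"
  assumes "(\<lambda>(z, y). F z y) \<in> borel_measurable borel"
  shows "(\<lambda>z. LBINT y. F z y) \<in> borel_measurable borel"
proof -
  have "case_prod F \<in> borel_measurable (borel \<Otimes>\<^sub>M lborel)"
    using assms by (subst measurable_cong_sets[OF sets_pair_measure_cong[OF refl sets_lborel] refl])
      (simp add: borel_prod)
  then show ?thesis by (rule lborel.borel_measurable_lebesgue_integral)
qed

lemma has_derivative_cexp:
  fixes g :: "'a::real_normed_vector \<Rightarrow> complex"
  assumes "(g has_derivative g') (at x within S)"
  shows "((\<lambda>x. exp (g x)) has_derivative (\<lambda>h. exp (g x) * g' h)) (at x within S)"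
  using has_derivative_compose[OF assms has_field_derivative_imp_has_derivative[OF DERIV_exp]]
  by simp

context
  fixes a :: "'a::euclidean_space \<times> 'a \<Rightarrow> complex" and f :: "'a \<Rightarrow> complex" and m :: nat
  assumes a: "amplitude_of_order m a" and f: "schwartz f"
begin

lemma inner_integral_measurable: "(\<lambda>(x, \<xi>). inner_integral a f x \<xi>) \<in> borel_measurable borel"
  unfolding inner_integral_def split_beta
  by (intro borel_measurable_parameter_integral borel_measurable_continuous_onI)
    (auto simp: split_beta intro!: continuous_intros
        continuous_on_UNIV_compose[OF amplitude_continuous[OF a]]
        continuous_on_UNIV_compose[OF schwartz_continuous[OF f]])

lemma inner_integral_measurable' [measurable]: "inner_integral a f x \<in> borel_measurable borel"
proof -
  have "(\<lambda>\<xi>. (x, \<xi>)) \<in> borel_measurable borel"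
    by (intro borel_measurable_continuous_onI continuous_intros)
  from measurable_compose[OF this inner_integral_measurable] show ?thesis by simp
qed

text \<open>The bound after zero integrations by parts, growing in \<xi> like the amplitude. It
  starts the induction for the decay estimate and controls small frequencies there.\<close>

lemma inner_integral_bound_0:
  obtains C where "C \<ge> 0"
    "\<And>x \<xi>. integrable lborel (\<lambda>y. cis (- (y \<bullet> \<xi>)) * (a ((x + y) /\<^sub>R 2, \<xi>) * f y))"
    "\<And>x \<xi>. norm (inner_integral a f x \<xi>) \<le> C * (1 + norm x) ^ m * (1 + norm \<xi>) ^ m"
proof -
  obtain C where C: "C \<ge> 0"
    "\<And>x y \<xi>. norm (a ((x + y) /\<^sub>R 2, \<xi>)) \<le> C * (1 + norm x) ^ m * (1 + norm y) ^ m * (1 + norm \<xi>) ^ m"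
    using amplitude_bound_midpoint[OF a] by blast
  let ?w = "\<lambda>y. (1 + norm y) ^ m * norm (f y)"
  have w: "integrable lborel ?w" by (rule schwartz_integrable_power[OF f])
  define D where "D = C * (LBINT y. ?w y)"
  have b: "norm (cis (- (y \<bullet> \<xi>)) * (a ((x + y) /\<^sub>R 2, \<xi>) * f y)) \<le> C * (1 + norm x) ^ m * (1 + norm \<xi>) ^ m * ?w y" for x y \<xi>
    using mult_right_mono[OF C(2)[of x y \<xi>] norm_ge_zero[of "f y"]] by (simp add: norm_mult mult_ac)
  have i: "integrable lborel (\<lambda>y. C * (1 + norm x) ^ m * (1 + norm \<xi>) ^ m * ?w y)" for x \<xi> :: 'a
    by (intro integrable_mult_right w)
  have int: "integrable lborel (\<lambda>y. cis (- (y \<bullet> \<xi>)) * (a ((x + y) /\<^sub>R 2, \<xi>) * f y))" for x \<xi>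
    by (rule integrable_dominated[OF i _ b]) (intro borel_measurable_continuous_onI continuous_intros
        continuous_on_UNIV_compose[OF amplitude_continuous[OF a]] schwartz_continuous[OF f])
  have "norm (inner_integral a f x \<xi>) \<le> (LBINT y. C * (1 + norm x) ^ m * (1 + norm \<xi>) ^ m * ?w y)" for x \<xi>
    unfolding inner_integral_def
    by (rule Bochner_Integration.integral_norm_bound_integral[OF int i b])
  then have "norm (inner_integral a f x \<xi>) \<le> D * (1 + norm x) ^ m * (1 + norm \<xi>) ^ m" for x \<xi>
    unfolding integral_mult_right_zero D_def by (metis (no_types, lifting) mult.assoc mult.commute)
  moreover have "D \<ge> 0" unfolding D_def using C by (intro mult_nonneg_nonneg integral_nonneg) auto
  ultimately show thesis using int that by blast
qed

end

section \<open>Decay of the inner integral in the frequency\<close>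

lemma integrand_integrable:
  assumes "amplitude_of_order m a" and "schwartz f"
  shows "integrable lborel (\<lambda>y. cis (- (y \<bullet> \<xi>)) * (a ((x + y) /\<^sub>R 2, \<xi>) * f y))"
  by (rule inner_integral_bound_0[OF assms])

text \<open>A factor \<xi>_i is, up to a constant, a \<open>y\<close>-derivative of the exponential,
  which is moved onto \<open>a\<close> and \<open>f\<close>. Both terms on the right are again inner
  integrals of the same type, so the step can be repeated. The factor 1/2 from the midpoint is
  estimated by 1.\<close>

lemma inner_integral_by_parts:
  fixes a :: "'a::euclidean_space \<times> 'a \<Rightarrow> complex"
  assumes a: "amplitude_of_order m a" and f: "schwartz f" and i: "i \<in> Basis"
  shows "\<bar>\<xi> \<bullet> i\<bar> * norm (inner_integral a f x \<xi>)
    \<le> norm (inner_integral (partial_deriv (i, 0) a) f x \<xi>) + norm (inner_integral a (partial_deriv i f) x \<xi>)"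
proof -
  have i0: "(i, 0) \<in> (Basis :: ('a \<times> 'a) set)" using i by (simp add: Basis_prod_def)
  let ?G = "\<lambda>a f y. cis (- (y \<bullet> \<xi>)) * (a ((x + y) /\<^sub>R 2, \<xi>) * f y)"
  let ?a' = "partial_deriv (i, 0) a" and ?f' = "partial_deriv i f"
  note a' = amplitude_of_order_partial_deriv[OF a i0] and f' = schwartz_partial_deriv[OF f i]
  define D where "D y h = cis (- (y \<bullet> \<xi>)) * (a ((x + y) /\<^sub>R 2, \<xi>) * frechet_derivative f (at y) h
      + frechet_derivative a (at ((x + y) /\<^sub>R 2, \<xi>)) (h /\<^sub>R 2, 0) * f y)
    + cis (- (y \<bullet> \<xi>)) * (\<i> * of_real (- (h \<bullet> \<xi>))) * (a ((x + y) /\<^sub>R 2, \<xi>) * f y)" for y h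
  have da: "(a has_derivative frechet_derivative a (at X)) (at X)" for X
    using a by (simp add: amplitude_of_order_def smooth_has_derivative)
  have df: "(f has_derivative frechet_derivative f (at y)) (at y)" for y
    using f by (simp add: schwartz_def smooth_has_derivative)
  have D: "(?G a f has_derivative D y) (at y)" for y
  proof -
    have 1: "((\<lambda>y. a ((x + y) /\<^sub>R 2, \<xi>)) has_derivative
        (\<lambda>h. frechet_derivative a (at ((x + y) /\<^sub>R 2, \<xi>)) (h /\<^sub>R 2, 0))) (at y)"
      by (rule has_derivative_compose[OF _ da]) (auto intro!: derivative_eq_intros)
    have 2: "((\<lambda>y. exp (\<i> * of_real (- (y \<bullet> \<xi>)))) has_derivative
        (\<lambda>h. exp (\<i> * of_real (- (y \<bullet> \<xi>))) * (\<i> * of_real (- (h \<bullet> \<xi>))))) (at y)"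
      by (rule has_derivative_cexp) (auto intro!: derivative_eq_intros)
    show ?thesis
      using has_derivative_mult[OF 2 has_derivative_mult[OF 1 df]]
      unfolding D_def cis_conv_exp by simp
  qed
  have D_i: "D y i = ?G ?a' f y / 2 + ?G a ?f' y - \<i> * (\<xi> \<bullet> i) * ?G a f y" for y
  proof -
    have "frechet_derivative a (at ((x + y) /\<^sub>R 2, \<xi>)) (i /\<^sub>R 2, 0)
        = frechet_derivative a (at ((x + y) /\<^sub>R 2, \<xi>)) ((1 / 2) *\<^sub>R (i, 0))" by simp
    also have "\<dots> = ?a' ((x + y) /\<^sub>R 2, \<xi>) / 2"
      unfolding linear_scale[OF has_derivative_linear[OF da]] partial_deriv_def
      by (simp add: scaleR_conv_of_real)
    finally show ?thesis
      by (simp add: D_def partial_deriv_def algebra_simps inner_commute)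
  qed
  have int: "integrable lborel (?G a f)" "integrable lborel (?G ?a' f)" "integrable lborel (?G a ?f')"
    by (rule integrand_integrable[OF a f] integrand_integrable[OF a' f] integrand_integrable[OF a f'])+
  have "(LBINT y. D y i) = 0"
  proof (rule integral_directional_derivative[OF D])
    show "continuous_on UNIV (\<lambda>y. D y i)"
      unfolding D_i
      by (intro continuous_intros continuous_on_UNIV_compose[OF amplitude_continuous[OF a]]
          continuous_on_UNIV_compose[OF amplitude_continuous[OF a']]
          continuous_on_UNIV_compose[OF schwartz_continuous[OF f]]
          continuous_on_UNIV_compose[OF schwartz_continuous[OF f']]) auto
  qed (use int in \<open>auto simp: D_i\<close>)
  then have "inner_integral ?a' f x \<xi> / 2 + inner_integral a ?f' x \<xi> - \<i> * (\<xi> \<bullet> i) * inner_integral a f x \<xi> = 0"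
    unfolding D_i inner_integral_def using int by simp
  then have "norm (\<i> * (\<xi> \<bullet> i) * inner_integral a f x \<xi>) = norm (inner_integral ?a' f x \<xi> / 2 + inner_integral a ?f' x \<xi>)"
    by simp
  also have "\<dots> \<le> norm (inner_integral ?a' f x \<xi> / 2) + norm (inner_integral a ?f' x \<xi>)"
    by (rule norm_triangle_ineq)
  also have "norm (inner_integral ?a' f x \<xi> / 2) \<le> norm (inner_integral ?a' f x \<xi>)"
    by (simp add: norm_divide)
  finally show ?thesis by (simp add: norm_mult)
qed

lemma inner_integral_decay_direction:
  fixes a :: "'a::euclidean_space \<times> 'a \<Rightarrow> complex"
  assumes "amplitude_of_order m a" and "schwartz f" and i: "i \<in> Basis"
  shows "\<exists>C\<ge>0. \<forall>x \<xi>. \<bar>\<xi> \<bullet> i\<bar> ^ N * norm (inner_integral a f x \<xi>) \<le> C * (1 + norm x) ^ m * (1 + norm \<xi>) ^ m"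
  using assms(1,2)
proof (induction N arbitrary: a f)
  case 0
  then show ?case by (auto intro: inner_integral_bound_0[OF 0])
next
  case (Suc N)
  have i0: "(i, 0) \<in> (Basis :: ('a \<times> 'a) set)" using i by (simp add: Basis_prod_def)
  note a' = amplitude_of_order_partial_deriv[OF Suc.prems(1) i0] and f' = schwartz_partial_deriv[OF Suc.prems(2) i]
  obtain C1 where C1: "C1 \<ge> 0" "\<And>x \<xi>. \<bar>\<xi> \<bullet> i\<bar> ^ N * norm (inner_integral (partial_deriv (i, 0) a) f x \<xi>)
      \<le> C1 * (1 + norm x) ^ m * (1 + norm \<xi>) ^ m"
    using Suc.IH[OF a' Suc.prems(2)] by blast
  obtain C2 where C2: "C2 \<ge> 0" "\<And>x \<xi>. \<bar>\<xi> \<bullet> i\<bar> ^ N * norm (inner_integral a (partial_deriv i f) x \<xi>)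
      \<le> C2 * (1 + norm x) ^ m * (1 + norm \<xi>) ^ m"
    using Suc.IH[OF Suc.prems(1) f'] by blast
  have "\<bar>\<xi> \<bullet> i\<bar> ^ Suc N * norm (inner_integral a f x \<xi>) \<le> (C1 + C2) * (1 + norm x) ^ m * (1 + norm \<xi>) ^ m" for x \<xi>
  proof -
    have "\<bar>\<xi> \<bullet> i\<bar> ^ Suc N * norm (inner_integral a f x \<xi>) = \<bar>\<xi> \<bullet> i\<bar> ^ N * (\<bar>\<xi> \<bullet> i\<bar> * norm (inner_integral a f x \<xi>))"
      by simp
    also have "\<dots> \<le> \<bar>\<xi> \<bullet> i\<bar> ^ N * (norm (inner_integral (partial_deriv (i, 0) a) f x \<xi>)
        + norm (inner_integral a (partial_deriv i f) x \<xi>))"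
      by (intro mult_left_mono inner_integral_by_parts[OF Suc.prems i]) auto
    also have "\<dots> \<le> (C1 + C2) * (1 + norm x) ^ m * (1 + norm \<xi>) ^ m"
      using C1(2)[of \<xi> x] C2(2)[of \<xi> x] by (simp add: algebra_simps)
    finally show ?thesis .
  qed
  with C1(1) C2(1) show ?case by (metis add_nonneg_nonneg)
qed

lemma ex_large_coordinate:
  fixes x :: "'a::euclidean_space"
  obtains i where "i \<in> Basis" "norm x \<le> DIM('a) * \<bar>x \<bullet> i\<bar>"
proof -
  have fin: "finite ((\<lambda>i. \<bar>x \<bullet> i\<bar>) ` Basis)" "(\<lambda>i. \<bar>x \<bullet> i\<bar>) ` (Basis::'a set) \<noteq> {}" by auto
  obtain i where i: "i \<in> Basis" "Max ((\<lambda>i. \<bar>x \<bullet> i\<bar>) ` Basis) = \<bar>x \<bullet> i\<bar>"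
    using Max_in[OF fin] unfolding image_iff by blast
  have "norm x \<le> (\<Sum>b\<in>Basis. \<bar>x \<bullet> b\<bar>)" by (rule norm_le_l1)
  also have "\<dots> \<le> (\<Sum>b\<in>(Basis::'a set). \<bar>x \<bullet> i\<bar>)"
    unfolding i(2)[symmetric] by (intro sum_mono Max_ge fin) auto
  finally show thesis using i(1) that by simp
qed

lemma inner_integral_decay:
  fixes a :: "'a::euclidean_space \<times> 'a \<Rightarrow> complex"
  assumes a: "amplitude_of_order m a" and f: "schwartz f"
  obtains C where "C \<ge> 0"
    "\<And>x \<xi>. norm (inner_integral a f x \<xi>) \<le> C * (1 + norm x) ^ m * (1 / (1 + norm \<xi>) ^ (2 * DIM('a)))"
proof -
  \<comment> \<open>\<open>m\<close> of these powers cancel the growth of the amplitude, the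
    remaining \<open>2 * DIM('a)\<close> make the result integrable.\<close>
  define K where "K = m + 2 * DIM('a)"
  define d where "d = 1 + real DIM('a)"
  obtain C0 where C0: "C0 \<ge> 0" "\<And>x \<xi>. norm (inner_integral a f x \<xi>) \<le> C0 * (1 + norm x) ^ m * (1 + norm \<xi>) ^ m"
    using inner_integral_bound_0[OF a f] by metis
  obtain c where c: "\<And>i. i \<in> Basis \<Longrightarrow> c i \<ge> 0"
    "\<And>i x \<xi>. i \<in> Basis \<Longrightarrow> \<bar>\<xi> \<bullet> i\<bar> ^ K * norm (inner_integral a f x \<xi>) \<le> c i * (1 + norm x) ^ m * (1 + norm \<xi>) ^ m"
    using inner_integral_decay_direction[OF a f, of _ K] by metis
  define C where "C = d ^ K * (C0 + sum c Basis)"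
  have "norm (inner_integral a f x \<xi>) \<le> C * (1 + norm x) ^ m * (1 / (1 + norm \<xi>) ^ (2 * DIM('a)))" for x \<xi>
  proof -
    let ?w = "norm (inner_integral a f x \<xi>)" and ?p = "(1 + norm x) ^ m" and ?q = "(1 + norm \<xi>) ^ m"
    \<comment> \<open>Decay along a dominant coordinate is decay in the norm. The coordinate depends
      on \<xi>, which is why \<open>C\<close> sums over all directions; the maximum with 1 below
      covers small \<xi> through the crude bound \<open>C0\<close>.\<close>
    obtain i where i: "i \<in> Basis" "norm \<xi> \<le> DIM('a) * \<bar>\<xi> \<bullet> i\<bar>"
      by (rule ex_large_coordinate)
    have "1 + norm \<xi> \<le> d * max 1 \<bar>\<xi> \<bullet> i\<bar>"
    proof -
      have "norm \<xi> \<le> DIM('a) * max 1 \<bar>\<xi> \<bullet> i\<bar>"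
        by (rule order_trans[OF i(2)]) (intro mult_left_mono, auto)
      then show ?thesis by (simp add: d_def algebra_simps)
    qed
    then have "(1 + norm \<xi>) ^ K \<le> (d * max 1 \<bar>\<xi> \<bullet> i\<bar>) ^ K"
      by (intro power_mono) auto
    also have "\<dots> \<le> d ^ K * (1 + \<bar>\<xi> \<bullet> i\<bar> ^ K)"
      unfolding power_mult_distrib by (intro mult_left_mono) (auto simp: max_def d_def)
    finally have "(1 + norm \<xi>) ^ K * ?w \<le> d ^ K * (1 + \<bar>\<xi> \<bullet> i\<bar> ^ K) * ?w"
      by (rule mult_right_mono) auto
    also have "\<dots> = d ^ K * (?w + \<bar>\<xi> \<bullet> i\<bar> ^ K * ?w)"
      by (simp add: algebra_simps)
    also have "\<dots> \<le> d ^ K * (C0 * ?p * ?q + c i * ?p * ?q)"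
      using i(1) by (intro mult_left_mono add_mono C0 c) (auto simp: d_def)
    also have "\<dots> = d ^ K * (C0 + c i) * ?p * ?q"
      by (simp add: algebra_simps)
    also have "\<dots> \<le> C * ?p * ?q"
      unfolding C_def using i(1) c(1)
      by (intro mult_right_mono mult_left_mono add_left_mono member_le_sum) (auto simp: d_def)
    finally have *: "(1 + norm \<xi>) ^ (2 * DIM('a)) * ?w * ?q \<le> C * ?p * ?q"
      by (simp add: K_def power_add mult_ac)
    have "?q > 0" "(1 + norm \<xi>) ^ (2 * DIM('a)) > 0" by (simp_all add: add_pos_nonneg)
    then show ?thesis
      using * by (simp add: pos_le_divide_eq mult.commute)
  qed
  moreover have "C \<ge> 0"
    unfolding C_def d_def using C0(1) c(1) by (intro mult_nonneg_nonneg add_nonneg_nonneg sum_nonneg) auto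
  ultimately show thesis using that by blast
qed

text \<open>For fixed \<epsilon> the cutoff makes the double integral absolutely convergent, so
  \<open>y\<close> may be integrated first. The decay of the inner integral then dominates uniformly
  in \<epsilon>, and since every cutoff equals 1 at the origin the limit is the same for all of
  them.\<close>

theorem amplitude_oscillatory_integral:
  fixes a :: "'a::euclidean_space \<times> 'a \<Rightarrow> complex"
  assumes a: "amplitude_of_order m a" and f: "schwartz f"
  shows "has_oscillatory_integral (\<lambda>y \<xi>. cis ((x - y) \<bullet> \<xi>) * a ((x + y) /\<^sub>R 2, \<xi>) * f y)
    (LBINT \<xi>. cis (x \<bullet> \<xi>) * inner_integral a f x \<xi>)"
  unfolding has_oscillatory_integral_def
proof (intro allI impI conjI)
  fix \<psi> :: "'a \<Rightarrow> complex" assume "schwartz \<psi> \<and> \<psi> 0 = 1"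
  then have psi: "schwartz \<psi>" "\<psi> 0 = 1" by auto
  define F where "F e y \<xi> = \<psi> (e *\<^sub>R \<xi>) * (cis ((x - y) \<bullet> \<xi>) * a ((x + y) /\<^sub>R 2, \<xi>) * f y)" for e y \<xi>
  have cont: "continuous_on UNIV (\<lambda>(y, \<xi>). F e y \<xi>)" for e
    unfolding F_def split_beta
    by (intro continuous_intros continuous_on_UNIV_compose[OF amplitude_continuous[OF a]]
        continuous_on_UNIV_compose[OF schwartz_continuous[OF f]]
        continuous_on_UNIV_compose[OF schwartz_continuous[OF psi(1)]])
  let ?J = "\<lambda>e \<xi>. \<psi> (e *\<^sub>R \<xi>) * (cis (x \<bullet> \<xi>) * inner_integral a f x \<xi>)"
  note [measurable] = schwartz_measurable[OF psi(1)] inner_integral_measurable'[OF a f]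
  obtain C where C: "C \<ge> 0"
    "\<And>x y \<xi>. norm (a ((x + y) /\<^sub>R 2, \<xi>)) \<le> C * (1 + norm x) ^ m * (1 + norm y) ^ m * (1 + norm \<xi>) ^ m"
    using amplitude_bound_midpoint[OF a] by blast
  obtain P where P: "P \<ge> 0" "\<And>\<xi>. norm (\<psi> \<xi>) \<le> P"
    using schwartz_bounded[OF psi(1)] by blast
  obtain D where D: "D \<ge> 0"
    "\<And>x \<xi>. norm (inner_integral a f x \<xi>) \<le> D * (1 + norm x) ^ m * (1 / (1 + norm \<xi>) ^ (2 * DIM('a)))"
    using inner_integral_decay[OF a f] by metis
  have int: "integrable lborel (\<lambda>(y, \<xi>). F e y \<xi>)" if e: "e > 0" for e
  proof (rule integrable_pair_bound)
    show "(\<lambda>(y, \<xi>). F e y \<xi>) \<in> borel_measurable borel"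
      by (rule borel_measurable_continuous_onI[OF cont])
    show "integrable lborel (\<lambda>y. C * (1 + norm x) ^ m * ((1 + norm y) ^ m * norm (f y)))"
      by (intro integrable_mult_right schwartz_integrable_power[OF f])
    \<comment> \<open>\<open>r\<close> undoes the dilation: 1 + |\<xi>| is at most \<open>r\<close>
      times 1 + |e \<xi>|, so the Schwartz decay of the dilated cutoff still beats the power
      \<open>m\<close>.\<close>
    define r where "r = max 1 (1 / e)"
    have r: "r \<ge> 1" "r * e \<ge> 1" using e by (auto simp: r_def max_def field_simps)
    show "integrable lborel (\<lambda>\<xi>::'a. (1 + norm \<xi>) ^ m * norm (\<psi> (e *\<^sub>R \<xi>)))"
    proof (rule Bochner_Integration.integrable_bound)
      show "integrable lborel (\<lambda>\<xi>::'a. r ^ m * ((1 + norm (e *\<^sub>R \<xi>)) ^ m * norm (\<psi> (e *\<^sub>R \<xi>))))"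
        using lborel_integrable_affine[OF _ schwartz_integrable_power[OF psi(1), of m], of e 0] e
        by (intro integrable_mult_right) auto
      have "(1 + norm \<xi>) ^ m \<le> r ^ m * (1 + norm (e *\<^sub>R \<xi>)) ^ m" for \<xi> :: 'a
      proof -
        have "1 + norm \<xi> \<le> r * (1 + norm (e *\<^sub>R \<xi>))"
          using r e mult_right_mono[OF r(2), of "norm \<xi>"] by (simp add: algebra_simps)
        then show ?thesis
          unfolding power_mult_distrib[symmetric] by (intro power_mono) auto
      qed
      from mult_right_mono[OF this norm_ge_zero]
      show "AE \<xi> in lborel. norm ((1 + norm \<xi>) ^ m * norm (\<psi> (e *\<^sub>R \<xi>)))
          \<le> norm (r ^ m * ((1 + norm (e *\<^sub>R \<xi>)) ^ m * norm (\<psi> (e *\<^sub>R \<xi>))))"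
        using r(1) by (intro AE_I2) (simp add: mult.assoc abs_mult)
    qed auto
    show "norm (F e y \<xi>) \<le> C * (1 + norm x) ^ m * ((1 + norm y) ^ m * norm (f y)) * ((1 + norm \<xi>) ^ m * norm (\<psi> (e *\<^sub>R \<xi>)))" for y \<xi>
      using mult_right_mono[OF C(2)[of x y \<xi>], of "norm (f y) * norm (\<psi> (e *\<^sub>R \<xi>))"]
      by (simp add: F_def norm_mult mult_ac)
  qed
  then show "\<And>e. e > 0 \<Longrightarrow> integrable lborel (\<lambda>(y, \<xi>). \<psi> (e *\<^sub>R \<xi>) * (cis ((x - y) \<bullet> \<xi>) * a ((x + y) /\<^sub>R 2, \<xi>) * f y))"
    by (simp add: F_def)
  have eq: "integral\<^sup>L lborel (\<lambda>(y, \<xi>). F e y \<xi>) = (LBINT \<xi>. ?J e \<xi>)"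
    if e: "e > 0" for e
  proof -
    have "F e y \<xi> = \<psi> (e *\<^sub>R \<xi>) * cis (x \<bullet> \<xi>) * (cis (- (y \<bullet> \<xi>)) * (a ((x + y) /\<^sub>R 2, \<xi>) * f y))" for y \<xi>
    proof -
      have "cis ((x - y) \<bullet> \<xi>) = cis (x \<bullet> \<xi>) * cis (- (y \<bullet> \<xi>))"
        by (simp add: cis_mult inner_diff_left)
      then show ?thesis by (simp add: F_def)
    qed
    then have "(LBINT y. F e y \<xi>) = ?J e \<xi>" for \<xi>
      by (simp add: inner_integral_def mult.assoc)
    then show ?thesis
      unfolding integral_iterated[OF int[OF e], symmetric] integral_iterated_swap[OF int[OF e]] by simp
  qed
  have "((\<lambda>e. LBINT \<xi>. ?J e \<xi>)
      \<longlongrightarrow> (LBINT \<xi>. cis (x \<bullet> \<xi>) * inner_integral a f x \<xi>)) (at_right 0)"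
  proof (rule integral_dominated_convergence_at_right)
    show "integrable lborel (\<lambda>\<xi>::'a. P * (D * (1 + norm x) ^ m * (1 / (1 + norm \<xi>) ^ (2 * DIM('a)))))"
      by (intro integrable_mult_right integrable_inverse_power)
    show "norm (?J e \<xi>)
        \<le> P * (D * (1 + norm x) ^ m * (1 / (1 + norm \<xi>) ^ (2 * DIM('a))))" for e \<xi>
      unfolding norm_mult norm_cis mult_1 by (intro mult_mono P D) auto
    show "AE \<xi> in lborel. ((\<lambda>e. ?J e \<xi>)
        \<longlongrightarrow> cis (x \<bullet> \<xi>) * inner_integral a f x \<xi>) (at_right 0)"
    proof (rule AE_I2)
      fix \<xi> :: 'a
      have "continuous_on UNIV (\<lambda>e::real. \<psi> (e *\<^sub>R \<xi>))"
        by (intro continuous_on_UNIV_compose[OF schwartz_continuous[OF psi(1)]] continuous_intros)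
      then have "((\<lambda>e. \<psi> (e *\<^sub>R \<xi>)) \<longlongrightarrow> \<psi> (0 *\<^sub>R \<xi>)) (at_right 0)"
        by (meson UNIV_I continuous_on tendsto_within_subset subset_UNIV)
      then have "((\<lambda>e. \<psi> (e *\<^sub>R \<xi>)) \<longlongrightarrow> 1) (at_right 0)"
        by (simp add: psi)
      from tendsto_mult_right[OF this, of "cis (x \<bullet> \<xi>) * inner_integral a f x \<xi>"]
      show "((\<lambda>e. ?J e \<xi>)
        \<longlongrightarrow> cis (x \<bullet> \<xi>) * inner_integral a f x \<xi>) (at_right 0)" by simp
    qed
    have [measurable]: "cis \<in> borel_measurable borel"
      by (intro borel_measurable_continuous_onI continuous_intros)
    show "(\<lambda>\<xi>. cis (x \<bullet> \<xi>) * inner_integral a f x \<xi>) \<in> borel_measurable lborel"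
      "(\<lambda>\<xi>. ?J e \<xi>) \<in> borel_measurable lborel" for e
      by measurable
  qed
  moreover have "\<forall>\<^sub>F e in at_right 0. (LBINT \<xi>. ?J e \<xi>)
      = integral\<^sup>L lborel (\<lambda>(y, \<xi>). F e y \<xi>)"
    using eq by (auto simp: eventually_at_filter)
  ultimately show "((\<lambda>e. integral\<^sup>L lborel (\<lambda>(y, \<xi>). \<psi> (e *\<^sub>R \<xi>) * (cis ((x - y) \<bullet> \<xi>) * a ((x + y) /\<^sub>R 2, \<xi>) * f y)))
      \<longlongrightarrow> (LBINT \<xi>. cis (x \<bullet> \<xi>) * inner_integral a f x \<xi>)) (at_right 0)"
    unfolding F_def by (rule Lim_transform_eventually)
qed

section \<open>Superpositions of Gaussians\<close>

text \<open>The bilinear pairing of \<open>x\<close> with the complex vector p + i q, which is the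
  linear exponent of a coherent state.\<close>

definition clinear :: "'a::euclidean_space \<Rightarrow> 'a \<Rightarrow> 'a \<Rightarrow> complex" where
  "clinear p q x = of_real (p \<bullet> x) + \<i> * of_real (q \<bullet> x)"

text \<open>One family serves two purposes: constant \<sigma> gives Schwartz functions, among them
  the preimages of coherent states under H, and \<open>\<sigma> s = s\<close> with \<rho> = 0 gives
  the Weyl symbol. The weight is complex because these preimages require complex weights.\<close>

definition gauss_mix :: "(real \<Rightarrow> real) \<Rightarrow> (real \<Rightarrow> real) \<Rightarrow> 'a::euclidean_space \<Rightarrow> 'a \<Rightarrow>
    (real \<Rightarrow> complex) \<Rightarrow> 'a \<Rightarrow> complex" where
  "gauss_mix \<sigma> \<rho> p q w x =
     integral {0..1} (\<lambda>s. w s * exp (- of_real (\<sigma> s * (norm x)\<^sup>2) + of_real (\<rho> s) * clinear p q x))"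

lemma gauss_mix_cmult: "gauss_mix \<sigma> \<rho> p q (\<lambda>s. c * w s) x = c * gauss_mix \<sigma> \<rho> p q w x"
  by (simp add: gauss_mix_def mult.assoc)

lemma continuous_on_clinear [continuous_intros]:
  "continuous_on S f \<Longrightarrow> continuous_on S (\<lambda>x. clinear p q (f x))"
  unfolding clinear_def by (intro continuous_intros)

context
  fixes \<sigma> \<rho> :: "real \<Rightarrow> real" and w :: "real \<Rightarrow> complex"
  assumes cont: "continuous_on {0..1} \<sigma>" "continuous_on {0..1} \<rho>" "continuous_on {0..1} w"
begin

lemma continuous_on_gauss_mix_integrand:
  "continuous_on {0..1} (\<lambda>s. w s * exp (- of_real (\<sigma> s * (norm x)\<^sup>2) + of_real (\<rho> s) * clinear p q x))"
  by (intro continuous_intros cont)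

text \<open>Differentiation under the integral stays within the family: the quadratic exponent
  multiplies the weight by \<sigma> and produces a factor \<open>x\<close>, the linear exponent
  multiplies it by \<rho>.\<close>

lemma gauss_mix_has_derivative:
  "(gauss_mix \<sigma> \<rho> p q w has_derivative
     (\<lambda>h. - 2 * of_real (x \<bullet> h) * gauss_mix \<sigma> \<rho> p q (\<lambda>s. of_real (\<sigma> s) * w s) x
        + clinear p q h * gauss_mix \<sigma> \<rho> p q (\<lambda>s. of_real (\<rho> s) * w s) x)) (at x)"
proof -
  let ?D = "\<lambda>h. - 2 * of_real (x \<bullet> h) * gauss_mix \<sigma> \<rho> p q (\<lambda>s. of_real (\<sigma> s) * w s) x
        + clinear p q h * gauss_mix \<sigma> \<rho> p q (\<lambda>s. of_real (\<rho> s) * w s) x"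
  let ?E = "\<lambda>x s. exp (- of_real (\<sigma> s * (norm x)\<^sup>2) + of_real (\<rho> s) * clinear p q x)"
  define L where "L x s h = w s * (?E x s * (- of_real (\<sigma> s * (2 * (x \<bullet> h))) + of_real (\<rho> s) * clinear p q h))" for x s h
  have der: "((\<lambda>x. w s * ?E x s) has_derivative L x s) (at x within S)" for x s S
  proof -
    have "((\<lambda>x. - of_real (\<sigma> s * (norm x)\<^sup>2) + of_real (\<rho> s) * clinear p q x) has_derivative
       (\<lambda>h. - of_real (\<sigma> s * (2 * (x \<bullet> h))) + of_real (\<rho> s) * clinear p q h)) (at x within S)"
      unfolding clinear_def power2_norm_eq_inner
      by (auto intro!: derivative_eq_intros simp: inner_commute algebra_simps)
    from has_derivative_mult_right[OF has_derivative_cexp[OF this], of "w s"] show ?thesis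
      by (simp add: L_def[abs_def])
  qed
  then have L: "blinfun_apply (Blinfun (L x s)) = L x s" for x s
    by (intro bounded_linear_Blinfun_apply) (rule has_derivative_bounded_linear[OF der])
  have comp: "continuous_on (UNIV \<times> {0..1}) (\<lambda>z. g (snd z))" if "continuous_on {0..1} g" for g :: "real \<Rightarrow> 'b::real_normed_vector"
    by (rule continuous_on_compose2[OF that]) (auto intro: continuous_intros)
  \<comment> \<open>Leibniz's rule asks for joint continuity of the derivative as a bounded linear
    map; in finite dimension this may be tested on basis vectors.\<close>
  have contL: "continuous_on (UNIV \<times> {0..1}) (\<lambda>(x, s). Blinfun (L x s))"
  proof (rule continuous_on_blinfun_componentwise)
    fix i :: 'a assume "i \<in> Basis"
    show "continuous_on (UNIV \<times> {0..1}) (\<lambda>z. blinfun_apply (case z of (x, s) \<Rightarrow> Blinfun (L x s)) i)"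
      unfolding split_beta L L_def
      by (intro continuous_intros comp cont)
  qed
  have D: "((\<lambda>x. integral (cbox 0 1) (\<lambda>s. w s * ?E x s)) has_derivative integral (cbox 0 1) (\<lambda>s. Blinfun (L x s))) (at x within UNIV)"
  proof (rule leibniz_rule)
    show "((\<lambda>x. w s * ?E x s) has_derivative blinfun_apply (Blinfun (L x s))) (at x within UNIV)" for x s
      unfolding L by (rule der)
    show "(\<lambda>s. w s * ?E x s) integrable_on cbox 0 1" for x
      using continuous_on_gauss_mix_integrand[of x p q] by (simp add: integrable_continuous_interval)
    show "continuous_on (UNIV \<times> cbox 0 1) (\<lambda>(x, s). Blinfun (L x s))"
      using contL by simp
  qed auto
  have contLx: "continuous_on {0..1} (\<lambda>s. Blinfun (L x s))"
    using continuous_on_compose2[OF contL continuous_on_Pair[OF continuous_on_const continuous_on_id], of x "{0..1}"]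
    by auto
  have "integral (cbox 0 1) (\<lambda>s. Blinfun (L x s)) h = ?D h" for h
  proof -
    have "blinfun_apply (integral {0..1} (\<lambda>s. Blinfun (L x s))) h = integral {0..1} (\<lambda>s. blinfun_apply (Blinfun (L x s)) h)"
      using integral_linear[OF integrable_continuous_interval[OF contLx] blinfun.bounded_linear_left[of h]]
      by (simp add: o_def)
    also have "\<dots> = integral {0..1} (\<lambda>s. - 2 * of_real (x \<bullet> h) * (of_real (\<sigma> s) * w s * ?E x s)
        + clinear p q h * (of_real (\<rho> s) * w s * ?E x s))"
      unfolding L by (rule integral_cong) (simp add: L_def algebra_simps)
    also have "\<dots> = ?D h"
      unfolding gauss_mix_def integral_mult_right[symmetric]
      by (rule integral_add) (intro integrable_continuous_interval continuous_intros cont)+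
    finally show ?thesis by simp
  qed
  then have "blinfun_apply (integral (cbox 0 1) (\<lambda>s. Blinfun (L x s))) = ?D" by (rule ext)
  moreover have "gauss_mix \<sigma> \<rho> p q w = (\<lambda>x. integral (cbox 0 1) (\<lambda>s. w s * ?E x s))"
    by (simp add: gauss_mix_def[abs_def])
  ultimately show ?thesis
    using D by simp
qed

end

section \<open>Polynomial multiples of Gaussian superpositions and their derivatives\<close>

inductive polynomial_le :: "nat \<Rightarrow> ('a::euclidean_space \<Rightarrow> real) \<Rightarrow> bool" where
  const: "polynomial_le k (\<lambda>_. c)"
| mult: "polynomial_le k f \<Longrightarrow> polynomial_le (Suc k) (\<lambda>x. (x \<bullet> b) * f x)"
| add: "polynomial_le k f \<Longrightarrow> polynomial_le k g \<Longrightarrow> polynomial_le k (\<lambda>x. f x + g x)"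

lemma polynomial_le_cmult: "polynomial_le k f \<Longrightarrow> polynomial_le k (\<lambda>x. c * f x)"
  by (induction rule: polynomial_le.induct)
    (auto simp: distrib_left mult.left_commute[of c] intro: polynomial_le.intros)

lemma polynomial_le_Suc: "polynomial_le k f \<Longrightarrow> polynomial_le (Suc k) f"
  by (induction rule: polynomial_le.induct) (auto intro: polynomial_le.intros)

lemma polynomial_le_derivative:
  assumes "polynomial_le k f"
  shows "\<exists>f'. (\<forall>x. (f has_derivative f' x) (at x)) \<and> (\<forall>i. polynomial_le k (\<lambda>x. f' x i))"
  using assms
proof induction
  case (const k c)
  then show ?case
    by (intro exI[of _ "\<lambda>_ _. 0"]) (auto intro: polynomial_le.intros)
next
  case (mult k f b)
  then obtain f' where f': "\<And>x. (f has_derivative f' x) (at x)" "\<And>i. polynomial_le k (\<lambda>x. f' x i)" by blast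
  have "((\<lambda>x. (x \<bullet> b) * f x) has_derivative (\<lambda>h. (x \<bullet> b) * f' x h + (h \<bullet> b) * f x)) (at x)" for x
    by (auto intro!: derivative_eq_intros f')
  moreover have "polynomial_le (Suc k) (\<lambda>x. (x \<bullet> b) * f' x i + (i \<bullet> b) * f x)" for i
    by (intro polynomial_le.add polynomial_le.mult f' polynomial_le_Suc polynomial_le_cmult mult)
  ultimately show ?case
    by (intro exI[of _ "\<lambda>x h. (x \<bullet> b) * f' x h + (h \<bullet> b) * f x"]) blast
next
  case (add k f g)
  then obtain f' g' where "\<And>x. (f has_derivative f' x) (at x)" "\<And>i. polynomial_le k (\<lambda>x. f' x i)"
    "\<And>x. (g has_derivative g' x) (at x)" "\<And>i. polynomial_le k (\<lambda>x. g' x i)" by blast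
  then show ?case
    by (intro exI[of _ "\<lambda>x h. f' x h + g' x h"]) (auto intro: polynomial_le.add has_derivative_add)
qed

lemma polynomial_le_continuous: "polynomial_le k f \<Longrightarrow> continuous_on S f"
  by (induction rule: polynomial_le.induct) (auto intro!: continuous_intros)

lemma polynomial_le_bound:
  assumes "polynomial_le k f" shows "\<exists>C\<ge>0. \<forall>x. \<bar>f x\<bar> \<le> C * (1 + norm x) ^ k"
  using assms
proof induction
  case (const k c)
  have "\<bar>c\<bar> * 1 \<le> \<bar>c\<bar> * (1 + norm x) ^ k" for x :: 'a
    by (intro mult_left_mono one_le_power) auto
  then show ?case by (intro exI[of _ "\<bar>c\<bar>"]) auto
next
  case (mult k f b)
  then obtain C where C: "C \<ge> 0" "\<And>x. \<bar>f x\<bar> \<le> C * (1 + norm x) ^ k" by blast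
  have "\<bar>(x \<bullet> b) * f x\<bar> \<le> (norm b * C) * (1 + norm x) ^ Suc k" for x
  proof -
    have "\<bar>x \<bullet> b\<bar> \<le> (1 + norm x) * norm b"
      using Cauchy_Schwarz_ineq2[of x b] norm_ge_zero[of b] by (simp add: algebra_simps del: norm_ge_zero)
    then have "\<bar>(x \<bullet> b) * f x\<bar> \<le> ((1 + norm x) * norm b) * (C * (1 + norm x) ^ k)"
      unfolding abs_mult by (intro mult_mono C) auto
    then show ?thesis by (simp add: algebra_simps)
  qed
  with C(1) show ?case by (intro exI[of _ "norm b * C"]) auto
next
  case (add k f g)
  then obtain C D where "C \<ge> 0" "\<And>x. \<bar>f x\<bar> \<le> C * (1 + norm x) ^ k" "D \<ge> 0" "\<And>x. \<bar>g x\<bar> \<le> D * (1 + norm x) ^ k" by blast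
  then show ?case
    by (intro exI[of _ "C + D"]) (auto simp: distrib_right intro!: order_trans[OF abs_triangle_ineq] add_mono)
qed

text \<open>
  The class below is closed under partial differentiation.  The index \<open>k\<close> of \<open>W\<close> records how
  many factors \<open>\<sigma> s\<close> the weight contains; each of them pays for one factor \<open>x\<close> in the polynomial.
\<close>

inductive gauss_class :: "(real \<Rightarrow> real) \<Rightarrow> (real \<Rightarrow> real) \<Rightarrow> 'a::euclidean_space \<Rightarrow> 'a \<Rightarrow>
    (nat \<Rightarrow> (real \<Rightarrow> complex) \<Rightarrow> bool) \<Rightarrow> ('a \<Rightarrow> complex) \<Rightarrow> bool"
  for \<sigma> \<rho> p q W where
  base: "polynomial_le k f \<Longrightarrow> W k w \<Longrightarrow> gauss_class \<sigma> \<rho> p q W (\<lambda>x. of_real (f x) * gauss_mix \<sigma> \<rho> p q w x)"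
| add: "gauss_class \<sigma> \<rho> p q W g \<Longrightarrow> gauss_class \<sigma> \<rho> p q W h \<Longrightarrow> gauss_class \<sigma> \<rho> p q W (\<lambda>x. g x + h x)"

text \<open>The weight class stays abstract because two instances are used: all continuous weights
  at every index when \<sigma> is constant, and s^k times a continuous weight at index
  \<open>k\<close> when \<open>\<sigma> s = s\<close>.\<close>

locale gauss_weights =
  fixes \<sigma> \<rho> :: "real \<Rightarrow> real" and p q :: "'a::euclidean_space" and W :: "nat \<Rightarrow> (real \<Rightarrow> complex) \<Rightarrow> bool"
  assumes cont_\<sigma>: "continuous_on {0..1} \<sigma>" and cont_\<rho>: "continuous_on {0..1} \<rho>"
    and cont_W: "W k w \<Longrightarrow> continuous_on {0..1} w"
    and W_\<sigma>: "W k w \<Longrightarrow> W (Suc k) (\<lambda>s. of_real (\<sigma> s) * w s)"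
    and W_\<rho>: "W k w \<Longrightarrow> W k (\<lambda>s. of_real (\<rho> s) * w s)"
    and W_c: "W k w \<Longrightarrow> W k (\<lambda>s. c * w s)"
begin

abbreviation "G \<equiv> gauss_class \<sigma> \<rho> p q W"

lemma gauss_class_has_derivative:
  assumes "G g"
  shows "\<exists>g'. (\<forall>x. (g has_derivative g' x) (at x)) \<and> (\<forall>i. G (\<lambda>x. g' x i))"
  using assms
proof induction
  case (base k f w)
  obtain f' where f': "\<And>x. (f has_derivative f' x) (at x)" "\<And>i. polynomial_le k (\<lambda>x. f' x i)"
    using polynomial_le_derivative[OF base(1)] by blast
  let ?m = "gauss_mix \<sigma> \<rho> p q"
  define g' where "g' x h = of_real (f x) * (- 2 * of_real (x \<bullet> h) * ?m (\<lambda>s. of_real (\<sigma> s) * w s) x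
        + clinear p q h * ?m (\<lambda>s. of_real (\<rho> s) * w s) x) + of_real (f' x h) * ?m w x" for x h
  have "((\<lambda>x. of_real (f x) * ?m w x) has_derivative g' x) (at x)" for x
    unfolding g'_def
    by (intro has_derivative_mult has_derivative_of_real f'(1) gauss_mix_has_derivative cont_\<sigma> cont_\<rho> cont_W[OF base(2)])
  moreover have "G (\<lambda>x. g' x i)" for i
  proof -
    have 1: "G (\<lambda>x. of_real (- 2 * ((x \<bullet> i) * f x)) * ?m (\<lambda>s. of_real (\<sigma> s) * w s) x)"
      by (intro gauss_class.base[of "Suc k"] polynomial_le_cmult polynomial_le.mult base W_\<sigma>)
    have 2: "G (\<lambda>x. of_real (f x) * ?m (\<lambda>s. clinear p q i * (of_real (\<rho> s) * w s)) x)"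
      by (intro gauss_class.base[of k] base W_\<rho> W_c)
    have 3: "G (\<lambda>x. of_real (f' x i) * ?m w x)"
      by (intro gauss_class.base[of k] base f')
    have "g' x i = of_real (- 2 * ((x \<bullet> i) * f x)) * ?m (\<lambda>s. of_real (\<sigma> s) * w s) x
        + of_real (f x) * ?m (\<lambda>s. clinear p q i * (of_real (\<rho> s) * w s)) x + of_real (f' x i) * ?m w x" for x
      unfolding g'_def gauss_mix_cmult by (simp add: algebra_simps)
    then show ?thesis
      using gauss_class.add[OF gauss_class.add[OF 1 2] 3] by simp
  qed
  ultimately show ?case by blast
next
  case (add g h)
  then obtain g' h' where "\<And>x. (g has_derivative g' x) (at x)" "\<And>i. G (\<lambda>x. g' x i)"
    "\<And>x. (h has_derivative h' x) (at x)" "\<And>i. G (\<lambda>x. h' x i)" by blast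
  then show ?case
    by (intro exI[of _ "\<lambda>x i. g' x i + h' x i"]) (auto intro: gauss_class.add has_derivative_add)
qed

lemma gauss_class_partial_deriv:
  assumes "G g" shows "G (partial_deriv i g)"
proof -
  obtain g' where "\<And>x. (g has_derivative g' x) (at x)" "\<And>i. G (\<lambda>x. g' x i)"
    using gauss_class_has_derivative[OF assms] by blast
  moreover from this(1) have "partial_deriv i g = (\<lambda>x. g' x i)"
    using partial_deriv_eq by blast
  ultimately show ?thesis by simp
qed

lemma gauss_class_smooth: "G g \<Longrightarrow> smooth g"
  by (rule smooth_coinduct[where P = "G"])
    (use gauss_class_partial_deriv gauss_class_has_derivative in
      \<open>auto simp: differentiable_on_def differentiable_def, metis\<close>)

lemma gauss_class_iter_deriv:
  "G g \<Longrightarrow> bs \<in> lists Basis \<Longrightarrow> G (iter_deriv bs g)"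
  by (rule iter_deriv_closed[where P = "G"]) (use gauss_class_partial_deriv in auto)

end

text \<open>(1 + r)^k / k! is a single term of the series of exp (1 + r); completing the square in
  the remaining exponent gives the constant.\<close>

lemma power_le_exp:
  fixes c r M :: real
  assumes "c > 0" "r \<ge> 0" shows "(1 + r) ^ k * exp (M * r - c * r\<^sup>2) \<le> fact k * exp (1 + (M + 1)\<^sup>2 / (4 * c))"
proof -
  have "(1 + r) ^ k / fact k \<le> (\<Sum>j\<in>{k}. (1 + r) ^ j /\<^sub>R fact j)" by (simp add: divide_inverse mult.commute)
  also have "\<dots> \<le> exp (1 + r)"
    unfolding exp_def using assms
    by (intro sum_le_suminf summable_exp_generic) auto
  finally have "(1 + r) ^ k * exp (M * r - c * r\<^sup>2) \<le> (fact k * exp (1 + r)) * exp (M * r - c * r\<^sup>2)"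
    by (intro mult_right_mono) (auto simp: field_simps)
  also have "\<dots> = fact k * exp (1 + r + (M * r - c * r\<^sup>2))"
    by (simp only: exp_add mult_ac)
  also have "\<dots> \<le> fact k * exp (1 + (M + 1)\<^sup>2 / (4 * c))"
  proof -
    have "(M + 1)\<^sup>2 / (4 * c) - (r + (M * r - c * r\<^sup>2)) = (2 * c * r - (M + 1))\<^sup>2 / (4 * c)"
      using assms by (simp add: field_simps power2_eq_square)
    also have "\<dots> \<ge> 0" using assms by simp
    finally show ?thesis by simp
  qed
  finally show ?thesis .
qed

section \<open>Schwartz and symbol bounds for the superpositions\<close>

lemma norm_integral_01_le:
  fixes f :: "real \<Rightarrow> complex"
  assumes "continuous_on {0..1} f" "\<And>s. s \<in> {0..1} \<Longrightarrow> norm (f s) \<le> B"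
  shows "norm (integral {0..1} f) \<le> B"
  using integral_bound[of 0 1 f B] assms by auto

lemma continuous_on_01_bounded:
  fixes v :: "real \<Rightarrow> complex"
  assumes "continuous_on {0..1} v"
  shows "\<exists>D\<ge>0. \<forall>s\<in>{0..1}. norm (v s) \<le> D"
proof -
  have "bounded (v ` {0..1})"
    by (intro compact_imp_bounded compact_continuous_image assms) simp
  then show ?thesis unfolding bounded_pos by (auto intro: less_imp_le)
qed

text \<open>A fixed width beats every polynomial and also the linear exponent, whose real part the
  bound on \<rho> keeps below |p| |x|; \<open>q\<close> contributes only phases.\<close>

lemma gauss_mix_schwartz:
  fixes p q :: "'a::euclidean_space"
  assumes c: "c > 0" and \<rho>: "continuous_on {0..1} \<rho>" "\<And>s. s \<in> {0..1} \<Longrightarrow> \<bar>\<rho> s\<bar> \<le> 1"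
    and w: "continuous_on {0..1} w"
  shows "schwartz (gauss_mix (\<lambda>_. c) \<rho> p q w)"
proof -
  interpret gauss_weights "\<lambda>_. c" \<rho> p q "\<lambda>_ w. continuous_on {0..1} w"
    by unfold_locales (auto intro!: continuous_intros \<rho>)
  let ?G = "gauss_class (\<lambda>_. c) \<rho> p q (\<lambda>_ w. continuous_on {0..1} w)"
  have "?G (\<lambda>x. of_real 1 * gauss_mix (\<lambda>_. c) \<rho> p q w x)"
    by (intro gauss_class.base[of 0] polynomial_le.const w)
  then have G: "?G (gauss_mix (\<lambda>_. c) \<rho> p q w)" by simp
  have bound: "\<exists>C. \<forall>x. (1 + norm x) ^ k * norm (g x) \<le> C" if "?G g" for g k
    using that
  proof induction
    case (base m f v)
    obtain C where C: "C \<ge> 0" "\<And>x. \<bar>f x\<bar> \<le> C * (1 + norm x) ^ m"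
      using polynomial_le_bound[OF base(1)] by blast
    obtain D where D0: "D \<ge> 0" and D: "\<And>s. s \<in> {0..1} \<Longrightarrow> norm (v s) \<le> D"
      using continuous_on_01_bounded[OF base(2)] by blast
    let ?K = "fact (k + m) * exp (1 + (norm p + 1)\<^sup>2 / (4 * c))"
    have "(1 + norm x) ^ k * norm (of_real (f x) * gauss_mix (\<lambda>_. c) \<rho> p q v x) \<le> C * D * ?K" for x
    proof -
      have "norm (gauss_mix (\<lambda>_. c) \<rho> p q v x) \<le> D * exp (norm p * norm x - c * (norm x)\<^sup>2)"
        unfolding gauss_mix_def
      proof (rule norm_integral_01_le)
        show "continuous_on {0..1} (\<lambda>s. v s * exp (- of_real (c * (norm x)\<^sup>2) + of_real (\<rho> s) * clinear p q x))"
          by (rule continuous_on_gauss_mix_integrand) (auto intro: \<rho> base(2) continuous_intros)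
        fix s :: real assume s: "s \<in> {0..1}"
        have "\<bar>\<rho> s * (p \<bullet> x)\<bar> \<le> 1 * (norm p * norm x)"
          unfolding abs_mult using s by (intro mult_mono \<rho> Cauchy_Schwarz_ineq2) auto
        then have "\<rho> s * (p \<bullet> x) \<le> norm p * norm x" by simp
        then show "norm (v s * exp (- of_real (c * (norm x)\<^sup>2) + of_real (\<rho> s) * clinear p q x))
            \<le> D * exp (norm p * norm x - c * (norm x)\<^sup>2)"
          unfolding norm_mult norm_exp_eq_Re using s D0
          by (intro mult_mono D) (auto simp: clinear_def)
      qed
      then have "(1 + norm x) ^ k * norm (of_real (f x) * gauss_mix (\<lambda>_. c) \<rho> p q v x)
        \<le> (1 + norm x) ^ k * ((C * (1 + norm x) ^ m) * (D * exp (norm p * norm x - c * (norm x)\<^sup>2)))"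
        unfolding norm_mult norm_of_real using C by (intro mult_left_mono mult_mono) auto
      also have "\<dots> = C * D * ((1 + norm x) ^ (k + m) * exp (norm p * norm x - c * (norm x)\<^sup>2))"
        by (simp add: power_add)
      also have "\<dots> \<le> C * D * ?K"
        using C D0 c by (intro mult_left_mono power_le_exp) auto
      finally show ?thesis .
    qed
    then show ?case by blast
  next
    case (add g h)
    then obtain C D where CD: "\<And>x. (1 + norm x) ^ k * norm (g x) \<le> C" "\<And>x. (1 + norm x) ^ k * norm (h x) \<le> D" by blast
    have "(1 + norm x) ^ k * norm (g x + h x) \<le> C + D" for x
    proof -
      have "(1 + norm x) ^ k * norm (g x + h x) \<le> (1 + norm x) ^ k * (norm (g x) + norm (h x))"
        by (intro mult_left_mono norm_triangle_ineq) auto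
      then show ?thesis using CD[of x] by (simp add: distrib_left)
    qed
    then show ?case by blast
  qed
  show ?thesis
    unfolding schwartz_def using gauss_class_smooth[OF G] bound gauss_class_iter_deriv[OF G] by blast
qed

lemma gaussian_schwartz:
  assumes "c > 0" shows "schwartz (\<lambda>x::'a::euclidean_space. exp (- of_real (c * (norm x)\<^sup>2) + clinear p q x))"
proof -
  have "gauss_mix (\<lambda>_. c) (\<lambda>_. 1) p q (\<lambda>_. 1) = (\<lambda>x::'a. exp (- of_real (c * (norm x)\<^sup>2) + clinear p q x))"
    by (auto simp: gauss_mix_def)
  then show ?thesis
    using gauss_mix_schwartz[OF assms, of "\<lambda>_. 1" "\<lambda>_. 1" p q] by simp
qed

lemma standard_gaussian_schwartz: "schwartz (\<lambda>x::'a::euclidean_space. of_real (exp (- (norm x)\<^sup>2)))"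
  using gaussian_schwartz[of 1 "0::'a" 0] by (simp add: clinear_def exp_of_real[symmetric])

text \<open>The width \<open>s\<close> degenerates at 0, so there is no uniform decay. Still, a
  polynomial factor of degree \<open>k\<close> is accompanied by \<open>s^k\<close>, and the product
  of the two is absorbed by the Gaussian uniformly in \<open>s\<close>; hence all derivatives are
  bounded and the order is 0.\<close>

lemma gauss_mix_amplitude:
  assumes v: "continuous_on {0..1} v"
  shows "amplitude_of_order 0 (gauss_mix (\<lambda>s. s) (\<lambda>_. 0) 0 0 v :: 'a::euclidean_space \<Rightarrow> complex)"
proof -
  let ?W = "\<lambda>k w. \<exists>u. continuous_on {0..1} u \<and> w = (\<lambda>s::real. complex_of_real (s ^ k) * u s)"
  interpret gauss_weights "\<lambda>s. s" "\<lambda>_. 0" "0::'a" "0::'a" ?W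
  proof
    fix k w c assume "?W k w"
    then obtain u where u: "continuous_on {0..1} u" "w = (\<lambda>s. complex_of_real (s ^ k) * u s)" by blast
    show "continuous_on {0..1} w" unfolding u by (intro continuous_intros u)
    show "?W (Suc k) (\<lambda>s. of_real s * w s)"
      by (intro exI[of _ u]) (auto simp: u(2) intro: u(1))
    show "?W k (\<lambda>s. of_real 0 * w s)"
      by (intro exI[of _ "\<lambda>_. 0"]) auto
    show "?W k (\<lambda>s. c * w s)"
      by (intro exI[of _ "\<lambda>s. c * u s"]) (auto simp: u(2) intro!: continuous_intros u(1))
  qed (auto intro: continuous_intros)
  let ?G = "gauss_class (\<lambda>s. s) (\<lambda>_. 0) (0::'a) 0 ?W"
  have "?G (\<lambda>x. of_real 1 * gauss_mix (\<lambda>s. s) (\<lambda>_. 0) 0 0 v x)"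
    using v by (intro gauss_class.base[of 0] polynomial_le.const) auto
  then have G: "?G (gauss_mix (\<lambda>s. s) (\<lambda>_. 0) 0 0 v)" by simp
  have bound: "\<exists>C. \<forall>x. norm (g x) \<le> C" if "?G g" for g
    using that
  proof induction
    case (base k f w)
    obtain C where C: "C \<ge> 0" "\<And>x. \<bar>f x\<bar> \<le> C * (1 + norm x) ^ k"
      using polynomial_le_bound[OF base(1)] by blast
    obtain u where u: "continuous_on {0..1} u" "w = (\<lambda>s. complex_of_real (s ^ k) * u s)" using base(2) by blast
    obtain D where D0: "D \<ge> 0" and D: "\<And>s. s \<in> {0..1} \<Longrightarrow> norm (u s) \<le> D"
      using continuous_on_01_bounded[OF u(1)] by blast
    let ?K = "fact k * exp (1 + (0 + 1)\<^sup>2 / (4 * 1)) :: real"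
    have "norm (of_real (f x) * gauss_mix (\<lambda>s. s) (\<lambda>_. 0) 0 0 w x) \<le> C * D * ?K" for x
    proof -
      have "of_real (f x) * gauss_mix (\<lambda>s. s) (\<lambda>_. 0) 0 0 w x
          = integral {0..1} (\<lambda>s. of_real (f x) * (w s * exp (- of_real (s * (norm x)\<^sup>2))))"
        by (simp add: gauss_mix_def)
      also have "norm \<dots> \<le> C * D * ?K"
      proof (rule norm_integral_01_le)
        show "continuous_on {0..1} (\<lambda>s. of_real (f x) * (w s * exp (- of_real (s * (norm x)\<^sup>2))))"
          unfolding u(2) by (intro continuous_intros u(1))
        fix s :: real assume s: "s \<in> {0..1}"
        \<comment> \<open>The natural scale of the Gaussian, whose modulus is exp (- r^2). Since
          \<open>s\<close> is at most \<open>sqrt s\<close> on the unit interval, s (1 + |x|) is at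
          most 1 + r.\<close>
        define r where "r = sqrt s * norm x"
        have r: "r \<ge> 0" "r\<^sup>2 = s * (norm x)\<^sup>2" using s by (auto simp: r_def power_mult_distrib)
        have "s \<le> sqrt s"
          using s by (metis atLeastAtMost_iff real_sqrt_ge_0_iff real_le_rsqrt power2_eq_square mult_left_le mult_nonneg_nonneg)
        then have "s * (1 + norm x) \<le> 1 + r"
          using s mult_right_mono[of s "sqrt s" "norm x"] by (simp add: r_def algebra_simps)
        then have sr: "(s * (1 + norm x)) ^ k \<le> (1 + r) ^ k"
          using s by (intro power_mono) auto
        have "norm (of_real (f x) * (w s * exp (- of_real (s * (norm x)\<^sup>2))))
            = \<bar>f x\<bar> * (s ^ k * norm (u s) * exp (- r\<^sup>2))"
          using s r by (simp add: norm_mult u(2) norm_power)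
        also have "\<dots> \<le> (C * (1 + norm x) ^ k) * (s ^ k * D * exp (- r\<^sup>2))"
          using s C D0 by (intro mult_mono D) (auto simp: D)
        also have "\<dots> = C * D * ((s * (1 + norm x)) ^ k * exp (- r\<^sup>2))"
          by (simp add: power_mult_distrib)
        also have "\<dots> \<le> C * D * ((1 + r) ^ k * exp (0 * r - 1 * r\<^sup>2))"
          using C D0 sr by (intro mult_left_mono) (auto intro!: mult_right_mono)
        also have "\<dots> \<le> C * D * ?K"
          using C D0 r by (intro mult_left_mono power_le_exp) auto
        finally show "norm (of_real (f x) * (w s * exp (- of_real (s * (norm x)\<^sup>2)))) \<le> C * D * ?K" .
      qed
      finally show ?thesis .
    qed
    then show ?case by blast
  next
    case (add g h)
    then obtain C D where CD: "\<And>x. norm (g x) \<le> C" "\<And>x. norm (h x) \<le> D" by blast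
    have "norm (g x + h x) \<le> C + D" for x
      using CD[of x] norm_triangle_ineq[of "g x" "h x"] by linarith
    then show ?case by blast
  qed
  show ?thesis
    unfolding amplitude_of_order_def power_0 mult_1_right
    using gauss_class_smooth[OF G] bound gauss_class_iter_deriv[OF G] by blast
qed

section \<open>The Mehler kernel\<close>

text \<open>The heat kernel at time \<tau> in dimension 2n. The even dimension turns the usual
  exponent d/2 into the natural number \<open>n\<close>.\<close>

definition heat :: "nat \<Rightarrow> real \<Rightarrow> 'a::euclidean_space \<Rightarrow> real" where
  "heat n \<tau> z = exp (- ((norm z)\<^sup>2 / (4 * \<tau>))) / (4 * pi * \<tau>) ^ n"

text \<open>
  With \<open>\<tau> = s = tanh t\<close> this is the kernel of \<open>e\<^bsup>-tH\<^esup>\<close> divided by \<open>(cosh t)\<^bsup>-2n\<^esup>\<close>, and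
  \<open>(cosh t)\<^bsup>-2n\<^esup> dt = weight n s ds\<close>.  The Gaussian cutoff in the oscillatory integral replaces
  \<open>\<tau>\<close> by \<open>s + e\<^sup>2\<close>, hence the two parameters.  At \<open>\<tau> = 0\<close> division by zero gives the kernel \<open>0\<close>.
\<close>

definition mehler :: "nat \<Rightarrow> real \<Rightarrow> real \<Rightarrow> 'a::euclidean_space \<Rightarrow> 'a \<Rightarrow> real" where
  "mehler n \<tau> s x y = heat n \<tau> (x - y) * exp (- (s * (norm (x + y))\<^sup>2 / 4))"

text \<open>With s = tanh t, the power -2n of cosh t is (1 - s^2)^n, and dt = ds / (1 - s^2) takes
  away one factor.\<close>

definition weight :: "nat \<Rightarrow> real \<Rightarrow> real" where
  "weight n s = indicator {0..1} s * (1 - s\<^sup>2) ^ (n - 1)"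

lemma weight_bound: "\<bar>weight n s\<bar> \<le> indicator {0..1} s"
  by (auto simp: weight_def indicator_def power_le_one abs_le_iff power_mono mult_le_one
      intro: power_le_one order_trans[OF _ zero_le_power])

lemma weight_measurable [measurable]: "weight n \<in> borel_measurable borel"
  unfolding weight_def by measurable

lemma integrable_indicator_01: "integrable lborel (\<lambda>s::real. indicator {a..b} s * c :: real)"
  by (intro integrable_mult_left integrable_real_indicator) (auto simp: emeasure_lborel_Icc_eq)

lemma mehler_sym: "mehler n \<tau> s x y = mehler n \<tau> s y x"
  by (simp add: mehler_def heat_def norm_minus_commute add.commute)

lemma mehler_measurable [measurable (raw)]:
  fixes f g :: "'b \<Rightarrow> 'a::euclidean_space"
  assumes "\<tau> \<in> borel_measurable M" "s \<in> borel_measurable M" "f \<in> borel_measurable M" "g \<in> borel_measurable M"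
  shows "(\<lambda>x. mehler n (\<tau> x) (s x) (f x) (g x)) \<in> borel_measurable M"
  unfolding mehler_def heat_def using assms by measurable

lemma heat_nonneg: "\<tau> \<ge> 0 \<Longrightarrow> heat n \<tau> z \<ge> 0"
  by (simp add: heat_def)

lemma mehler_nonneg: "\<tau> \<ge> 0 \<Longrightarrow> mehler n \<tau> s x y \<ge> 0"
  by (simp add: mehler_def heat_nonneg)

lemma mehler_le_heat: "\<tau> \<ge> 0 \<Longrightarrow> s \<ge> 0 \<Longrightarrow> mehler n \<tau> s x y \<le> heat n \<tau> (x - y)"
  unfolding mehler_def by (intro mult_left_le) (auto simp: heat_nonneg)

lemma heat_le: "\<tau> \<ge> 0 \<Longrightarrow> heat n \<tau> z \<le> 1 / (4 * pi * \<tau>) ^ n"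
  unfolding heat_def by (intro divide_right_mono) auto

lemma mehler_le: "\<tau> \<ge> 0 \<Longrightarrow> s \<ge> 0 \<Longrightarrow> mehler n \<tau> s x y \<le> 1 / (4 * pi * \<tau>) ^ n"
  using mehler_le_heat[of \<tau> s n x y] heat_le[of \<tau> n "x - y"] by linarith

section \<open>The harmonic oscillator acting on Schwartz functions\<close>

lemma schwartz_laplacian:
  assumes "schwartz \<phi>"
  shows "continuous_on UNIV (laplacian \<phi>)" "\<exists>M\<ge>0. \<forall>x. norm (laplacian \<phi> x) \<le> M"
    "integrable lborel (laplacian \<phi>)"
proof -
  have s: "schwartz (partial_deriv i (partial_deriv i \<phi>))" if "i \<in> Basis" for i
    by (intro schwartz_partial_deriv assms that)
  show "continuous_on UNIV (laplacian \<phi>)"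
    unfolding laplacian_def[abs_def] by (intro continuous_on_sum schwartz_continuous s)
  show "integrable lborel (laplacian \<phi>)"
    unfolding laplacian_def[abs_def] by (intro Bochner_Integration.integrable_sum schwartz_integrable s)
  have "\<forall>i\<in>Basis. \<exists>M\<ge>0. \<forall>x. norm (partial_deriv i (partial_deriv i \<phi>) x) \<le> M"
    using schwartz_bounded[OF s] by metis
  then obtain M where M: "\<And>i. i \<in> Basis \<Longrightarrow> M i \<ge> 0"
    "\<And>i x. i \<in> Basis \<Longrightarrow> norm (partial_deriv i (partial_deriv i \<phi>) x) \<le> M i"
    by metis
  have "norm (laplacian \<phi> x) \<le> (\<Sum>i\<in>Basis. M i)" for x
    unfolding laplacian_def by (intro order_trans[OF norm_sum] sum_mono M)
  then show "\<exists>M\<ge>0. \<forall>x. norm (laplacian \<phi> x) \<le> M"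
    using M by (metis sum_nonneg)
qed

lemma norm_power2_le: "(norm x)\<^sup>2 \<le> (1 + norm x)\<^sup>2"
  by (intro power_mono) auto

lemma schwartz_integrable_norm2:
  assumes "schwartz \<phi>" shows "integrable lborel (\<lambda>x. of_real ((norm x)\<^sup>2) * \<phi> x)"
  by (rule schwartz_integrable_mult[OF assms, where C=1 and k=2]) (auto simp: norm_power norm_power2_le)

lemma schwartz_harmonic:
  assumes "schwartz \<phi>"
  shows "harmonic_expr \<phi> \<in> borel_measurable borel" "\<exists>M\<ge>0. \<forall>x. norm (harmonic_expr \<phi> x) \<le> M"
    "integrable lborel (harmonic_expr \<phi>)"
proof -
  have eq: "harmonic_expr \<phi> = (\<lambda>x. - laplacian \<phi> x + of_real ((norm x)\<^sup>2) * \<phi> x)"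
    by (simp add: harmonic_expr_def[abs_def])
  note [measurable] = borel_measurable_continuous_onI[OF schwartz_laplacian(1)[OF assms]] schwartz_measurable[OF assms]
  show "harmonic_expr \<phi> \<in> borel_measurable borel"
    unfolding eq by measurable
  obtain M where M: "M \<ge> 0" "\<And>x. norm (laplacian \<phi> x) \<le> M"
    using schwartz_laplacian(2)[OF assms] by blast
  obtain C where C: "C \<ge> 0" "\<And>x. norm (\<phi> x) \<le> C / (1 + norm x) ^ 2"
    using schwartz_bound[OF assms] by metis
  have "norm (harmonic_expr \<phi> x) \<le> M + C" for x
  proof -
    have p: "(1 + norm x)\<^sup>2 > 0" using norm_ge_zero[of x] by (intro zero_less_power) linarith
    have "(norm x)\<^sup>2 * norm (\<phi> x) \<le> (1 + norm x)\<^sup>2 * (C / (1 + norm x) ^ 2)"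
      by (intro mult_mono C norm_power2_le) auto
    also have "\<dots> = C" using p by simp
    finally have "norm (of_real ((norm x)\<^sup>2) * \<phi> x) \<le> C" by (simp add: norm_mult norm_power)
    then show ?thesis
      unfolding harmonic_expr_def using M(2)[of x] norm_triangle_ineq[of "- laplacian \<phi> x" "of_real ((norm x)\<^sup>2) * \<phi> x"]
      by simp
  qed
  with M C show "\<exists>M\<ge>0. \<forall>x. norm (harmonic_expr \<phi> x) \<le> M" by (metis add_nonneg_nonneg)
  show "integrable lborel (harmonic_expr \<phi>)"
    unfolding eq by (intro Bochner_Integration.integrable_add Bochner_Integration.integrable_minus schwartz_laplacian schwartz_integrable_norm2 assms)
qed

section \<open>Mass and heat equation of the Mehler kernel\<close>

context
  fixes n :: nat
  assumes dim: "DIM('a::euclidean_space) = 2 * n" and n: "n > 0"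
begin

lemma heat_integrable:
  assumes "\<tau> > 0" shows "integrable lborel (\<lambda>y::'a. heat n \<tau> (x - y))"
    and "(LBINT y. heat n \<tau> (x - (y::'a))) = 1"
proof -
  have s: "1 / (4 * \<tau>) > 0" using assms by simp
  have i: "integrable lborel (heat n \<tau> :: 'a \<Rightarrow> real)"
    unfolding heat_def[abs_def] using integrable_gaussian[OF s, where 'a='a] by auto
  show "integrable lborel (\<lambda>y::'a. heat n \<tau> (x - y))"
    using lborel_integrable_affine[OF _ i, of "-1" x] by simp
  have "sqrt (pi / (1 / (4 * \<tau>))) ^ DIM('a) = (4 * pi * \<tau>) ^ n"
    unfolding dim power_mult using assms by (simp add: mult_ac)
  then have "(LBINT y. heat n \<tau> (y::'a)) = 1"
    unfolding heat_def[abs_def] using gaussian_integral[OF s, where 'a='a] assms by simp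
  then show "(LBINT y. heat n \<tau> (x - (y::'a))) = 1"
    using lborel_integral_affine[of "-1" "heat n \<tau> :: 'a \<Rightarrow> real" x] borel_measurable_integrable[OF i] by simp
qed

lemma heat_zero: "heat n 0 (z::'a) = 0"
  using n by (simp add: heat_def)

text \<open>The kernel is dominated by the heat kernel, whose mass is 1. The degenerate value \<tau>
  = 0 is included so that the bounds hold on the closed parameter interval.\<close>

lemma mehler_integrable:
  assumes "\<tau> \<ge> 0" "s \<ge> 0" shows "integrable lborel (\<lambda>y::'a. mehler n \<tau> s x y)"
    and "(LBINT y. mehler n \<tau> s x (y::'a)) \<le> 1"
proof -
  show *: "integrable lborel (\<lambda>y::'a. mehler n \<tau> s x y)"
  proof (cases "\<tau> = 0")
    case True
    then show ?thesis by (simp add: mehler_def heat_zero)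
  next
    case False
    show ?thesis
    proof (rule Bochner_Integration.integrable_bound[OF heat_integrable(1)[of \<tau> x]])
      show "AE y::'a in lborel. norm (mehler n \<tau> s x y) \<le> norm (heat n \<tau> (x - y))"
        using mehler_nonneg[of \<tau> n s x] mehler_le_heat[of \<tau> s n x] assms by (auto simp: heat_nonneg)
    qed (use False assms in auto)
  qed
  show "(LBINT y. mehler n \<tau> s x (y::'a)) \<le> 1"
  proof (cases "\<tau> = 0")
    case True
    then show ?thesis by (simp add: mehler_def heat_zero)
  next
    case False
    then have "(LBINT y. mehler n \<tau> s x (y::'a)) \<le> (LBINT y. heat n \<tau> (x - (y::'a)))"
      using assms by (intro Bochner_Integration.integral_mono * heat_integrable mehler_le_heat) auto
    then show ?thesis using False assms heat_integrable(2)[of \<tau> x] by simp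
  qed
qed

text \<open>The multiplier \<open>q\<close> with H K = q K for the kernel K =
  \<open>mehler n s s\<close> as a function of either variable. It appears twice, in the derivative
  in \<open>s\<close> and in Green's identity, and this agreement is the heat equation.\<close>

definition mehler_factor :: "real \<Rightarrow> 'a \<Rightarrow> 'a \<Rightarrow> real" where
  "mehler_factor s x y = real n / s + real n * s - (norm (x - y))\<^sup>2 / (4 * s\<^sup>2) - s\<^sup>2 * (norm (x + y))\<^sup>2 / 4
      + ((norm x)\<^sup>2 + (norm y)\<^sup>2) / 2"

lemma norm_sum_diff: "((norm (x - y))\<^sup>2 + (norm (x + y))\<^sup>2) / 2 = (norm x)\<^sup>2 + (norm (y::'a))\<^sup>2"
  by (simp add: power2_norm_eq_inner inner_diff_left inner_diff_right inner_add_left inner_add_right)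

text \<open>The heat equation \<open>\<partial>\<^sub>t e\<^bsup>-tH\<^esup> = - H e\<^bsup>-tH\<^esup>\<close> after the substitution \<open>s = tanh t\<close>.\<close>

lemma mehler_has_derivative_time:
  assumes "s > 0"
  shows "((\<lambda>s. (1 - s\<^sup>2) ^ n * mehler n s s x y) has_real_derivative
      - ((1 - s\<^sup>2) ^ (n - 1) * mehler_factor s x y * mehler n s s x y)) (at s within S)"
proof -
  define A where "A = (norm (x - y))\<^sup>2"
  define B where "B = (norm (x + y))\<^sup>2"
  define q where "q s = exp (- (A / (4 * s))) * exp (- (s * B / 4))" for s :: real
  obtain m where m: "n = Suc m" using n by (cases n) auto
  have eq: "mehler n s s x y = q s / (4 * pi * s) ^ n" for s
    by (simp add: mehler_def heat_def q_def A_def B_def)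
  \<comment> \<open>By the parallelogram law the factor depends only on |x - y| and |x + y|, like
    the kernel itself.\<close>
  have f: "mehler_factor s x y = real n / s + real n * s - A / (4 * s\<^sup>2) - s\<^sup>2 * B / 4 + (A + B) / 4"
    using norm_sum_diff[of x y] by (simp add: mehler_factor_def A_def B_def)
  have dq: "(q has_real_derivative q s * (A / (4 * s\<^sup>2) - B / 4)) (at s within S)"
    unfolding q_def using assms
    by (auto intro!: derivative_eq_intros simp: field_simps power2_eq_square)
  have dp: "((\<lambda>s. (1 - s\<^sup>2) ^ n) has_real_derivative n * (1 - s\<^sup>2) ^ m * (- 2 * s)) (at s within S)"
  proof -
    have "((\<lambda>s::real. 1 - s\<^sup>2) has_real_derivative - 2 * s) (at s within S)"
      by (auto intro!: derivative_eq_intros)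
    from DERIV_power[OF this, of n] show ?thesis
      by (simp add: m mult_ac)
  qed
  let ?v = "\<lambda>s. inverse ((4 * pi * s) ^ n)"
  have dr: "(?v has_real_derivative - (n / s) * ?v s) (at s within S)"
  proof -
    have "((\<lambda>s::real. 4 * pi * s) has_real_derivative 4 * pi) (at s within S)"
      by (auto intro!: derivative_eq_intros)
    from DERIV_power[OF this, of n]
    have "((\<lambda>s. (4 * pi * s) ^ n) has_real_derivative n * (4 * pi * s) ^ n / s) (at s within S)"
      by (rule DERIV_cong) (use assms in \<open>simp add: m\<close>)
    from DERIV_inverse_fun[OF this] show ?thesis
      using assms by (simp add: power2_eq_square field_simps)
  qed
  have "((\<lambda>s. (1 - s\<^sup>2) ^ n * (q s * ?v s)) has_real_derivative
     (1 - s\<^sup>2) ^ n * (q s * (- (n / s) * ?v s) + q s * (A / (4 * s\<^sup>2) - B / 4) * ?v s)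
      + n * (1 - s\<^sup>2) ^ m * (- 2 * s) * (q s * ?v s)) (at s within S)"
    by (intro DERIV_mult' dp dq dr)
  moreover have "(1 - s\<^sup>2) ^ n * (q s * (- (n / s) * ?v s) + q s * (A / (4 * s\<^sup>2) - B / 4) * ?v s)
      + n * (1 - s\<^sup>2) ^ m * (- 2 * s) * (q s * ?v s)
      = ((1 - s\<^sup>2) ^ m * (q s * ?v s)) * ((1 - s\<^sup>2) * (- (n / s) + (A / (4 * s\<^sup>2) - B / 4)) - 2 * s * n)"
    unfolding m power_Suc[of "1 - s\<^sup>2"] by (simp only: algebra_simps)
  \<comment> \<open>After division by the kernel, the heat equation is this identity between
    rational functions of \<open>s\<close>.\<close>
  moreover have "(1 - s\<^sup>2) * (- (n / s) + (A / (4 * s\<^sup>2) - B / 4)) - 2 * s * n = - mehler_factor s x y"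
    unfolding f using assms by (simp add: field_simps power2_eq_square)
  ultimately have D: "((\<lambda>s. (1 - s\<^sup>2) ^ n * (q s * ?v s)) has_real_derivative
     ((1 - s\<^sup>2) ^ m * (q s * ?v s)) * - mehler_factor s x y) (at s within S)"
    by simp
  show ?thesis
    unfolding eq divide_inverse[of "q _"] using D by (rule DERIV_cong) (simp add: m)
qed

end

section \<open>Green's identity, truncation in time and the limit at time zero\<close>

lemma has_derivative_norm_power2:
  fixes f :: "'b::real_normed_vector \<Rightarrow> 'a::real_inner"
  assumes "(f has_derivative f') (at x within S)"
  shows "((\<lambda>x. (norm (f x))\<^sup>2) has_derivative (\<lambda>h. 2 * (f x \<bullet> f' h))) (at x within S)"
  unfolding power2_norm_eq_inner
  by (rule has_derivative_eq_rhs[OF has_derivative_inner[OF assms assms]]) (auto simp: inner_commute)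

lemma mehler_continuous [continuous_intros]:
  assumes "continuous_on S f" shows "continuous_on S (\<lambda>x. mehler n s s (f x) y)"
  unfolding mehler_def heat_def divide_inverse by (intro continuous_intros assms)

lemma mehler_has_derivative:
  fixes x y :: "'a::euclidean_space"
  shows "((\<lambda>x. mehler n s s x y) has_derivative
    (\<lambda>h. mehler n s s x y * (- ((x - y) \<bullet> h) / (2 * s) - s * ((x + y) \<bullet> h) / 2))) (at x)"
proof -
  define c where "c = 1 / (4 * pi * s) ^ n"
  have 1: "((\<lambda>x. (norm (x - y))\<^sup>2) has_derivative (\<lambda>h. 2 * ((x - y) \<bullet> h))) (at x)"
    by (rule has_derivative_norm_power2) (auto intro!: derivative_eq_intros)
  have 2: "((\<lambda>x. (norm (x + y))\<^sup>2) has_derivative (\<lambda>h. 2 * ((x + y) \<bullet> h))) (at x)"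
    by (rule has_derivative_norm_power2) (auto intro!: derivative_eq_intros)
  have eq: "mehler n s s x y = c * exp (- (1 / (4 * s) * (norm (x - y))\<^sup>2) - s / 4 * (norm (x + y))\<^sup>2)" for x
    unfolding mehler_def heat_def c_def diff_conv_add_uminus[of "- _"] exp_add by simp
  have "((\<lambda>x. - (1 / (4 * s) * (norm (x - y))\<^sup>2) - s / 4 * (norm (x + y))\<^sup>2) has_derivative
    (\<lambda>h. - (1 / (4 * s) * (2 * ((x - y) \<bullet> h))) - s / 4 * (2 * ((x + y) \<bullet> h)))) (at x)"
    by (intro has_derivative_diff has_derivative_minus has_derivative_mult_left has_derivative_mult_right 1 2)
  moreover have "- (1 / (4 * s) * (2 * u)) - s / 4 * (2 * v) = - u / (2 * s) - s * v / 2" for u v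
    by (simp add: field_simps)
  ultimately have "((\<lambda>x. - (1 / (4 * s) * (norm (x - y))\<^sup>2) - s / 4 * (norm (x + y))\<^sup>2) has_derivative
    (\<lambda>h. - ((x - y) \<bullet> h) / (2 * s) - s * ((x + y) \<bullet> h) / 2)) (at x)"
    by simp
  from has_derivative_mult_right[OF has_derivative_exp[OF this], of c] show ?thesis
    unfolding eq mult.assoc by (simp only: mult.commute[of "exp _"])
qed

context
  fixes n :: nat
  assumes dim: "DIM('a::euclidean_space) = 2 * n" and n: "n > 0"
begin

text \<open>Both integrations by parts are done at once: the derivative of K \<partial>_i \<phi> -
  (\<partial>_i K) \<phi> in direction \<open>i\<close> is K \<partial>_i^2 \<phi> - (\<partial>_i^2
  K) \<phi> and integrates to zero. For s > 0 the kernel is bounded, so the Schwartz function pays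
  for all polynomial factors.\<close>

lemma mehler_green:
  fixes \<phi> :: "'a \<Rightarrow> complex"
  assumes \<phi>: "schwartz \<phi>" and s: "s > 0"
  shows "(LBINT x. of_real (mehler n s s x y) * harmonic_expr \<phi> x)
    = (LBINT x. of_real (mehler_factor n s x y * mehler n s s x y) * \<phi> x)"
proof -
  define K where "K x = mehler n s s x y" for x
  \<comment> \<open>The logarithmic derivative of \<open>K\<close>. It is affine in
    \<open>x\<close>, and in a basis direction its own derivative is the constant
    \<open>- e\<close>, so the second derivative of \<open>K\<close> in direction \<open>i\<close>
    is \<open>K x * ((L x i)\<^sup>2 - e)\<close>.\<close>
  define L where "L x h = - ((x - y) \<bullet> h) / (2 * s) - s * ((x + y) \<bullet> h) / 2" for x h
  define c0 where "c0 = 1 / (4 * pi * s) ^ n"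
  define e where "e = 1 / (2 * s) + s / 2"
  have c0: "c0 \<ge> 0" using s by (simp add: c0_def)
  have dK: "(K has_derivative (\<lambda>h. K x * L x h)) (at x)" for x
    unfolding K_def[abs_def] L_def by (rule mehler_has_derivative)
  have K: "0 \<le> K x" "K x \<le> c0" for x
    unfolding K_def c0_def using s by (auto intro: mehler_nonneg mehler_le)
  have contK: "continuous_on UNIV K"
    unfolding K_def[abs_def] by (intro continuous_intros)
  have contL: "continuous_on UNIV (\<lambda>x. L x i)" for i
    unfolding L_def divide_inverse by (intro continuous_intros)
  have [measurable]: "K \<in> borel_measurable borel"
    by (rule borel_measurable_continuous_onI[OF contK])
  have KP: "integrable lborel (\<lambda>x. of_real (K x * g x) * \<eta> x)" if g: "polynomial_le k g" and \<eta>: "schwartz \<eta>" for k g \<eta>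
  proof -
    obtain C where C: "C \<ge> 0" "\<And>x. \<bar>g x\<bar> \<le> C * (1 + norm x) ^ k" using polynomial_le_bound[OF g] by blast
    note [measurable] = borel_measurable_continuous_onI[OF polynomial_le_continuous[OF g]]
    show ?thesis
    proof (rule schwartz_integrable_mult[OF \<eta>])
      show "norm (complex_of_real (K x * g x)) \<le> (c0 * C) * (1 + norm x) ^ k" for x
        unfolding norm_of_real abs_mult mult.assoc using K[of x] c0 by (intro mult_mono C) auto
    qed measurable
  qed
  define u where "u = - (1 / (2 * s)) - s / 2"
  define v where "v i = (y \<bullet> i) * (1 / (2 * s) - s / 2)" for i
  have Luv: "L x i = (x \<bullet> i) * u + v i" for x i
    using s by (simp add: L_def u_def v_def inner_diff_left inner_add_left field_simps)
  have L2: "(L x i)\<^sup>2 - e = (x \<bullet> i) * ((x \<bullet> i) * u\<^sup>2 + 2 * u * v i) + ((v i)\<^sup>2 - e)" for x i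
    unfolding Luv by (simp add: power2_eq_square algebra_simps)
  have P1: "polynomial_le (Suc 0) (\<lambda>x. L x i)" for i
    unfolding Luv by (intro polynomial_le.intros)
  have P2: "polynomial_le (Suc (Suc 0)) (\<lambda>x. (L x i)\<^sup>2 - e)" for i
    unfolding L2 by (intro polynomial_le.intros)
  have green: "(LBINT x. of_real (K x) * partial_deriv i (partial_deriv i \<phi>) x)
      = (LBINT x. of_real (K x * ((L x i)\<^sup>2 - e)) * \<phi> x)" (is "?lhs = ?rhs")
    and int1: "integrable lborel (\<lambda>x. of_real (K x) * partial_deriv i (partial_deriv i \<phi>) x)"
    and int2: "integrable lborel (\<lambda>x. of_real (K x * ((L x i)\<^sup>2 - e)) * \<phi> x)" if i: "i \<in> Basis" for i
  proof -
    let ?d1 = "partial_deriv i \<phi>" and ?d2 = "partial_deriv i (partial_deriv i \<phi>)"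
    have S1: "schwartz ?d1" and S2: "schwartz ?d2" by (intro schwartz_partial_deriv \<phi> i)+
    show int1: "integrable lborel (\<lambda>x. of_real (K x) * ?d2 x)"
      using KP[OF polynomial_le.const[of 0 1] S2] by simp
    show int2: "integrable lborel (\<lambda>x. of_real (K x * ((L x i)\<^sup>2 - e)) * \<phi> x)"
      by (rule KP[OF P2 \<phi>])
    have int3: "integrable lborel (\<lambda>x. of_real (K x) * ?d1 x)"
      using KP[OF polynomial_le.const[of 0 1] S1] by simp
    have int4: "integrable lborel (\<lambda>x. of_real (K x * L x i) * \<phi> x)"
      by (rule KP[OF P1 \<phi>])
    define G where "G x = of_real (K x) * ?d1 x - of_real (K x * L x i) * \<phi> x" for x
    define G' where "G' x h = (of_real (K x) * frechet_derivative ?d1 (at x) h + of_real (K x * L x h) * ?d1 x)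
        - (of_real (K x * L x i) * frechet_derivative \<phi> (at x) h
          + of_real (K x * (- (h \<bullet> i) / (2 * s) - s * (h \<bullet> i) / 2) + K x * L x h * L x i) * \<phi> x)" for x h
    have dL: "((\<lambda>x. L x i) has_derivative (\<lambda>h. - (h \<bullet> i) / (2 * s) - s * (h \<bullet> i) / 2)) (at x)" for x
      unfolding L_def using s by (auto intro!: derivative_eq_intros simp: field_simps)
    have d: "(\<phi> has_derivative frechet_derivative \<phi> (at x)) (at x)" "(?d1 has_derivative frechet_derivative ?d1 (at x)) (at x)" for x
      by (intro smooth_has_derivative schwartz_smooth \<phi> S1)+
    have dG: "(G has_derivative G' x) (at x)" for x
      unfolding G_def[abs_def] G'_def
      by (intro has_derivative_diff has_derivative_mult has_derivative_of_real dK dL d)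
    have G'i: "G' x i = of_real (K x) * ?d2 x - of_real (K x * ((L x i)\<^sup>2 - e)) * \<phi> x" for x
    proof -
      have ii: "- (i \<bullet> i) / (2 * s) - s * (i \<bullet> i) / 2 = - e" using i by (simp add: e_def)
      show ?thesis
        unfolding G'_def ii by (simp add: partial_deriv_def power2_eq_square) (simp add: algebra_simps)
    qed
    have "(LBINT x. G' x i) = 0"
    proof (rule integral_directional_derivative[OF dG])
      show "continuous_on UNIV (\<lambda>x. G' x i)"
        unfolding G'i by (intro continuous_intros contK contL schwartz_continuous \<phi> S2)
      show "integrable lborel G" unfolding G_def[abs_def] by (intro Bochner_Integration.integrable_diff int3 int4)
      show "integrable lborel (\<lambda>x. G' x i)" unfolding G'i by (intro Bochner_Integration.integrable_diff int1 int2)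
    qed
    then show "?lhs = ?rhs"
      unfolding G'i Bochner_Integration.integral_diff[OF int1 int2] by simp
  qed
  have int5: "integrable lborel (\<lambda>x. of_real (K x * (norm x)\<^sup>2) * \<phi> x)"
  proof (rule schwartz_integrable_mult[OF \<phi>])
    show "norm (complex_of_real (K x * (norm x)\<^sup>2)) \<le> c0 * (1 + norm x) ^ 2" for x
      using K[of x] c0 unfolding norm_of_real by (auto simp: abs_mult intro!: mult_mono norm_power2_le)
  qed measurable
  have "(LBINT x. of_real (K x) * harmonic_expr \<phi> x)
      = (LBINT x. of_real (K x * (norm x)\<^sup>2) * \<phi> x - (\<Sum>i\<in>Basis. of_real (K x) * partial_deriv i (partial_deriv i \<phi>) x))"
    by (simp add: harmonic_expr_def laplacian_def sum_distrib_left algebra_simps)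
  also have "\<dots> = (LBINT x. of_real (K x * (norm x)\<^sup>2) * \<phi> x)
      - (\<Sum>i\<in>Basis. (LBINT x. of_real (K x) * partial_deriv i (partial_deriv i \<phi>) x))"
    using int1 int5 by (subst Bochner_Integration.integral_diff) (auto intro!: Bochner_Integration.integral_sum)
  also have "\<dots> = (LBINT x. of_real (K x * (norm x)\<^sup>2) * \<phi> x)
      - (\<Sum>i\<in>Basis. (LBINT x. of_real (K x * ((L x i)\<^sup>2 - e)) * \<phi> x))"
    by (simp only: green cong: sum.cong)
  also have "\<dots> = (LBINT x. of_real (K x * (norm x)\<^sup>2) * \<phi> x - (\<Sum>i\<in>Basis. of_real (K x * ((L x i)\<^sup>2 - e)) * \<phi> x))"
    using int2 int5 by (subst Bochner_Integration.integral_diff) (auto simp: Bochner_Integration.integral_sum)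
  also have "\<dots> = (LBINT x. of_real (mehler_factor n s x y * K x) * \<phi> x)"
  proof (rule Bochner_Integration.integral_cong)
    fix x
    \<comment> \<open>\<open>v\<close> is the gradient of log K, so the sum of squares is |v|^2; its
      cross term (x - y) . (x + y) equals |x|^2 - |y|^2, which makes the result symmetric in
      \<open>x\<close> and \<open>y\<close>.\<close>
    define v where "v = - ((x - y) /\<^sub>R (2 * s)) - (s / 2) *\<^sub>R (x + y)"
    have "(\<Sum>i\<in>Basis. (L x i)\<^sup>2) = (norm v)\<^sup>2"
      unfolding norm_power2_eq_sum_Basis[of v]
    proof (intro sum.cong refl)
      fix i
      have "v \<bullet> i = L x i"
        by (simp only: v_def L_def inner_diff_left[of "- _"] inner_minus_left inner_scaleR_left) (simp add: field_simps)
      then show "(L x i)\<^sup>2 = (v \<bullet> i)\<^sup>2" by simp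
    qed
    also have "\<dots> = (norm (x - y))\<^sup>2 / (4 * s\<^sup>2) + s\<^sup>2 * (norm (x + y))\<^sup>2 / 4 + ((x - y) \<bullet> (x + y)) / 2"
    proof -
      have nv: "norm v = norm ((x - y) /\<^sub>R (2 * s) + (s / 2) *\<^sub>R (x + y))"
        unfolding v_def by (metis minus_add_distrib norm_minus_cancel uminus_add_conv_diff add.commute)
      have "(norm v)\<^sup>2 = (norm ((x - y) /\<^sub>R (2 * s)))\<^sup>2 + (norm ((s / 2) *\<^sub>R (x + y)))\<^sup>2
          + 2 * (((x - y) /\<^sub>R (2 * s)) \<bullet> ((s / 2) *\<^sub>R (x + y)))"
        unfolding nv unfolding power2_norm_eq_inner by (simp only: inner_add_left inner_add_right inner_commute)
      then show ?thesis
        using s by (simp only: norm_scaleR inner_scaleR_left inner_scaleR_right power_mult_distrib)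
          (simp add: field_simps power2_eq_square)
    qed
    also have "(x - y) \<bullet> (x + y) = (norm x)\<^sup>2 - (norm y)\<^sup>2"
      by (simp add: power2_norm_eq_inner inner_diff_left inner_diff_right inner_add_right inner_commute)
    finally have sq: "(\<Sum>i\<in>Basis. (L x i)\<^sup>2) = (norm (x - y))\<^sup>2 / (4 * s\<^sup>2) + s\<^sup>2 * (norm (x + y))\<^sup>2 / 4 + ((norm x)\<^sup>2 - (norm y)\<^sup>2) / 2" .
    have "(norm x)\<^sup>2 - (\<Sum>i\<in>(Basis::'a set). (L x i)\<^sup>2 - e) = (norm x)\<^sup>2 - (\<Sum>i\<in>Basis. (L x i)\<^sup>2) + 2 * n * e"
      by (simp add: sum_subtractf dim)
    also have "\<dots> = mehler_factor n s x y"
      unfolding sq mehler_factor_def[OF dim n] e_def using s by (simp add: field_simps)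
    finally have f: "mehler_factor n s x y = (norm x)\<^sup>2 - (\<Sum>i\<in>(Basis::'a set). (L x i)\<^sup>2 - e)" by simp
    have "of_real (K x * (norm x)\<^sup>2) * \<phi> x - (\<Sum>i\<in>(Basis::'a set). of_real (K x * ((L x i)\<^sup>2 - e)) * \<phi> x)
       = of_real (K x * ((norm x)\<^sup>2 - (\<Sum>i\<in>(Basis::'a set). (L x i)\<^sup>2 - e))) * \<phi> x"
      unfolding sum_distrib_right[symmetric] of_real_sum[symmetric] sum_distrib_left[symmetric]
      by (simp only: of_real_diff[symmetric] left_diff_distrib[symmetric] right_diff_distrib)
    then show "of_real (K x * (norm x)\<^sup>2) * \<phi> x - (\<Sum>i\<in>(Basis::'a set). of_real (K x * ((L x i)\<^sup>2 - e)) * \<phi> x)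
       = of_real (mehler_factor n s x y * K x) * \<phi> x"
      unfolding f by (simp only: mult.commute[of "K x"])
  qed simp
  finally show ?thesis by (simp add: K_def)
qed

text \<open>The endpoint s = 1, that is t = infinity, contributes nothing because of the factor (1 -
  s^2)^n with n > 0; only the kernel at the truncation time remains.\<close>

lemma mehler_FTC:
  fixes x y :: 'a
  assumes r: "0 < r" "r \<le> 1"
  shows "(LBINT s. of_real (indicator {r..1} s * ((1 - s\<^sup>2) ^ (n - 1) * mehler_factor n s x y * mehler n s s x y)))
    = complex_of_real ((1 - r\<^sup>2) ^ n * mehler n r r x y)"
proof -
  let ?g = "\<lambda>s. (1 - s\<^sup>2) ^ (n - 1) * mehler_factor n s x y * mehler n s s x y"
  have "(LBINT s. indicator {r..1} s *\<^sub>R ?g s)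
     = - ((1 - 1\<^sup>2) ^ n * mehler n 1 1 x y) - (- ((1 - r\<^sup>2) ^ n * mehler n r r x y))"
  proof (rule integral_FTC_Icc)
    fix s assume "r \<le> s" "s \<le> 1"
    then have "s > 0" using r by simp
    from DERIV_minus[OF mehler_has_derivative_time[OF dim n this]]
    show "((\<lambda>s. - ((1 - s\<^sup>2) ^ n * mehler n s s x y)) has_vector_derivative ?g s) (at s within {r..1})"
      by (simp add: has_real_derivative_iff_has_vector_derivative)
  next
    show "continuous_on {r..1} ?g"
      unfolding mehler_factor_def[OF dim n] mehler_def heat_def
      using r by (intro continuous_intros) auto
  qed (use r in auto)
  also have "\<dots> = (1 - r\<^sup>2) ^ n * mehler n r r x y" using n by simp
  finally show ?thesis
    unfolding integral_complex_of_real by simp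
qed

text \<open>The factor blows up as \<open>s\<close> tends to 0. Away from 0 its growth is quadratic
  in \<open>x\<close>, which suffices for Fubini against a Schwartz function.\<close>

lemma mehler_factor_bound:
  fixes y :: 'a
  assumes r: "r > 0"
  shows "\<exists>C. \<forall>s\<in>{r..1}. \<forall>x. \<bar>mehler_factor n s x y\<bar> \<le> C * (1 + norm x) ^ 2"
proof -
  define C where "C = n / r + n + (1 + norm y)\<^sup>2 / (4 * r\<^sup>2) + (1 + norm y)\<^sup>2 / 4 + (1 + norm y)\<^sup>2 / 2"
  have "\<bar>mehler_factor n s x y\<bar> \<le> C * (1 + norm x)\<^sup>2" if s: "s \<in> {r..1}" for s x
  proof -
    let ?Q = "((1 + norm y) * (1 + norm x))\<^sup>2"
    have s0: "s > 0" "s \<le> 1" "r \<le> s" using s r by auto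
    have q: "norm x + norm y \<le> (1 + norm y) * (1 + norm x)" by (simp add: algebra_simps)
    have 1: "(norm (x - y))\<^sup>2 \<le> ?Q" "(norm (x + y))\<^sup>2 \<le> ?Q"
      by (intro power_mono order_trans[OF norm_triangle_ineq4] order_trans[OF norm_triangle_ineq] q norm_ge_zero)+
    have 2: "(norm x)\<^sup>2 + (norm y)\<^sup>2 \<le> ?Q"
    proof -
      have "(norm x)\<^sup>2 + (norm y)\<^sup>2 \<le> (norm x + norm y)\<^sup>2" by (simp add: power2_sum)
      also have "\<dots> \<le> ?Q" by (intro power_mono q) auto
      finally show ?thesis .
    qed
    have one: "1 \<le> (1 + norm x)\<^sup>2" by (intro one_le_power) auto
    have "n / s \<le> n / r" using s0 r by (intro divide_left_mono) auto
    also have "\<dots> * 1 \<le> n / r * (1 + norm x)\<^sup>2" using one r by (intro mult_left_mono) auto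
    finally have a1: "n / s \<le> n / r * (1 + norm x)\<^sup>2" by simp
    have "real n * s \<le> real n * 1" using s0 by (intro mult_left_mono) auto
    also have "\<dots> \<le> n * (1 + norm x)\<^sup>2" using one by (intro mult_left_mono) auto
    finally have a2: "n * s \<le> n * (1 + norm x)\<^sup>2" .
    have a3: "(norm (x - y))\<^sup>2 / (4 * s\<^sup>2) \<le> ?Q / (4 * r\<^sup>2)"
      using s0 r by (intro frac_le 1 mult_left_mono power_mono) auto
    have "s\<^sup>2 \<le> 1" using s0 by (simp add: power_le_one)
    then have "s\<^sup>2 * (norm (x + y))\<^sup>2 \<le> 1 * ?Q" by (intro mult_mono 1) auto
    then have a4: "s\<^sup>2 * (norm (x + y))\<^sup>2 / 4 \<le> ?Q / 4" by simp
    have p: "0 \<le> n / s" "0 \<le> n * s" "0 \<le> (norm (x - y))\<^sup>2 / (4 * s\<^sup>2)" "0 \<le> s\<^sup>2 * (norm (x + y))\<^sup>2 / 4"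
      "0 \<le> (norm x)\<^sup>2 + (norm y)\<^sup>2" using s0 by auto
    have "\<bar>mehler_factor n s x y\<bar> \<le> n / s + n * s + (norm (x - y))\<^sup>2 / (4 * s\<^sup>2) + s\<^sup>2 * (norm (x + y))\<^sup>2 / 4 + ((norm x)\<^sup>2 + (norm y)\<^sup>2) / 2"
    proof -
      have "\<bar>a + b - c - d + e / 2\<bar> \<le> a + b + c + d + e / 2"
        if "0 \<le> a" "0 \<le> b" "0 \<le> c" "0 \<le> d" "0 \<le> e" for a b c d e :: real using that by linarith
      from this[OF p] show ?thesis unfolding mehler_factor_def[OF dim n] .
    qed
    also have "\<dots> \<le> n / r * (1 + norm x)\<^sup>2 + n * (1 + norm x)\<^sup>2 + ?Q / (4 * r\<^sup>2) + ?Q / 4 + ?Q / 2"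
      by (intro add_mono divide_right_mono a1 a2 a3 a4 2) auto
    also have "\<dots> = C * (1 + norm x)\<^sup>2"
      unfolding C_def power_mult_distrib by (simp only: distrib_right) simp
    finally show ?thesis .
  qed
  then show ?thesis by blast
qed

lemma mehler_factor_measurable [measurable (raw)]:
  fixes f g :: "'b \<Rightarrow> 'a"
  assumes "s \<in> borel_measurable M" "f \<in> borel_measurable M" "g \<in> borel_measurable M"
  shows "(\<lambda>x. mehler_factor n (s x) (f x) (g x)) \<in> borel_measurable M"
  unfolding mehler_factor_def[OF dim n] using assms by measurable

text \<open>On {r..1} the kernel is bounded. Green's identity replaces H on \<phi> by the factor,
  Fubini brings the s-integral inside, and there the integrand is an exact derivative.\<close>

lemma truncated_resolvent:
  fixes \<phi> :: "'a \<Rightarrow> complex"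
  assumes \<phi>: "schwartz \<phi>" and r: "0 < r" "r \<le> 1"
  shows "(LBINT s. of_real (indicator {r..1} s * (1 - s\<^sup>2) ^ (n - 1)) *
       (LBINT x. of_real (mehler n s s x y) * harmonic_expr \<phi> x))
    = (LBINT x. of_real ((1 - r\<^sup>2) ^ n * mehler n r r x y) * \<phi> x)"
proof -
  define F where "F s x = of_real (indicator {r..1} s * ((1 - s\<^sup>2) ^ (n - 1) * mehler_factor n s x y * mehler n s s x y)) * \<phi> x" for s x
  note [measurable] = schwartz_measurable[OF \<phi>]
  obtain C where C: "\<And>s x. s \<in> {r..1} \<Longrightarrow> \<bar>mehler_factor n s x y\<bar> \<le> C * (1 + norm x) ^ 2"
    using mehler_factor_bound[OF r(1), of y] by blast
  have "\<bar>mehler_factor n 1 0 y\<bar> \<le> C * (1 + norm (0::'a)) ^ 2" by (rule C) (use r in auto)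
  then have C0: "C \<ge> 0" by simp
  have int: "integrable lborel (\<lambda>(s, x). F s x)"
  proof (rule integrable_pair_bound)
    show "(\<lambda>(s, x). F s x) \<in> borel_measurable borel"
      unfolding F_def split_beta by measurable
    show "integrable lborel (\<lambda>s::real. indicator {r..1} s * (C * (1 / (4 * pi * r) ^ n)))"
      by (rule integrable_indicator_01)
    show "integrable lborel (\<lambda>x. (1 + norm x) ^ 2 * norm (\<phi> x))" by (rule schwartz_integrable_power[OF \<phi>])
    show "norm (F s x) \<le> indicator {r..1} s * (C * (1 / (4 * pi * r) ^ n)) * ((1 + norm x) ^ 2 * norm (\<phi> x))" for s x
    proof (cases "s \<in> {r..1}")
      case True
      then have s: "s > 0" "s \<le> 1" "r \<le> s" using r by auto
      have k: "0 \<le> mehler n s s x y" "mehler n s s x y \<le> 1 / (4 * pi * r) ^ n"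
      proof -
        show "0 \<le> mehler n s s x y" using s by (intro mehler_nonneg) auto
        have "mehler n s s x y \<le> 1 / (4 * pi * s) ^ n" using s by (intro mehler_le) auto
        also have "\<dots> \<le> 1 / (4 * pi * r) ^ n"
          using s r by (intro divide_left_mono power_mono mult_left_mono mult_pos_pos zero_less_power) auto
        finally show "mehler n s s x y \<le> 1 / (4 * pi * r) ^ n" .
      qed
      have w: "0 \<le> (1 - s\<^sup>2) ^ (n - 1)" "(1 - s\<^sup>2) ^ (n - 1) \<le> 1"
        using s by (auto intro!: power_le_one zero_le_power simp: power_le_one)
      have "\<bar>(1 - s\<^sup>2) ^ (n - 1) * mehler_factor n s x y * mehler n s s x y\<bar> \<le> 1 * (C * (1 + norm x) ^ 2) * (1 / (4 * pi * r) ^ n)"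
        unfolding abs_mult using w k C0 by (intro mult_mono C[OF True]) auto
      then have "norm (F s x) \<le> (1 * (C * (1 + norm x) ^ 2) * (1 / (4 * pi * r) ^ n)) * norm (\<phi> x)"
        unfolding F_def norm_mult norm_of_real using True by (intro mult_right_mono) auto
      then show ?thesis using True by (simp add: mult_ac)
    qed (simp add: F_def)
  qed
  have "(LBINT s. of_real (indicator {r..1} s * (1 - s\<^sup>2) ^ (n - 1)) *
       (LBINT x. of_real (mehler n s s x y) * harmonic_expr \<phi> x)) = (LBINT s. (LBINT x. F s x))"
  proof (rule Bochner_Integration.integral_cong)
    fix s :: real
    show "of_real (indicator {r..1} s * (1 - s\<^sup>2) ^ (n - 1)) * (LBINT x. of_real (mehler n s s x y) * harmonic_expr \<phi> x)
      = (LBINT x. F s x)"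
    proof (cases "s \<in> {r..1}")
      case True
      then have s: "s > 0" using r by auto
      have "(LBINT x. F s x) = (LBINT x. of_real ((1 - s\<^sup>2) ^ (n - 1)) * (of_real (mehler_factor n s x y * mehler n s s x y) * \<phi> x))"
        using True by (simp add: F_def mult.assoc)
      then show ?thesis
        unfolding mehler_green[OF \<phi> s] using True by simp
    qed (simp add: F_def)
  qed simp
  also have "\<dots> = (LBINT x. (LBINT s. F s x))" by (rule integral_iterated_swap[OF int])
  also have "\<dots> = (LBINT x. of_real ((1 - r\<^sup>2) ^ n * mehler n r r x y) * \<phi> x)"
    unfolding F_def integral_mult_left_zero mehler_FTC[OF r] ..
  finally show ?thesis .
qed

text \<open>Substituting x = y + 2 sqrt r z turns the heat part of the kernel into the fixed density
  exp (- |z|^2) / pi^n, while the other factors converge pointwise.\<close>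

lemma mehler_approximate_identity:
  fixes \<phi> :: "'a \<Rightarrow> complex"
  assumes \<phi>: "schwartz \<phi>"
  shows "((\<lambda>r. LBINT x. of_real ((1 - r\<^sup>2) ^ n * mehler n r r x y) * \<phi> x) \<longlongrightarrow> \<phi> y) (at_right 0)"
proof -
  note [measurable] = schwartz_measurable[OF \<phi>]
  obtain M where M: "M \<ge> 0" "\<And>x. norm (\<phi> x) \<le> M" using schwartz_bounded[OF \<phi>] by blast
  \<comment> \<open>What remains of the integrand after the Gaussian weight is split off. It makes
    sense at r = 0, where it is \<open>\<phi> y\<close> divided by \<open>pi ^ n\<close>.\<close>
  define G where "G r z = of_real (exp (- (r * (norm (2 *\<^sub>R y + (2 * sqrt r) *\<^sub>R z))\<^sup>2 / 4)) / pi ^ n)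
      * \<phi> (y + (2 * sqrt r) *\<^sub>R z)" for r and z :: 'a
  let ?A = "\<lambda>r z. of_real (exp (- (norm z)\<^sup>2)) * G r z"
  have eq: "(LBINT x. of_real ((1 - r\<^sup>2) ^ n * mehler n r r x y) * \<phi> x) = of_real ((1 - r\<^sup>2) ^ n) * (LBINT z. ?A r z)"
    if r: "r > 0" for r
  proof -
    let ?c = "2 * sqrt r"
    have c: "?c > 0" "?c ^ (2 * n) = (4 * r) ^ n"
      using r by (auto simp: power_mult power_mult_distrib)
    let ?f = "\<lambda>x. of_real (mehler n r r x y) * \<phi> x"
    have "(LBINT z. ?f (y + ?c *\<^sub>R z)) = (LBINT x. ?f x) /\<^sub>R \<bar>?c\<bar> ^ DIM('a)"
    proof (rule lborel_integral_affine)
      show "?f \<in> borel_measurable borel" by measurable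
    qed (use c in auto)
    then have "(LBINT x. ?f x) = of_real ((4 * r) ^ n) * (LBINT z. ?f (y + ?c *\<^sub>R z))"
    proof -
      assume J: "(LBINT z. ?f (y + ?c *\<^sub>R z)) = (LBINT x. ?f x) /\<^sub>R \<bar>?c\<bar> ^ DIM('a)"
      have X: "\<bar>?c\<bar> ^ DIM('a) = (4 * r) ^ n" unfolding dim c(2)[symmetric] using c(1) by simp
      have nz: "(4 * r) ^ n * inverse ((4 * r) ^ n) = 1" using r by (intro right_inverse) simp
      show ?thesis unfolding J X scaleR_conv_of_real mult.assoc[symmetric] of_real_mult[symmetric] nz by simp
    qed
    also have "\<dots> = (LBINT z. of_real ((4 * r) ^ n) * ?f (y + ?c *\<^sub>R z))" by simp
    also have "\<dots> = (LBINT z. ?A r z)"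
    proof (rule Bochner_Integration.integral_cong)
      fix z :: 'a
      have "(4 * r) ^ n * mehler n r r (y + ?c *\<^sub>R z) y
          = exp (- (norm z)\<^sup>2) * (exp (- (r * (norm (2 *\<^sub>R y + ?c *\<^sub>R z))\<^sup>2 / 4)) / pi ^ n)"
      proof -
        have 1: "(norm (?c *\<^sub>R z))\<^sup>2 / (4 * r) = (norm z)\<^sup>2" using r by (simp add: power_mult_distrib)
        have 2: "y + ?c *\<^sub>R z + y = 2 *\<^sub>R y + ?c *\<^sub>R z" by (simp add: scaleR_2)
        have 3: "y + ?c *\<^sub>R z - y = ?c *\<^sub>R z" by simp
        show ?thesis
          unfolding mehler_def heat_def 2 3 1 using r by (simp add: power_mult_distrib)
      qed
      then show "of_real ((4 * r) ^ n) * ?f (y + ?c *\<^sub>R z) = ?A r z"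
        unfolding G_def mult.assoc[symmetric] of_real_mult[symmetric] by simp
    qed simp
    finally have "(LBINT x. ?f x) = (LBINT z. ?A r z)" .
    then show ?thesis by (simp add: mult.assoc)
  qed
  have "((\<lambda>r. LBINT z. ?A r z) \<longlongrightarrow> of_real (sqrt pi ^ DIM('a)) * (of_real (1 / pi ^ n) * \<phi> y)) (at_right 0)"
  proof (rule gaussian_average_limit)
    show "continuous_on UNIV (\<lambda>r. G r z)" for z
      unfolding G_def divide_inverse
      by (intro continuous_intros continuous_on_UNIV_compose[OF schwartz_continuous[OF \<phi>]])
    show "norm (G r z) \<le> 1 / pi ^ n * M" if "r > 0" for r z
      unfolding G_def norm_mult norm_of_real using that M
      by (intro mult_mono) (auto intro: divide_right_mono)
  qed (auto simp: G_def[abs_def])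
  then have 1: "((\<lambda>r. LBINT z. ?A r z) \<longlongrightarrow> \<phi> y) (at_right 0)"
    by (simp add: dim power_mult)
  have "((\<lambda>r::real. complex_of_real ((1 - r\<^sup>2) ^ n)) \<longlongrightarrow> of_real ((1 - 0\<^sup>2) ^ n)) (at_right 0)"
    by (intro tendsto_intros)
  from tendsto_mult[OF this 1]
  have "((\<lambda>r. of_real ((1 - r\<^sup>2) ^ n) * (LBINT z. ?A r z)) \<longlongrightarrow> \<phi> y) (at_right 0)" by simp
  then show ?thesis
    by (rule Lim_transform_eventually) (use eq in \<open>auto simp: eventually_at_filter\<close>)
qed

lemma
  fixes g :: "'a \<Rightarrow> complex"
  assumes g[measurable]: "g \<in> borel_measurable borel" and M: "M \<ge> 0" "\<And>y. norm (g y) \<le> M"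
    and ts: "\<tau> \<ge> 0" "s \<ge> 0"
  shows mehler_apply_integrable: "integrable lborel (\<lambda>y. of_real (mehler n \<tau> s x y) * g y)"
    and mehler_apply_bound': "(LBINT y. norm (of_real (mehler n \<tau> s x y) * g y)) \<le> M"
    and mehler_apply_bound: "norm (LBINT y. of_real (mehler n \<tau> s x y) * g y) \<le> M"
proof -
  have i: "integrable lborel (\<lambda>y. mehler n \<tau> s x y * M)"
    using mehler_integrable(1)[OF dim n ts, of x] by simp
  have b: "norm (of_real (mehler n \<tau> s x y) * g y) \<le> mehler n \<tau> s x y * M" for y
    unfolding norm_mult norm_of_real using mehler_nonneg[OF ts(1), of n s x y] M by (intro mult_mono) auto
  show *: "integrable lborel (\<lambda>y. of_real (mehler n \<tau> s x y) * g y)"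
    by (rule integrable_dominated[OF i _ b]) measurable
  have "(LBINT y. norm (of_real (mehler n \<tau> s x y) * g y)) \<le> (LBINT y. mehler n \<tau> s x y * M)"
    using * by (intro Bochner_Integration.integral_mono i b) auto
  also have "\<dots> \<le> 1 * M"
    using mult_right_mono[OF mehler_integrable(2)[OF dim n ts, of x] M(1)] by simp
  finally show 1: "(LBINT y. norm (of_real (mehler n \<tau> s x y) * g y)) \<le> M" by simp
  show "norm (LBINT y. of_real (mehler n \<tau> s x y) * g y) \<le> M"
    by (rule order_trans[OF integral_norm_bound 1])
qed

text \<open>Let \<open>r\<close> tend to 0 in the truncated identity. On the left the kernel has
  mass at most 1, so the integrand is dominated by the sup of |H \<phi>| on the unit interval; on
  the right stands the approximate identity.\<close>

lemma resolvent_identity: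
  fixes \<phi> :: "'a \<Rightarrow> complex"
  assumes \<phi>: "schwartz \<phi>"
  shows "(LBINT s. of_real (weight n s) * (LBINT x. of_real (mehler n s s x y) * harmonic_expr \<phi> x)) = \<phi> y"
proof -
  define h where "h s = (LBINT x. of_real (mehler n s s x y) * harmonic_expr \<phi> x)" for s
  note [measurable] = schwartz_harmonic(1)[OF \<phi>]
  obtain M where M: "M \<ge> 0" "\<And>x. norm (harmonic_expr \<phi> x) \<le> M" using schwartz_harmonic(2)[OF \<phi>] by blast
  have h[measurable]: "h \<in> borel_measurable borel"
    unfolding h_def by (intro borel_measurable_parameter_integral) (unfold split_beta, measurable)
  have hb: "norm (h s) \<le> M" if "s \<ge> 0" for s
    unfolding h_def mehler_sym[of n s s _ y] by (rule mehler_apply_bound) (use M that in auto)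
  let ?T = "\<lambda>r s. of_real (indicator {r..1} s * (1 - s\<^sup>2) ^ (n - 1)) * h s"
  have "((\<lambda>r. LBINT s. ?T r s) \<longlongrightarrow> (LBINT s. of_real (weight n s) * h s)) (at_right 0)"
  proof (rule integral_dominated_convergence_at_right)
    show "integrable lborel (\<lambda>s::real. indicator {0..1} s * M)" by (rule integrable_indicator_01)
    show "norm (?T r s) \<le> indicator {0..1} s * M" if "r > 0" for r s
    proof (cases "s \<in> {r..1}")
      case True
      then have s: "0 \<le> s" "s \<le> 1" using that by auto
      then have "\<bar>(1 - s\<^sup>2) ^ (n - 1)\<bar> * norm (h s) \<le> 1 * M"
        by (intro mult_mono hb) (auto intro!: power_le_one simp: power_le_one power_abs)
      moreover have "norm (?T r s) = \<bar>(1 - s\<^sup>2) ^ (n - 1)\<bar> * norm (h s)"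
        unfolding norm_mult norm_of_real using True by simp
      ultimately show ?thesis using True s by simp
    qed (use M in \<open>auto simp: indicator_def\<close>)
    show "AE s in lborel. ((\<lambda>r. ?T r s) \<longlongrightarrow> of_real (weight n s) * h s) (at_right 0)"
      using AE_lborel_singleton[of "0::real"]
    proof eventually_elim
      case (elim s)
      have "\<forall>\<^sub>F r in at_right 0. of_real (weight n s) * h s = ?T r s"
      proof (cases "s > 0")
        case True
        have "\<forall>\<^sub>F r in at_right 0. r < s" using True by (rule order_tendstoD[OF tendsto_ident_at])
        then show ?thesis
          by (rule eventually_mono) (use True in \<open>auto simp: weight_def indicator_def\<close>)
      next
        case False
        with elim have "s < 0" by simp
        have "\<forall>\<^sub>F r in at_right 0. r > (0::real)" by (simp add: eventually_at_filter)
        then show ?thesis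
          by (rule eventually_mono) (use \<open>s < 0\<close> in \<open>auto simp: weight_def indicator_def\<close>)
      qed
      then show ?case by (rule Lim_transform_eventually[OF tendsto_const])
    qed
  qed measurable
  moreover have "\<forall>\<^sub>F r in at_right 0. (LBINT x. of_real ((1 - r\<^sup>2) ^ n * mehler n r r x y) * \<phi> x) = (LBINT s. ?T r s)"
  proof -
    have "\<forall>\<^sub>F r in at_right 0. r < (1::real)" by (rule order_tendstoD[OF tendsto_ident_at]) simp
    moreover have "\<forall>\<^sub>F r in at_right 0. r > (0::real)" by (simp add: eventually_at_filter)
    ultimately show ?thesis
      unfolding h_def by eventually_elim (rule truncated_resolvent[OF \<phi>, symmetric], auto)
  qed
  from Lim_transform_eventually[OF mehler_approximate_identity[OF \<phi>, of y] this]
  have "((\<lambda>r. LBINT s. ?T r s) \<longlongrightarrow> \<phi> y) (at_right 0)" .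
  ultimately show ?thesis
    unfolding h_def by (rule tendsto_unique[rotated]) simp
qed

end

section \<open>The resolvent and its Weyl symbol\<close>

definition resolvent :: "nat \<Rightarrow> ('a::euclidean_space \<Rightarrow> complex) \<Rightarrow> 'a \<Rightarrow> complex" where
  "resolvent n f x = (LBINT s. of_real (weight n s) * (LBINT y. of_real (mehler n s s x y) * f y))"

definition resolvent_symbol :: "nat \<Rightarrow> 'a::euclidean_space \<Rightarrow> complex" where
  "resolvent_symbol n = gauss_mix (\<lambda>s. s) (\<lambda>_. 0) 0 0 (\<lambda>s. of_real ((1 - s\<^sup>2) ^ (n - 1)))"

lemma resolvent_symbol_amplitude: "amplitude_of_order 0 (resolvent_symbol n)"
  unfolding resolvent_symbol_def by (intro gauss_mix_amplitude continuous_intros)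

text \<open>Differentiation under the integral sign used the gauge integral of
  \<open>gauss_mix\<close>; Fubini needs this Lebesgue integral.\<close>

lemma resolvent_symbol_eq:
  "resolvent_symbol n X = (LBINT s. of_real (weight n s * exp (- (s * (norm X)\<^sup>2))))"
proof -
  have "resolvent_symbol n X = integral {0..1} (\<lambda>s. of_real ((1 - s\<^sup>2) ^ (n - 1) * exp (- (s * (norm X)\<^sup>2))))"
    by (simp add: resolvent_symbol_def gauss_mix_def exp_of_real[symmetric])
  also have "\<dots> = (LBINT s. of_real (indicator {0..1} s) * of_real ((1 - s\<^sup>2) ^ (n - 1) * exp (- (s * (norm X)\<^sup>2))))"
    by (intro integral_01_eq continuous_intros)
  finally show ?thesis
    by (simp add: weight_def mult_ac)
qed

context
  fixes n :: nat
  assumes dim: "DIM('a::euclidean_space) = 2 * n" and n: "n > 0"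
begin

context
  fixes f :: "'a \<Rightarrow> complex"
  assumes f: "schwartz f"
begin

text \<open>Time and space are bundled into one variable, so that exchanging them jointly with
  \<open>x\<close> is a single application of Fubini.\<close>

definition resolvent_kernel :: "'a \<Rightarrow> real \<times> 'a \<Rightarrow> complex" where
  "resolvent_kernel x = (\<lambda>(s, y). of_real (weight n s * mehler n s s x y) * f y)"

text \<open>The kernel is unbounded near s = 0, but its mass in \<open>y\<close> is at most 1 for
  every \<open>s\<close>; hence the criterion with iterated bounds.\<close>

lemma resolvent_eq:
  shows "integrable lborel (resolvent_kernel x)"
    and "resolvent n f x = (LBINT z. resolvent_kernel x z)"
proof -
  note [measurable] = schwartz_measurable[OF f]
  obtain M where M: "M \<ge> 0" "\<And>y. norm (f y) \<le> M" using schwartz_bounded[OF f] by blast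
  have eq: "of_real (weight n s * mehler n s s x y) * f y = of_real (weight n s) * (of_real (mehler n s s x y) * f y)" for s y
    by simp
  show int: "integrable lborel (resolvent_kernel x)"
    unfolding resolvent_kernel_def
  proof (rule integrable_pair_iterated)
    show "(\<lambda>(s, y). of_real (weight n s * mehler n s s x y) * f y) \<in> borel_measurable borel"
      unfolding split_beta by measurable
    show "integrable lborel (\<lambda>s::real. indicator {0..1} s * M)" by (rule integrable_indicator_01)
    fix s :: real
    show "integrable lborel (\<lambda>y. of_real (weight n s * mehler n s s x y) * f y)"
    proof (cases "s \<in> {0..1}")
      case True
      then show ?thesis
        unfolding eq by (intro integrable_mult_right mehler_apply_integrable[OF dim n _ M]) auto
    qed (simp add: weight_def)
    show "(LBINT y. norm (of_real (weight n s * mehler n s s x y) * f y)) \<le> indicator {0..1} s * M"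
    proof (cases "s \<in> {0..1}")
      case True
      have "(LBINT y. norm (of_real (weight n s * mehler n s s x y) * f y))
          = \<bar>weight n s\<bar> * (LBINT y. norm (of_real (mehler n s s x y) * f y))"
        unfolding eq norm_mult[of "of_real (weight n s)"] norm_of_real by simp
      also have "\<dots> \<le> indicator {0..1} s * M"
        using True by (intro mult_mono weight_bound mehler_apply_bound'[OF dim n _ M] Bochner_Integration.integral_nonneg) auto
      finally show ?thesis .
    qed (simp add: weight_def)
  qed
  show "resolvent n f x = (LBINT z. resolvent_kernel x z)"
    using integral_iterated[OF int[unfolded resolvent_kernel_def]]
    by (simp add: resolvent_def resolvent_kernel_def mult.assoc)
qed

text \<open>By symmetry the kernel also has mass at most 1 in \<open>x\<close>, so integrating over
  \<open>x\<close> first leaves the integrable function |f y| on a bounded time interval. This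
  yields the L^1 bound for the resolvent.\<close>

lemma resolvent_kernel_integrable:
  "integrable lborel (\<lambda>(z, x). resolvent_kernel x z)"
proof (rule integrable_pair_iterated)
  note [measurable] = schwartz_measurable[OF f]
  show "(\<lambda>(z, x). resolvent_kernel x z) \<in> borel_measurable borel"
    unfolding resolvent_kernel_def split_beta by measurable
  show "integrable lborel (\<lambda>(s, y). indicator {0..1::real} s * norm (f y))"
    using integrable_indicator_01[of 0 1 1] schwartz_integrable[OF f] by (intro integrable_pair_mult) auto
  fix z :: "real \<times> 'a"
  obtain s y where z: "z = (s, y)" by fastforce
  have "integrable lborel (\<lambda>x. of_real (weight n s * mehler n s s x y) * f y) \<and>
    (LBINT x. norm (of_real (weight n s * mehler n s s x y) * f y)) \<le> indicator {0..1} s * norm (f y)"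
  proof (cases "s \<in> {0..1}")
    case True
    then have i: "integrable lborel (\<lambda>x::'a. mehler n s s x y)" "(LBINT x. mehler n s s (x::'a) y) \<le> 1"
      using mehler_integrable[OF dim n, of s s y] unfolding mehler_sym[of n s s _ y] by auto
    have ab: "\<bar>mehler n s s x y\<bar> = mehler n s s x y" for x :: 'a
      using True mehler_nonneg[of s n s x y] by simp
    have "(LBINT x. norm (of_real (weight n s * mehler n s s x y) * f y))
        = \<bar>weight n s\<bar> * norm (f y) * (LBINT x. mehler n s s x y)"
      unfolding norm_mult norm_of_real abs_mult ab
      by (subst integral_mult_right_zero[symmetric]) (simp add: mult_ac)
    also have "\<dots> \<le> indicator {0..1} s * norm (f y) * 1"
      using i(2) True by (intro mult_mono weight_bound mult_nonneg_nonneg Bochner_Integration.integral_nonneg)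
        (auto intro: mehler_nonneg)
    finally show ?thesis using i(1) by (auto intro!: integrable_mult_left simp del: of_real_mult)
  qed (simp add: weight_def)
  then show "integrable lborel (\<lambda>x. resolvent_kernel x z)"
    and "(LBINT x. norm (resolvent_kernel x z)) \<le> (case z of (s, y) \<Rightarrow> indicator {0..1} s * norm (f y))"
    by (simp_all add: z resolvent_kernel_def)
qed

lemma resolvent_integrable: "integrable lborel (resolvent n f)"
proof -
  have "resolvent n f = (\<lambda>x. LBINT z. resolvent_kernel x z)"
    by (rule ext) (rule resolvent_eq(2))
  then show ?thesis
    using integrable_iterated'[OF resolvent_kernel_integrable] by simp
qed

lemma resolvent_bound:
  assumes M: "M \<ge> 0" "\<And>y. norm (f y) \<le> M" shows "norm (resolvent n f x) \<le> M"
proof -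
  note [measurable] = schwartz_measurable[OF f]
  have i: "integrable lborel (\<lambda>s. of_real (weight n s) * (LBINT y. of_real (mehler n s s x y) * f y))"
    using integrable_iterated[OF resolvent_eq(1)[unfolded resolvent_kernel_def]] by (simp add: mult.assoc)
  have "norm (resolvent n f x) \<le> (LBINT s. indicator {0..1::real} s * M)"
    unfolding resolvent_def
  proof (rule Bochner_Integration.integral_norm_bound_integral[OF i integrable_indicator_01])
    fix s :: real
    show "norm (of_real (weight n s) * (LBINT y. of_real (mehler n s s x y) * f y)) \<le> indicator {0..1} s * M"
    proof (cases "s \<in> {0..1}")
      case True
      then show ?thesis
        unfolding norm_mult norm_of_real by (intro mult_mono weight_bound mehler_apply_bound[OF dim n _ M]) auto
    qed (simp add: weight_def)
  qed
  then show ?thesis by simp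
qed

text \<open>|u|^2 is at most M |u|: the L^2 statements are reduced to the L^1 and sup bounds that
  the kernel supplies directly.\<close>

lemma square_integrable_bounded:
  fixes u :: "'a \<Rightarrow> complex"
  assumes u: "integrable lborel u" and M: "\<And>x. norm (u x) \<le> M"
  shows "square_integrable u"
  unfolding square_integrable_def
proof
  show [measurable]: "u \<in> borel_measurable lborel" using u by simp
  have "integrable lborel (\<lambda>x. M * norm (u x))" using u by simp
  then show "integrable lborel (\<lambda>x. (norm (u x))\<^sup>2)"
    by (rule Bochner_Integration.integrable_bound)
      (auto simp: power2_eq_square intro!: AE_I2 mult_right_mono order_trans[OF M abs_ge_self] simp: abs_mult)
qed

text \<open>Fubini moves the kernel from \<open>f\<close> onto the test function, where
  \<open>resolvent_identity\<close> recovers \<phi>. Kernel and weight are real, so conjugation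
  passes through them.\<close>

theorem resolvent_harmonic_oscillator: "(resolvent n f, f) \<in> harmonic_oscillator"
proof -
  note [measurable] = schwartz_measurable[OF f]
  obtain M where M: "M \<ge> 0" "\<And>y. norm (f y) \<le> M" using schwartz_bounded[OF f] by blast
  have "(LBINT x. resolvent n f x * cnj (harmonic_expr \<phi> x)) = (LBINT x. f x * cnj (\<phi> x))"
    if \<phi>: "schwartz \<phi>" for \<phi>
  proof -
    note [measurable] = schwartz_harmonic(1)[OF \<phi>]
    have [measurable]: "cnj \<in> borel_measurable borel"
      by (intro borel_measurable_continuous_onI continuous_intros)
    obtain B where B: "B \<ge> 0" "\<And>x. norm (harmonic_expr \<phi> x) \<le> B" using schwartz_harmonic(2)[OF \<phi>] by blast
    note F = resolvent_kernel_integrable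
    have int: "integrable lborel (\<lambda>(z, x). resolvent_kernel x z * cnj (harmonic_expr \<phi> x))"
    proof (rule integrable_dominated[OF integrable_mult_right[OF integrable_norm[OF F], of B]])
      show "(\<lambda>(z, x). resolvent_kernel x z * cnj (harmonic_expr \<phi> x)) \<in> borel_measurable borel"
        using borel_measurable_integrable[OF F] unfolding split_beta by measurable
      show "norm (case p of (z, x) \<Rightarrow> resolvent_kernel x z * cnj (harmonic_expr \<phi> x)) \<le> B * norm (case p of (z, x) \<Rightarrow> resolvent_kernel x z)" for p
        using B by (auto simp: split_beta norm_mult mult.commute[of B] intro!: mult_left_mono)
    qed
    define Q where "Q s y = f y * cnj (of_real (weight n s) * (LBINT x. of_real (mehler n s s x y) * harmonic_expr \<phi> x))" for s y
    have Q: "(LBINT x. resolvent_kernel x z * cnj (harmonic_expr \<phi> x)) = (case z of (s, y) \<Rightarrow> Q s y)" for z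
    proof (cases z)
      case (Pair s y)
      have "(LBINT x. resolvent_kernel x z * cnj (harmonic_expr \<phi> x))
          = (LBINT x. (of_real (weight n s) * f y) * cnj (of_real (mehler n s s x y) * harmonic_expr \<phi> x))"
        by (simp add: resolvent_kernel_def Pair mult_ac)
      also have "\<dots> = (of_real (weight n s) * f y) * cnj (LBINT x. of_real (mehler n s s x y) * harmonic_expr \<phi> x)"
        by (simp only: integral_mult_right_zero Bochner_Integration.integral_cnj)
      finally show ?thesis by (simp add: Q_def Pair mult_ac)
    qed
    have intQ: "integrable lborel (\<lambda>(s, y). Q s y)"
      using integrable_iterated[OF int] unfolding Q by simp
    have "(LBINT x. resolvent n f x * cnj (harmonic_expr \<phi> x))
        = (LBINT x. (LBINT z. resolvent_kernel x z * cnj (harmonic_expr \<phi> x)))"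
      unfolding resolvent_eq(2) by simp
    also have "\<dots> = (LBINT z. (case z of (s, y) \<Rightarrow> Q s y))"
      unfolding integral_iterated_swap[OF int, symmetric] Q ..
    also have "\<dots> = (LBINT y. (LBINT s. Q s y))"
      unfolding integral_iterated[OF intQ, symmetric] by (rule integral_iterated_swap[OF intQ])
    also have "\<dots> = (LBINT y. f y * cnj (\<phi> y))"
    proof (rule Bochner_Integration.integral_cong)
      fix y
      show "(LBINT s. Q s y) = f y * cnj (\<phi> y)"
        unfolding Q_def integral_mult_right_zero Bochner_Integration.integral_cnj resolvent_identity[OF dim n \<phi>] ..
    qed simp
    finally show ?thesis .
  qed
  moreover have "square_integrable (resolvent n f)"
    by (rule square_integrable_bounded[OF resolvent_integrable resolvent_bound[OF M]])
  moreover have "square_integrable f"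
    by (rule square_integrable_bounded[OF schwartz_integrable[OF f] M(2)])
  ultimately show ?thesis by (simp add: harmonic_oscillator_def)
qed

text \<open>The symbol contributes exp (- s |\<xi>|^2) and the cutoff exp (- e |\<xi>|^2), so the
  \<xi>-integral is the Fourier transform of a Gaussian with parameter s + e. The factor in (x +
  y)/2 keeps its parameter \<open>s\<close>, which is why \<open>mehler\<close> has two time
  parameters.\<close>

lemma regularized_weyl_integral:
  assumes e: "e > 0"
  shows "(LBINT p. (case p of (y, \<xi>) \<Rightarrow> of_real (exp (- (e * (norm \<xi>)\<^sup>2))) *
        (cis ((x - y) \<bullet> \<xi>) * resolvent_symbol n ((x + y) /\<^sub>R 2, \<xi>) * f y)))
    = of_real ((2 * pi) ^ (2 * n)) *
      (LBINT s. of_real (weight n s) * (LBINT y. of_real (mehler n (s + e) s x y) * f y))"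
proof -
  let ?L = "\<lambda>p. case p of (y, \<xi>) \<Rightarrow> of_real (exp (- (e * (norm \<xi>)\<^sup>2))) *
        (cis ((x - y) \<bullet> \<xi>) * resolvent_symbol n ((x + y) /\<^sub>R 2, \<xi>) * f y)"
    and ?E = "\<lambda>s y \<xi>. exp (- (s * (norm ((x + y) /\<^sub>R 2, \<xi>))\<^sup>2))"
  note [measurable] = schwartz_measurable[OF f]
  define T where "T s p = (case p of (y, \<xi>) \<Rightarrow>
    of_real (weight n s * ?E s y \<xi> * exp (- (e * (norm \<xi>)\<^sup>2))) * (cis ((x - y) \<bullet> \<xi>) * f y))"
    for s :: real and p :: "'a \<times> 'a"
  have bound: "norm (T s (y, \<xi>)) \<le> indicator {0..1} s * (norm (f y) * exp (- (e * (norm \<xi>)\<^sup>2)))" for s y \<xi>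
  proof (cases "s \<in> {0..1}")
    case True
    have "\<bar>weight n s\<bar> * \<bar>?E s y \<xi>\<bar> \<le> 1 * 1"
      using True weight_bound[of n s] by (intro mult_mono) auto
    then have "\<bar>weight n s\<bar> * \<bar>?E s y \<xi>\<bar> * (norm (f y) * exp (- (e * (norm \<xi>)\<^sup>2)))
        \<le> 1 * (norm (f y) * exp (- (e * (norm \<xi>)\<^sup>2)))"
      by (intro mult_right_mono) auto
    then show ?thesis
      using True by (simp add: T_def norm_mult abs_mult mult_ac del: norm_Pair)
  qed (simp add: T_def weight_def)
  have hint: "integrable lborel (\<lambda>(y, \<xi>::'a). norm (f y) * exp (- (e * (norm \<xi>)\<^sup>2)))"
    using schwartz_integrable[OF f] integrable_gaussian[OF e, where 'a='a] by (intro integrable_pair_mult) auto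
  have Tm: "(\<lambda>(s, p). T s p) \<in> borel_measurable borel"
    unfolding T_def split_beta by measurable
  have int: "integrable lborel (\<lambda>(s, p). T s p)"
  proof (rule integrable_pair_bound[OF Tm _ hint])
    show "integrable lborel (\<lambda>s::real. indicator {0..1} s * 1 :: real)" by (rule integrable_indicator_01)
    show "norm (T s p) \<le> indicator {0..1} s * 1 * (case p of (y, \<xi>) \<Rightarrow> norm (f y) * exp (- (e * (norm \<xi>)\<^sup>2)))" for s p
      using bound by (cases p) simp
  qed
  have "(LBINT p. ?L p) = (LBINT p. (LBINT s. T s p))"
  proof (rule Bochner_Integration.integral_cong)
    fix p :: "'a \<times> 'a"
    obtain y \<xi> where p: "p = (y, \<xi>)" by fastforce
    let ?c = "of_real (exp (- (e * (norm \<xi>)\<^sup>2))) * (cis ((x - y) \<bullet> \<xi>) * f y)"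
    have "(LBINT s. T s p) = (LBINT s. of_real (weight n s * ?E s y \<xi>) * ?c)"
      by (simp add: T_def p mult_ac del: norm_Pair)
    also have "\<dots> = resolvent_symbol n ((x + y) /\<^sub>R 2, \<xi>) * ?c"
      unfolding integral_mult_left_zero resolvent_symbol_eq ..
    finally show "?L p = (LBINT s. T s p)"
      by (simp add: p mult_ac)
  qed simp
  also have "\<dots> = (LBINT s. (LBINT p. T s p))"
    by (rule integral_iterated_swap[OF int, symmetric])
  also have "\<dots> = (LBINT s. of_real ((2 * pi) ^ (2 * n)) * (of_real (weight n s) * (LBINT y. of_real (mehler n (s + e) s x y) * f y)))"
  proof (rule Bochner_Integration.integral_cong)
    fix s :: real
    show "(LBINT p. T s p) = of_real ((2 * pi) ^ (2 * n)) * (of_real (weight n s) * (LBINT y. of_real (mehler n (s + e) s x y) * f y))"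
    proof (cases "s \<in> {0..1}")
      case True
      define \<tau> where "\<tau> = s + e"
      have \<tau>: "\<tau> > 0" using True e by (simp add: \<tau>_def)
      have i: "integrable lborel (\<lambda>(y, \<xi>). T s (y, \<xi>))"
      proof (rule integrable_dominated[OF hint])
        show "(\<lambda>(y, \<xi>). T s (y, \<xi>)) \<in> borel_measurable borel"
          unfolding T_def split_beta by measurable
        show "norm (case p of (y, \<xi>) \<Rightarrow> T s (y, \<xi>)) \<le> (case p of (y, \<xi>) \<Rightarrow> norm (f y) * exp (- (e * (norm \<xi>)\<^sup>2)))" for p
          using bound[of s "fst p" "snd p"] True by (cases p) simp
      qed
      have "(LBINT p. T s p) = (LBINT y. (LBINT \<xi>. T s (y, \<xi>)))"
        unfolding integral_iterated[OF i] by simp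
      also have "\<dots> = (LBINT y. (of_real ((2 * pi) ^ (2 * n)) * of_real (weight n s)) * (of_real (mehler n \<tau> s x y) * f y))"
      proof (rule Bochner_Integration.integral_cong)
        fix y
        have ex: "?E s y \<xi> * exp (- (e * (norm \<xi>)\<^sup>2))
            = exp (- (s * (norm (x + y))\<^sup>2 / 4)) * exp (- (\<tau> * (norm \<xi>)\<^sup>2))" for \<xi> :: 'a
        proof -
          have "(norm ((x + y) /\<^sub>R 2, \<xi>))\<^sup>2 = (norm (x + y))\<^sup>2 / 4 + (norm \<xi>)\<^sup>2"
            by (simp add: norm_Pair power_mult_distrib power_divide)
          then show ?thesis
            unfolding exp_add[symmetric] \<tau>_def by (simp add: algebra_simps)
        qed
        have "(LBINT \<xi>. T s (y, \<xi>))
          = (LBINT \<xi>. (of_real (weight n s * exp (- (s * (norm (x + y))\<^sup>2 / 4))) * f y) * (cis ((x - y) \<bullet> \<xi>) * of_real (exp (- (\<tau> * (norm \<xi>)\<^sup>2)))))"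
          unfolding T_def prod.case mult.assoc[of "weight n s"] ex by (simp add: mult_ac)
        also have "\<dots> = (of_real (weight n s * exp (- (s * (norm (x + y))\<^sup>2 / 4))) * f y) *
            of_real (sqrt (pi / \<tau>) ^ DIM('a) * exp (- (norm (x - y))\<^sup>2 / (4 * \<tau>)))"
          unfolding integral_mult_right_zero gaussian_fourier[OF \<tau>] ..
        also have "sqrt (pi / \<tau>) ^ DIM('a) = (2 * pi) ^ (2 * n) / (4 * pi * \<tau>) ^ n"
        proof -
          have 1: "sqrt (pi / \<tau>) ^ DIM('a) = (pi / \<tau>) ^ n"
            unfolding dim power_mult using \<tau> by simp
          have 2: "pi / \<tau> = (2 * pi)\<^sup>2 / (4 * pi * \<tau>)"
            using \<tau> by (simp add: power2_eq_square field_simps)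
          show ?thesis
            unfolding 1 unfolding 2 by (simp only: power_divide power_mult)
        qed
        finally show "(LBINT \<xi>. T s (y, \<xi>))
            = (of_real ((2 * pi) ^ (2 * n)) * of_real (weight n s)) * (of_real (mehler n \<tau> s x y) * f y)"
          by (simp add: mehler_def heat_def mult_ac)
      qed simp
      finally show ?thesis by (simp add: \<tau>_def mult.assoc)
    qed (simp add: weight_def T_def)
  qed simp
  also have "\<dots> = of_real ((2 * pi) ^ (2 * n)) *
      (LBINT s. of_real (weight n s) * (LBINT y. of_real (mehler n (s + e) s x y) * f y))"
    by (rule integral_mult_right_zero)
  finally show ?thesis .
qed

text \<open>Two dominated convergences: at fixed s > 0 the kernels are bounded by 1 / (4 pi s)^n,
  and the outer integrand is bounded by the sup of |f| uniformly in \<open>e\<close>. The square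
  appears because the Gaussian cutoff is evaluated at \<open>e *\<^sub>R \<xi>\<close>.\<close>

lemma regularized_resolvent_limit:
  "((\<lambda>e. LBINT s. of_real (weight n s) * (LBINT y. of_real (mehler n (s + e\<^sup>2) s x y) * f y))
    \<longlongrightarrow> resolvent n f x) (at_right 0)"
proof -
  note [measurable] = schwartz_measurable[OF f]
  obtain M where M: "M \<ge> 0" "\<And>y. norm (f y) \<le> M" using schwartz_bounded[OF f] by blast
  let ?P = "\<lambda>t s. LBINT y. of_real (mehler n (s + t) s x y) * f y"
  show ?thesis
    unfolding resolvent_def
  proof (rule integral_dominated_convergence_at_right)
    show "integrable lborel (\<lambda>s::real. indicator {0..1} s * M)" by (rule integrable_indicator_01)
    have [measurable]: "?P t \<in> borel_measurable borel" for t
      by (intro borel_measurable_parameter_integral) (unfold split_beta, measurable)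
    show "(\<lambda>s. of_real (weight n s) * ?P (e\<^sup>2) s) \<in> borel_measurable lborel" for e
      by measurable
    have "(\<lambda>s. of_real (weight n s) * ?P 0 s) \<in> borel_measurable lborel"
      by measurable
    then show "(\<lambda>s. of_real (weight n s) * (LBINT y. of_real (mehler n s s x y) * f y)) \<in> borel_measurable lborel"
      by simp
    show "norm (of_real (weight n s) * ?P (e\<^sup>2) s) \<le> indicator {0..1} s * M" for e s
    proof (cases "s \<in> {0..1}")
      case True
      then show ?thesis
        unfolding norm_mult norm_of_real by (intro mult_mono weight_bound mehler_apply_bound[OF dim n _ M]) auto
    qed (simp add: weight_def)
    \<comment> \<open>The point s = 0 has to be excluded: there the kernels at time e^2 concentrate
      and tend to \<open>f x\<close>, whereas the kernel at time 0 is 0 by default.\<close>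
    show "AE s in lborel. ((\<lambda>e. of_real (weight n s) * ?P (e\<^sup>2) s)
        \<longlongrightarrow> of_real (weight n s) * (LBINT y. of_real (mehler n s s x y) * f y)) (at_right 0)"
      using AE_lborel_singleton[of "0::real"]
    proof eventually_elim
      case (elim s)
      show ?case
      proof (cases "s > 0")
        case True
        have "((\<lambda>e. ?P (e\<^sup>2) s)
          \<longlongrightarrow> (LBINT y. of_real (mehler n s s x y) * f y)) (at_right 0)"
        proof (rule integral_dominated_convergence_at_right)
          show "integrable lborel (\<lambda>y. 1 / (4 * pi * s) ^ n * norm (f y))"
            using schwartz_integrable[OF f] by auto
          show "norm (of_real (mehler n (s + e\<^sup>2) s x y) * f y) \<le> 1 / (4 * pi * s) ^ n * norm (f y)" for e y
          proof -
            have "mehler n (s + e\<^sup>2) s x y \<le> 1 / (4 * pi * (s + e\<^sup>2)) ^ n"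
              using True by (intro mehler_le) auto
            also have "\<dots> \<le> 1 / (4 * pi * s) ^ n"
              using True by (intro divide_left_mono power_mono mult_left_mono mult_pos_pos zero_less_power) (auto simp: add_pos_nonneg)
            finally have "\<bar>mehler n (s + e\<^sup>2) s x y\<bar> \<le> 1 / (4 * pi * s) ^ n"
              using mehler_nonneg[of "s + e\<^sup>2" n s x y] True by simp
            then show ?thesis unfolding norm_mult norm_of_real by (intro mult_right_mono) auto
          qed
          show "AE y in lborel. ((\<lambda>e. of_real (mehler n (s + e\<^sup>2) s x y) * f y) \<longlongrightarrow> of_real (mehler n s s x y) * f y) (at_right 0)"
          proof (rule AE_I2)
            fix y
            have "((\<lambda>e. of_real (mehler n (s + e\<^sup>2) s x y) * f y) \<longlongrightarrow> of_real (mehler n (s + 0\<^sup>2) s x y) * f y) (at_right 0)"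
              unfolding mehler_def heat_def using True by (intro tendsto_intros) auto
            then show "((\<lambda>e. of_real (mehler n (s + e\<^sup>2) s x y) * f y) \<longlongrightarrow> of_real (mehler n s s x y) * f y) (at_right 0)"
              by simp
          qed
        qed measurable
        then show ?thesis by (rule tendsto_mult_left)
      next
        case False
        then show ?thesis using elim by (simp add: weight_def)
      qed
    qed
  qed
qed

text \<open>\<open>amplitude_oscillatory_integral\<close> already provides a value \<open>I\<close>
  common to all cutoffs, so the Gaussian cutoff may be used to compute it.\<close>

theorem resolvent_weyl_value: "has_weyl_value (resolvent_symbol n) f x (resolvent n f x)"
proof -
  define \<psi> :: "'a \<Rightarrow> complex" where "\<psi> = (\<lambda>x. of_real (exp (- (norm x)\<^sup>2)))"
  have \<psi>: "schwartz \<psi>" "\<psi> 0 = 1"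
    unfolding \<psi>_def by (simp_all add: standard_gaussian_schwartz)
  have \<psi>_eq: "\<psi> (e *\<^sub>R \<xi>) = of_real (exp (- (e\<^sup>2 * (norm \<xi>)\<^sup>2)))" for e \<xi>
    by (simp add: \<psi>_def power_mult_distrib)
  define I where "I = (LBINT \<xi>. cis (x \<bullet> \<xi>) * inner_integral (resolvent_symbol n) f x \<xi>)"
  have osc: "has_oscillatory_integral (\<lambda>y \<xi>. cis ((x - y) \<bullet> \<xi>) * resolvent_symbol n ((x + y) /\<^sub>R 2, \<xi>) * f y) I"
    unfolding I_def by (rule amplitude_oscillatory_integral[OF resolvent_symbol_amplitude f])
  then have "((\<lambda>e. integral\<^sup>L lborel (\<lambda>(y, \<xi>). \<psi> (e *\<^sub>R \<xi>) *
      (cis ((x - y) \<bullet> \<xi>) * resolvent_symbol n ((x + y) /\<^sub>R 2, \<xi>) * f y))) \<longlongrightarrow> I) (at_right 0)"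
    unfolding has_oscillatory_integral_def using \<psi> by blast
  then have 1: "((\<lambda>e. of_real ((2 * pi) ^ (2 * n)) *
      (LBINT s. of_real (weight n s) * (LBINT y. of_real (mehler n (s + e\<^sup>2) s x y) * f y))) \<longlongrightarrow> I) (at_right 0)"
  proof (rule Lim_transform_eventually)
    have "\<forall>\<^sub>F e in at_right 0. e > (0::real)" by (simp add: eventually_at_filter)
    then show "\<forall>\<^sub>F e in at_right 0. integral\<^sup>L lborel (\<lambda>(y, \<xi>). \<psi> (e *\<^sub>R \<xi>) *
        (cis ((x - y) \<bullet> \<xi>) * resolvent_symbol n ((x + y) /\<^sub>R 2, \<xi>) * f y))
      = of_real ((2 * pi) ^ (2 * n)) *
        (LBINT s. of_real (weight n s) * (LBINT y. of_real (mehler n (s + e\<^sup>2) s x y) * f y))"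
      unfolding \<psi>_eq by (rule eventually_mono) (intro regularized_weyl_integral, simp)
  qed
  have 2: "((\<lambda>e. of_real ((2 * pi) ^ (2 * n)) *
      (LBINT s. of_real (weight n s) * (LBINT y. of_real (mehler n (s + e\<^sup>2) s x y) * f y)))
      \<longlongrightarrow> of_real ((2 * pi) ^ (2 * n)) * resolvent n f x) (at_right 0)"
    by (rule tendsto_mult_left[OF regularized_resolvent_limit])
  have "I = of_real ((2 * pi) ^ (2 * n)) * resolvent n f x"
    by (rule tendsto_unique[OF _ 1 2]) simp
  then show ?thesis
    unfolding has_weyl_value_def using osc by (intro exI[of _ I]) (auto simp: dim)
qed

end

theorem resolvent_symbol_is_weyl_symbol:
  "is_weyl_symbol (harmonic_oscillator\<inverse>) (resolvent_symbol n :: 'a \<times> 'a \<Rightarrow> complex)"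
  unfolding is_weyl_symbol_def
proof (intro conjI allI impI)
  show "amplitude (resolvent_symbol n)"
    unfolding amplitude_iff using resolvent_symbol_amplitude by blast
  fix f :: "'a \<Rightarrow> complex" assume "schwartz f"
  then show "\<exists>u. (f, u) \<in> harmonic_oscillator\<inverse> \<and> (\<forall>x. has_weyl_value (resolvent_symbol n) f x (u x))"
    using resolvent_harmonic_oscillator resolvent_weyl_value by blast
qed

end

section \<open>Uniqueness of the Weyl symbol\<close>

text \<open>Integrating the vanishing transform against exp (- r^2 |Z|^2) with the phase of
  \<open>X0\<close> shows, by Fubini, that Gaussian averages of \<Phi> around \<open>X0\<close> are
  zero at every scale; as the scale shrinks they tend to a nonzero multiple of
  \<open>\<Phi> X0\<close>.\<close>

theorem fourier_injective:
  fixes \<Phi> :: "'a::euclidean_space \<Rightarrow> complex"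
  assumes cont: "continuous_on UNIV \<Phi>" and int: "integrable lborel \<Phi>" and M: "\<And>X. norm (\<Phi> X) \<le> M"
    and zero: "\<And>Z. (LBINT X. cis (Z \<bullet> X) * \<Phi> X) = 0"
  shows "\<Phi> X0 = 0"
proof -
  have [measurable]: "\<Phi> \<in> borel_measurable borel" by (rule borel_measurable_continuous_onI[OF cont])
  define A where "A r Y = of_real (exp (- (norm Y)\<^sup>2)) * \<Phi> (X0 + (2 * r) *\<^sub>R Y)" for r :: real and Y :: 'a
  have A0: "(LBINT Y. A r Y) = 0" if r: "r > 0" for r
  proof -
    have d2: "r\<^sup>2 > 0" using r by simp
    define F where "F Z X = of_real (exp (- (r\<^sup>2 * (norm Z)\<^sup>2))) * cis ((X - X0) \<bullet> Z) * \<Phi> X" for Z X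
    have F: "integrable lborel (\<lambda>(Z, X). F Z X)"
    proof (rule integrable_pair_bound)
      show "(\<lambda>(Z, X). F Z X) \<in> borel_measurable borel"
        unfolding F_def split_beta by measurable
      show "integrable lborel (\<lambda>Z::'a. exp (- (r\<^sup>2 * (norm Z)\<^sup>2)))" by (rule integrable_gaussian[OF d2])
      show "integrable lborel (\<lambda>X. norm (\<Phi> X))" using int by simp
    qed (simp add: F_def norm_mult)
    have "(LBINT X. F Z X) = 0" for Z
    proof -
      have "F Z X = (of_real (exp (- (r\<^sup>2 * (norm Z)\<^sup>2))) * cis (- (X0 \<bullet> Z))) * (cis (Z \<bullet> X) * \<Phi> X)" for X
      proof -
        have "(X - X0) \<bullet> Z = - (X0 \<bullet> Z) + Z \<bullet> X" by (simp add: inner_diff_left inner_commute[of X Z])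
        then show ?thesis by (simp only: F_def cis_mult[symmetric] mult_ac)
      qed
      then show ?thesis by (simp add: zero)
    qed
    then have "0 = (LBINT X. (LBINT Z. F Z X))"
      using integral_iterated_swap[OF F] by simp
    also have "\<dots> = (LBINT X. of_real (sqrt (pi / r\<^sup>2) ^ DIM('a)) * (of_real (exp (- (norm (X - X0))\<^sup>2 / (4 * r\<^sup>2))) * \<Phi> X))"
    proof (rule Bochner_Integration.integral_cong)
      fix X
      have "(LBINT Z. F Z X) = (LBINT Z. (cis ((X - X0) \<bullet> Z) * of_real (exp (- (r\<^sup>2 * (norm Z)\<^sup>2)))) * \<Phi> X)"
        by (simp add: F_def mult.commute)
      also have "\<dots> = of_real (sqrt (pi / r\<^sup>2) ^ DIM('a) * exp (- (norm (X - X0))\<^sup>2 / (4 * r\<^sup>2))) * \<Phi> X"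
        unfolding integral_mult_left_zero gaussian_fourier[OF d2] ..
      finally show "(LBINT Z. F Z X) = of_real (sqrt (pi / r\<^sup>2) ^ DIM('a)) * (of_real (exp (- (norm (X - X0))\<^sup>2 / (4 * r\<^sup>2))) * \<Phi> X)"
        by simp
    qed simp
    also have "\<dots> = of_real (sqrt (pi / r\<^sup>2) ^ DIM('a)) * (LBINT X. of_real (exp (- (norm (X - X0))\<^sup>2 / (4 * r\<^sup>2))) * \<Phi> X)"
      by (rule integral_mult_right_zero)
    finally have "(LBINT X. of_real (exp (- (norm (X - X0))\<^sup>2 / (4 * r\<^sup>2))) * \<Phi> X) = 0"
      using r by simp
    moreover have "(LBINT Y. of_real (exp (- (norm (X0 + (2 * r) *\<^sub>R Y - X0))\<^sup>2 / (4 * r\<^sup>2))) * \<Phi> (X0 + (2 * r) *\<^sub>R Y))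
        = (LBINT X. of_real (exp (- (norm (X - X0))\<^sup>2 / (4 * r\<^sup>2))) * \<Phi> X) /\<^sub>R \<bar>2 * r\<bar> ^ DIM('a)"
      by (rule lborel_integral_affine) (use r in \<open>simp, measurable\<close>)
    moreover have "(norm (X0 + (2 * r) *\<^sub>R Y - X0))\<^sup>2 / (4 * r\<^sup>2) = (norm Y)\<^sup>2" for Y :: 'a
      using r by (simp add: power_mult_distrib)
    ultimately show ?thesis unfolding A_def by simp
  qed
  have "((\<lambda>r. LBINT Y. A r Y) \<longlongrightarrow> of_real (sqrt pi ^ DIM('a)) * \<Phi> X0) (at_right 0)"
    unfolding A_def
    by (rule gaussian_average_limit) (auto intro!: continuous_intros continuous_on_UNIV_compose[OF cont] M)
  moreover have "((\<lambda>r. LBINT Y. A r Y) \<longlongrightarrow> 0) (at_right 0)"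
    by (rule Lim_transform_eventually[OF tendsto_const]) (use A0 in \<open>auto simp: eventually_at_filter\<close>)
  ultimately have "of_real (sqrt pi ^ DIM('a)) * \<Phi> X0 = 0"
    using tendsto_unique[OF trivial_limit_at_right_real] by blast
  then show ?thesis by simp
qed

lemma weyl_value_eq:
  fixes a :: "'a::euclidean_space \<times> 'a \<Rightarrow> complex"
  assumes a: "amplitude_of_order m a" and f: "schwartz f" and v: "has_weyl_value a f x v"
  shows "of_real ((2 * pi) ^ DIM('a)) * v = (LBINT \<xi>. cis (x \<bullet> \<xi>) * inner_integral a f x \<xi>)"
proof -
  define \<psi> :: "'a \<Rightarrow> complex" where "\<psi> = (\<lambda>x. of_real (exp (- (norm x)\<^sup>2)))"
  have \<psi>: "schwartz \<psi> \<and> \<psi> 0 = 1"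
    unfolding \<psi>_def by (simp add: standard_gaussian_schwartz)
  obtain I where I: "has_oscillatory_integral (\<lambda>y \<xi>. cis ((x - y) \<bullet> \<xi>) * a ((x + y) /\<^sub>R 2, \<xi>) * f y) I"
    "v = I / of_real ((2 * pi) ^ DIM('a))"
    using v unfolding has_weyl_value_def by blast
  have "I = (LBINT \<xi>. cis (x \<bullet> \<xi>) * inner_integral a f x \<xi>)"
    using I(1) amplitude_oscillatory_integral[OF a f, of x] \<psi> tendsto_unique[OF trivial_limit_at_right_real]
    unfolding has_oscillatory_integral_def by blast
  then show ?thesis using I(2) by simp
qed

text \<open>An unnormalized coherent state: the ground state exp (- |x|^2 / 2) of H, displaced in
  position by \<open>p\<close> and in momentum by \<open>q\<close>.\<close>

definition coherent :: "'a::euclidean_space \<Rightarrow> 'a \<Rightarrow> 'a \<Rightarrow> complex" where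
  "coherent p q x = exp (- of_real (1 / 2 * (norm x)\<^sup>2) + clinear p q x)"

lemma coherent_schwartz: "schwartz (coherent p q)"
  unfolding coherent_def[abs_def] by (rule gaussian_schwartz) simp

lemma cnj_coherent: "cnj (coherent p q x) = coherent p (- q) x"
  by (simp add: coherent_def clinear_def exp_cnj)

lemma gaussian_amplitude:
  fixes a :: "'a::euclidean_space \<Rightarrow> complex"
  assumes a: "amplitude_of_order m a"
  shows "integrable lborel (\<lambda>X. of_real (exp (- (norm X)\<^sup>2)) * a X)"
    and "\<exists>M. \<forall>X. norm (of_real (exp (- (norm X)\<^sup>2)) * a X) \<le> M"
    and "continuous_on UNIV (\<lambda>X. of_real (exp (- (norm X)\<^sup>2)) * a X)"
proof -
  obtain C where C: "C \<ge> 0" "\<And>X. norm (a X) \<le> C * (1 + norm X) ^ m" using amplitude_bound[OF a] by blast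
  show "continuous_on UNIV (\<lambda>X. of_real (exp (- (norm X)\<^sup>2)) * a X)"
    by (intro continuous_intros amplitude_continuous[OF a])
  show "integrable lborel (\<lambda>X. of_real (exp (- (norm X)\<^sup>2)) * a X)"
    unfolding mult.commute[of "of_real _"]
    by (rule schwartz_integrable_mult[OF standard_gaussian_schwartz _ C(2)])
      (rule borel_measurable_continuous_onI[OF amplitude_continuous[OF a]])
  have "norm (of_real (exp (- (norm X)\<^sup>2)) * a X) \<le> C * (fact m * exp (1 + (0 + 1)\<^sup>2 / (4 * 1)))" for X
  proof -
    have "norm (of_real (exp (- (norm X)\<^sup>2)) * a X) \<le> C * ((1 + norm X) ^ m * exp (0 * norm X - 1 * (norm X)\<^sup>2))"
      using mult_left_mono[OF C(2)[of X], of "exp (- (norm X)\<^sup>2)"] by (simp add: norm_mult mult_ac)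
    also have "\<dots> \<le> C * (fact m * exp (1 + (0 + 1)\<^sup>2 / (4 * 1)))"
      by (intro mult_left_mono power_le_exp C(1)) auto
    finally show ?thesis .
  qed
  then show "\<exists>M. \<forall>X. norm (of_real (exp (- (norm X)\<^sup>2)) * a X) \<le> M" by blast
qed

text \<open>The Wigner function of a pair of coherent states is a modulated Gaussian.\<close>

lemma coherent_pairing:
  fixes a :: "'a::euclidean_space \<times> 'a \<Rightarrow> complex"
  assumes a: "amplitude_of_order m a"
  shows "(LBINT x. coherent (\<nu> /\<^sub>R 2) (\<mu> /\<^sub>R 2) x *
      (LBINT \<xi>. cis (x \<bullet> \<xi>) * inner_integral a (coherent (- (\<nu> /\<^sub>R 2)) (\<mu> /\<^sub>R 2)) x \<xi>))
    = of_real (exp ((norm \<nu>)\<^sup>2 / 4) * sqrt (4 * pi) ^ DIM('a)) *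
      (LBINT X. cis ((\<mu>, \<nu>) \<bullet> X) * (of_real (exp (- (norm X)\<^sup>2)) * a X))"
proof -
  let ?H = "\<lambda>X. cis ((\<mu>, \<nu>) \<bullet> X) * (of_real (exp (- (norm X)\<^sup>2)) * a X)"
  \<comment> \<open>With these signs the linear exponents of \<open>k x * f y\<close> add up to
    \<nu> . (x - y) / 2 + i \<mu> . (x + y) / 2: a real exponent in the difference and a pure phase
    in the midpoint.\<close>
  define f where "f = coherent (- (\<nu> /\<^sub>R 2)) (\<mu> /\<^sub>R 2)"
  define k where "k = coherent (\<nu> /\<^sub>R 2) (\<mu> /\<^sub>R 2)"
  have f: "schwartz f" and k: "schwartz k" by (simp_all add: f_def k_def coherent_schwartz)
  note [measurable] = schwartz_measurable[OF f] schwartz_measurable[OF k]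
    inner_integral_measurable[OF a f] borel_measurable_continuous_onI[OF amplitude_continuous[OF a]]
  define c where "c = exp ((norm \<nu>)\<^sup>2 / 4) * sqrt (4 * pi) ^ DIM('a)"
  obtain D where D: "D \<ge> 0"
    "\<And>x \<xi>. norm (inner_integral a f x \<xi>) \<le> D * (1 + norm x) ^ m * (1 / (1 + norm \<xi>) ^ (2 * DIM('a)))"
    using inner_integral_decay[OF a f] by metis
  have int1: "integrable lborel (\<lambda>(x, \<xi>). k x * (cis (x \<bullet> \<xi>) * inner_integral a f x \<xi>))"
  proof (rule integrable_pair_bound)
    have "(\<lambda>p. k (fst p) * (cis (fst p \<bullet> snd p) * (case p of (x, \<xi>) \<Rightarrow> inner_integral a f x \<xi>))) \<in> borel_measurable borel"
      by measurable
    then show "(\<lambda>(x, \<xi>). k x * (cis (x \<bullet> \<xi>) * inner_integral a f x \<xi>)) \<in> borel_measurable borel"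
      by (simp add: split_beta)
    show "integrable lborel (\<lambda>x. D * ((1 + norm x) ^ m * norm (k x)))"
      by (intro integrable_mult_right schwartz_integrable_power[OF k])
    show "integrable lborel (\<lambda>\<xi>::'a. 1 / (1 + norm \<xi>) ^ (2 * DIM('a)))" by (rule integrable_inverse_power)
    show "norm (k x * (cis (x \<bullet> \<xi>) * inner_integral a f x \<xi>)) \<le> D * ((1 + norm x) ^ m * norm (k x)) * (1 / (1 + norm \<xi>) ^ (2 * DIM('a)))" for x \<xi>
      using mult_left_mono[OF D(2)[of x \<xi>] norm_ge_zero[of "k x"]] by (simp add: norm_mult mult_ac)
  qed
  have fixed: "(LBINT x. k x * (cis (x \<bullet> \<xi>) * inner_integral a f x \<xi>))
      = of_real c * (LBINT m. ?H (m, \<xi>))" for \<xi>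
  proof -
    \<comment> \<open>In the variables midpoint and difference t = x - y the integrand at fixed
      \<xi> factors: \<open>P\<close> carries the symbol and the midpoint Gaussian, \<open>R\<close>
      is an explicit Gaussian in \<open>t\<close>. The translation x - t/2 then disappears under the
      \<open>x\<close>-integral.\<close>
    define P where "P m = cis (\<mu> \<bullet> m) * (of_real (exp (- (norm m)\<^sup>2)) * a (m, \<xi>))" for m
    define R where "R t = of_real (exp (- ((norm t)\<^sup>2 / 4) + (\<nu> \<bullet> t) / 2)) * cis (\<xi> \<bullet> t)" for t
    have [measurable]: "P \<in> borel_measurable borel" "R \<in> borel_measurable borel"
      unfolding P_def R_def by measurable
    \<comment> \<open>Completing the square: \<open>R\<close> is a Gaussian centred at \<nu>. The
      recentring produces the phase \<open>cis (\<xi> \<bullet> \<nu>)\<close>, the second component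
      of the phase-space Fourier character.\<close>
    have R_shift: "R (\<nu> + 1 *\<^sub>R t) = of_real (exp ((norm \<nu>)\<^sup>2 / 4)) * cis (\<xi> \<bullet> \<nu>) * (cis (\<xi> \<bullet> t) * of_real (exp (- (1 / 4 * (norm t)\<^sup>2))))" for t
    proof -
      have "- ((norm (\<nu> + t))\<^sup>2 / 4) + (\<nu> \<bullet> (\<nu> + t)) / 2 = (norm \<nu>)\<^sup>2 / 4 + - (1 / 4 * (norm t)\<^sup>2)"
        by (simp add: power2_norm_eq_inner inner_add_left inner_add_right inner_commute field_simps)
      then show ?thesis
        unfolding R_def scaleR_one inner_add_right[of \<xi>] cis_mult[symmetric] by (simp only: exp_add of_real_mult mult_ac)
    qed
    have g: "integrable lborel (\<lambda>t::'a. cis (\<xi> \<bullet> t) * of_real (exp (- (1 / 4 * (norm t)\<^sup>2))))"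
      "(LBINT t. cis (\<xi> \<bullet> t) * of_real (exp (- (1 / 4 * (norm t)\<^sup>2))))
        = of_real (sqrt (4 * pi) ^ DIM('a) * exp (- (norm \<xi>)\<^sup>2))"
      using integrable_gaussian_fourier[of "1/4" \<xi>] gaussian_fourier[of "1/4" \<xi>] by (simp_all add: mult.commute)
    have "integrable lborel (\<lambda>t. R (\<nu> + 1 *\<^sub>R t))"
      unfolding R_shift by (intro integrable_mult_right g)
    from lborel_integrable_affine[OF _ this, of 1 "- \<nu>"] have intR: "integrable lborel R" by simp
    have R: "(LBINT t. R t) = of_real (c * exp (- (norm \<xi>)\<^sup>2)) * cis (\<xi> \<bullet> \<nu>)"
    proof -
      have "(LBINT t. R t) = (LBINT t. R (\<nu> + 1 *\<^sub>R t))"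
        by (subst lborel_integral_affine) auto
      also have "\<dots> = of_real (exp ((norm \<nu>)\<^sup>2 / 4)) * cis (\<xi> \<bullet> \<nu>) * of_real (sqrt (4 * pi) ^ DIM('a) * exp (- (norm \<xi>)\<^sup>2))"
        unfolding R_shift integral_mult_right_zero g(2) ..
      finally show ?thesis by (simp add: c_def mult_ac)
    qed
    have intP: "integrable lborel P"
    proof -
      obtain C where C: "C \<ge> 0" "\<And>X. norm (a X) \<le> C * (1 + norm X) ^ m" using amplitude_bound[OF a] by blast
      have "integrable lborel (\<lambda>y. (cis (\<mu> \<bullet> y) * a (y, \<xi>)) * of_real (exp (- (norm y)\<^sup>2)))"
      proof (rule schwartz_integrable_mult[OF standard_gaussian_schwartz])
        show "norm (cis (\<mu> \<bullet> y) * a (y, \<xi>)) \<le> (C * (1 + norm \<xi>) ^ m) * (1 + norm y) ^ m" for y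
        proof -
          have "1 + norm (y, \<xi>) \<le> 1 + norm y + norm \<xi>" using norm_Pair_le[of y \<xi>] by simp
          also have "\<dots> \<le> (1 + norm \<xi>) * (1 + norm y)" by (simp add: algebra_simps)
          finally have "(1 + norm (y, \<xi>)) ^ m \<le> ((1 + norm \<xi>) * (1 + norm y)) ^ m" by (intro power_mono) auto
          from order_trans[OF C(2) mult_left_mono[OF this C(1)]] show ?thesis
            by (simp add: norm_mult power_mult_distrib mult.assoc)
        qed
      qed measurable
      then show ?thesis by (simp add: P_def[abs_def] mult_ac)
    qed
    have prod: "k x * (cis (x \<bullet> \<xi>) * (cis (- ((x - t) \<bullet> \<xi>)) * (a ((x + (x - t)) /\<^sub>R 2, \<xi>) * f (x - t))))
        = P (- (t /\<^sub>R 2) + 1 *\<^sub>R x) * R t" for x t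
    proof -
      define y where "y = x - t /\<^sub>R 2"
      have x: "x = y + t /\<^sub>R 2" by (simp add: y_def)
      have xt: "x - t = y - t /\<^sub>R 2"
      proof -
        have "t /\<^sub>R 2 + t /\<^sub>R 2 = t" by (simp add: scaleR_left_distrib[symmetric])
        then show ?thesis unfolding x by (metis add_diff_cancel_right diff_diff_eq2 add_diff_eq diff_add_eq_diff_diff_swap)
      qed
      have mid: "(x + (x - t)) /\<^sub>R 2 = y"
        unfolding xt unfolding x by (simp add: scaleR_2[symmetric])
      have y: "- (t /\<^sub>R 2) + 1 *\<^sub>R x = y" by (simp add: y_def)
      have q: "1 / 2 * (norm x)\<^sup>2 + 1 / 2 * (norm (x - t))\<^sup>2 = (norm y)\<^sup>2 + (norm t)\<^sup>2 / 4"
        unfolding xt unfolding x power2_norm_eq_inner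
        by (simp add: inner_add_left inner_add_right inner_diff_left inner_diff_right inner_commute field_simps)
      have lin: "clinear (\<nu> /\<^sub>R 2) (\<mu> /\<^sub>R 2) x + clinear (- (\<nu> /\<^sub>R 2)) (\<mu> /\<^sub>R 2) (x - t)
          = of_real ((\<nu> \<bullet> t) / 2) + \<i> * of_real (\<mu> \<bullet> y)"
        unfolding clinear_def xt unfolding x by (simp add: inner_add_right inner_diff_right complex_eq_iff field_simps)
      have "k x * f (x - t) = exp (- of_real (1 / 2 * (norm x)\<^sup>2 + 1 / 2 * (norm (x - t))\<^sup>2)
          + (clinear (\<nu> /\<^sub>R 2) (\<mu> /\<^sub>R 2) x + clinear (- (\<nu> /\<^sub>R 2)) (\<mu> /\<^sub>R 2) (x - t)))"
        unfolding k_def f_def coherent_def exp_add[symmetric] by (rule arg_cong[of _ _ exp]) simp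
      also have "\<dots> = of_real (exp (- (norm y)\<^sup>2)) * of_real (exp (- ((norm t)\<^sup>2 / 4) + (\<nu> \<bullet> t) / 2)) * cis (\<mu> \<bullet> y)"
        unfolding q lin cis_conv_exp exp_of_real[symmetric] exp_add[symmetric] by (rule arg_cong[of _ _ exp]) simp
      finally have kf: "k x * f (x - t) = \<dots>" .
      have cc: "cis (x \<bullet> \<xi>) * cis (- ((x - t) \<bullet> \<xi>)) = cis (\<xi> \<bullet> t)"
      proof -
        have "x \<bullet> \<xi> + - ((x - t) \<bullet> \<xi>) = \<xi> \<bullet> t" by (simp add: inner_diff_left inner_commute[of t])
        then show ?thesis by (simp only: cis_mult)
      qed
      have "k x * (cis (x \<bullet> \<xi>) * (cis (- ((x - t) \<bullet> \<xi>)) * (a ((x + (x - t)) /\<^sub>R 2, \<xi>) * f (x - t))))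
          = (k x * f (x - t)) * (cis (x \<bullet> \<xi>) * cis (- ((x - t) \<bullet> \<xi>))) * a ((x + (x - t)) /\<^sub>R 2, \<xi>)"
        by (simp only: mult_ac)
      also have "\<dots> = P y * R t"
        unfolding kf cc mid P_def R_def by (simp only: mult_ac)
      finally show ?thesis unfolding y .
    qed
    have int2: "integrable lborel (\<lambda>(t, x). P (- (t /\<^sub>R 2) + 1 *\<^sub>R x) * R t)"
    proof (rule integrable_pair_iterated)
      show "(\<lambda>(t, x). P (- (t /\<^sub>R 2) + 1 *\<^sub>R x) * R t) \<in> borel_measurable borel"
        unfolding split_beta by measurable
      show "integrable lborel (\<lambda>t. (LBINT x. norm (P x)) * norm (R t))" using intR by simp
      show "integrable lborel (\<lambda>x. P (- (t /\<^sub>R 2) + 1 *\<^sub>R x) * R t)" for t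
        by (intro integrable_mult_left lborel_integrable_affine intP) simp
      have "(LBINT x. norm (P (- (t /\<^sub>R 2) + 1 *\<^sub>R x))) = (LBINT x. norm (P x))" for t
        by (subst lborel_integral_affine) auto
      then show "(LBINT x. norm (P (- (t /\<^sub>R 2) + 1 *\<^sub>R x) * R t)) \<le> (LBINT x. norm (P x)) * norm (R t)" for t
        unfolding norm_mult integral_mult_left_zero by simp
    qed
    have "(LBINT x. k x * (cis (x \<bullet> \<xi>) * inner_integral a f x \<xi>))
        = (LBINT x. (LBINT t. P (- (t /\<^sub>R 2) + 1 *\<^sub>R x) * R t))"
    proof (rule Bochner_Integration.integral_cong)
      fix x
      let ?h = "\<lambda>y. cis (- (y \<bullet> \<xi>)) * (a ((x + y) /\<^sub>R 2, \<xi>) * f y)"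
      have "inner_integral a f x \<xi> = (LBINT t. ?h (x + (- 1) *\<^sub>R t))"
        unfolding inner_integral_def by (subst lborel_integral_affine) auto
      then have "k x * (cis (x \<bullet> \<xi>) * inner_integral a f x \<xi>) = (LBINT t. k x * (cis (x \<bullet> \<xi>) * ?h (x - t)))"
        by simp
      then show "k x * (cis (x \<bullet> \<xi>) * inner_integral a f x \<xi>) = (LBINT t. P (- (t /\<^sub>R 2) + 1 *\<^sub>R x) * R t)"
        unfolding prod .
    qed simp
    also have "\<dots> = (LBINT t. (LBINT x. P (- (t /\<^sub>R 2) + 1 *\<^sub>R x) * R t))"
      by (rule integral_iterated_swap[OF int2, symmetric])
    also have "\<dots> = (LBINT t. (LBINT x. P x) * R t)"
      unfolding integral_mult_left_zero by (subst lborel_integral_affine) auto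
    also have "\<dots> = (LBINT x. P x) * (of_real (c * exp (- (norm \<xi>)\<^sup>2)) * cis (\<xi> \<bullet> \<nu>))"
      unfolding integral_mult_right_zero R ..
    also have "\<dots> = (LBINT x. of_real c * (?H (x, \<xi>)))"
    proof (subst integral_mult_left_zero[symmetric], rule Bochner_Integration.integral_cong)
      fix x :: 'a
      have "(norm (x, \<xi>))\<^sup>2 = (norm x)\<^sup>2 + (norm \<xi>)\<^sup>2" by (simp add: norm_Pair)
      then have "exp (- (norm (x, \<xi>))\<^sup>2) = exp (- (norm x)\<^sup>2) * exp (- (norm \<xi>)\<^sup>2)"
        by (simp add: exp_add[symmetric])
      moreover have "cis ((\<mu>, \<nu>) \<bullet> (x, \<xi>)) = cis (\<mu> \<bullet> x) * cis (\<xi> \<bullet> \<nu>)"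
        by (simp add: cis_mult inner_commute)
      ultimately show "P x * (of_real (c * exp (- (norm \<xi>)\<^sup>2)) * cis (\<xi> \<bullet> \<nu>))
          = of_real c * (?H (x, \<xi>))"
        by (simp only: P_def of_real_mult mult_ac)
    qed simp
    finally show ?thesis by (simp only: integral_mult_right_zero)
  qed
  have int3: "integrable lborel (\<lambda>(m, \<xi>). ?H (m, \<xi>))"
  proof (rule integrable_dominated[OF integrable_norm[OF gaussian_amplitude(1)[OF a]]])
    show "(\<lambda>(m, \<xi>). ?H (m, \<xi>)) \<in> borel_measurable borel"
      unfolding split_beta prod.collapse by measurable
  qed (simp add: norm_mult split_beta)
  have "(LBINT x. k x * (LBINT \<xi>. cis (x \<bullet> \<xi>) * inner_integral a f x \<xi>))
      = (LBINT x. (LBINT \<xi>. k x * (cis (x \<bullet> \<xi>) * inner_integral a f x \<xi>)))" by simp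
  also have "\<dots> = (LBINT \<xi>. (LBINT x. k x * (cis (x \<bullet> \<xi>) * inner_integral a f x \<xi>)))"
    by (rule integral_iterated_swap[OF int1])
  also have "\<dots> = of_real c * (LBINT \<xi>. (LBINT m. ?H (m, \<xi>)))"
    unfolding fixed by (rule integral_mult_right_zero)
  also have "\<dots> = of_real c * (LBINT X. ?H X)"
    unfolding integral_iterated_swap[OF int3, symmetric] integral_iterated[OF int3] by (simp only: split_beta' prod.collapse)
  finally show ?thesis by (simp only: f_def k_def c_def)
qed

context
  fixes n :: nat
  assumes dim: "DIM('a::euclidean_space) = 2 * n" and n: "n > 0"
begin

text \<open>The preimage is \<open>\<integral>\<^sub>0\<^sup>\<infinity> e\<^bsup>-tH\<^esup> dt\<close> applied to the coherent state, with \<open>s = e\<^bsup>-2t\<^esup>\<close>.\<close>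

lemma coherent_in_range:
  fixes p q :: 'a
  shows "\<exists>\<phi>. schwartz \<phi> \<and> harmonic_expr \<phi> = coherent p q"
proof -
  \<comment> \<open>The bilinear square of the vector p + i q, without conjugation.\<close>
  define \<zeta> where "\<zeta> = (\<Sum>i\<in>(Basis::'a set). (clinear p q i)\<^sup>2)"
  \<comment> \<open>At s = exp (- 2 t) the evolved coherent state is s^n exp ((1 - s^2) \<zeta> / 4)
    exp (- |x|^2 / 2 + s c . x) with c = p + i q. The measure dt = - ds / (2 s) accounts for the
    factor 1/2 and lowers the exponent to \<open>n - 1\<close>.\<close>
  define W where "W s = exp (\<zeta> / 4) / 2 * (of_real s ^ (n - 1) * exp (- (of_real s ^ 2 * \<zeta> / 4)))" for s :: real
  define E where "E w = gauss_mix (\<lambda>_. 1 / 2) (\<lambda>s. s) p q w" for w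
  define E0 where "E0 = E W"
  define E1 where "E1 = E (\<lambda>s. of_real s * W s)"
  define E2 where "E2 = E (\<lambda>s. of_real s * (of_real s * W s))"
  have W: "continuous_on S W" for S
    unfolding W_def by (intro continuous_intros) auto
  have S: "schwartz E0"
    unfolding E0_def E_def by (rule gauss_mix_schwartz) (auto intro!: continuous_intros W)
  have dE: "(E w has_derivative (\<lambda>h. - of_real (x \<bullet> h) * E w x + clinear p q h * E (\<lambda>s. of_real s * w s) x)) (at x)"
    if "continuous_on {0..1} w" for w x
  proof -
    have "continuous_on {0..1} (\<lambda>_::real. 1 / 2 :: real)" "continuous_on {0..1} (\<lambda>s::real. s)"
      by (intro continuous_intros)+
    from gauss_mix_has_derivative[OF this that, of p q x] show ?thesis
      unfolding E_def gauss_mix_cmult[of _ _ _ _ "of_real (1 / 2)"]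
      by (rule has_derivative_eq_rhs) auto
  qed
  have d0: "(E0 has_derivative (\<lambda>h. - of_real (x \<bullet> h) * E0 x + clinear p q h * E1 x)) (at x)" for x
    unfolding E0_def E1_def by (rule dE[OF W])
  have d1: "(E1 has_derivative (\<lambda>h. - of_real (x \<bullet> h) * E1 x + clinear p q h * E2 x)) (at x)" for x
    unfolding E1_def E2_def by (rule dE) (intro continuous_intros W)
  have p1: "partial_deriv i E0 = (\<lambda>x. - of_real (x \<bullet> i) * E0 x + clinear p q i * E1 x)" for i
    by (rule ext) (rule partial_deriv_eq[OF d0])
  have p2: "partial_deriv i (partial_deriv i E0) x
      = - E0 x + of_real ((x \<bullet> i)\<^sup>2) * E0 x - 2 * (of_real (x \<bullet> i) * clinear p q i) * E1 x + (clinear p q i)\<^sup>2 * E2 x"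
    if i: "i \<in> Basis" for i x
  proof -
    have l: "((\<lambda>x. - complex_of_real (x \<bullet> i)) has_derivative (\<lambda>h. - of_real (h \<bullet> i))) (at x)"
      by (auto intro!: derivative_eq_intros)
    have "((\<lambda>x. - of_real (x \<bullet> i) * E0 x + clinear p q i * E1 x) has_derivative
        (\<lambda>h. (- of_real (x \<bullet> i) * (- of_real (x \<bullet> h) * E0 x + clinear p q h * E1 x) + (- of_real (h \<bullet> i)) * E0 x)
          + clinear p q i * (- of_real (x \<bullet> h) * E1 x + clinear p q h * E2 x))) (at x)"
      by (intro has_derivative_add has_derivative_mult has_derivative_mult_right l d0 d1)
    from partial_deriv_eq[OF this, of i] show ?thesis
      unfolding p1 using i by (simp add: power2_eq_square algebra_simps)
  qed
  have "harmonic_expr E0 x = coherent p q x" for x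
  proof -
    let ?cl = "clinear p q x"
    let ?G = "\<lambda>s. exp (- of_real (1 / 2 * (norm x)\<^sup>2) + of_real s * ?cl)"
    let ?I = "\<lambda>s. 2 * of_nat n * (W s * ?G s) + 2 * ?cl * (of_real s * W s * ?G s) - \<zeta> * (of_real s * (of_real s * W s) * ?G s)"
    have "(\<Sum>i\<in>Basis. of_real ((x \<bullet> i)\<^sup>2)) = complex_of_real ((norm x)\<^sup>2)"
      unfolding norm_power2_eq_sum_Basis of_real_sum ..
    moreover have "(\<Sum>i\<in>Basis. of_real (x \<bullet> i) * clinear p q i) = ?cl"
      unfolding clinear_def euclidean_inner[of p x] euclidean_inner[of q x] of_real_sum sum_distrib_left
      by (simp add: sum.distrib[symmetric] algebra_simps)
    ultimately have "laplacian E0 x = - (2 * of_nat n) * E0 x + of_real ((norm x)\<^sup>2) * E0 x - 2 * ?cl * E1 x + \<zeta> * E2 x"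
      unfolding laplacian_def
      by (simp only: p2 sum.distrib sum_subtractf sum_distrib_right[symmetric] sum_distrib_left[symmetric] \<zeta>_def
          cong: sum.cong) (simp add: dim)
    then have "harmonic_expr E0 x = 2 * of_nat n * E0 x + 2 * ?cl * E1 x - \<zeta> * E2 x"
      by (simp add: harmonic_expr_def)
    also have "\<dots> = integral {0..1} ?I"
      unfolding E0_def E1_def E2_def E_def gauss_mix_def integral_mult_right[symmetric]
      by (subst integral_add[symmetric] integral_diff[symmetric],
          (intro integrable_continuous_interval continuous_intros W)+)+ simp
    also have "\<dots> = coherent p q x"
    proof -
      \<comment> \<open>The evolved state itself, as a function of s. By the evolution equation H
        applied to the integrand is its s-derivative, so the integral is the value at s = 1, the
        coherent state, minus the value at s = 0, which vanishes because n > 0.\<close>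
      define F where "F z = exp (\<zeta> / 4) * (z ^ n * exp (- (z ^ 2 * \<zeta> / 4)) * exp (- of_real (1 / 2 * (norm x)\<^sup>2) + z * ?cl))" for z :: complex
      obtain k where k: "n = Suc k" using n by (cases n) auto
      have "(?I
          has_integral (F (of_real 1) - F (of_real 0))) {0..1}"
      proof (rule fundamental_theorem_of_calculus)
        fix s :: real
        have "(F has_field_derivative ?I s) (at (of_real s))"
        proof -
          let ?z = "complex_of_real s"
          have 1: "((\<lambda>z. z ^ n) has_field_derivative of_nat n * ?z ^ k) (at ?z)"
            by (rule DERIV_cong[OF DERIV_power[OF DERIV_ident]]) (simp add: k)
          have 2: "((\<lambda>z. exp (- (z ^ 2 * \<zeta> / 4))) has_field_derivative exp (- (?z ^ 2 * \<zeta> / 4)) * - (?z * \<zeta> / 2)) (at ?z)"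
            by (auto intro!: derivative_eq_intros)
          have 3: "((\<lambda>z. exp (- of_real (1 / 2 * (norm x)\<^sup>2) + z * ?cl)) has_field_derivative ?G s * ?cl) (at ?z)"
            by (auto intro!: derivative_eq_intros)
          have "K * (z ^ n * e * (g * l) + (z ^ n * (e * - (z * \<zeta> / 2)) + of_nat n * z ^ k * e) * g)
            = 2 * of_nat n * (K / 2 * (z ^ (n - 1) * e) * g) + 2 * l * (z * (K / 2 * (z ^ (n - 1) * e)) * g)
              - \<zeta> * (z * (z * (K / 2 * (z ^ (n - 1) * e))) * g)" for K z e g l :: complex
            by (simp add: k algebra_simps)
          then show ?thesis
            unfolding F_def[abs_def] W_def
            by (intro DERIV_cong[OF DERIV_cmult[OF DERIV_mult'[OF DERIV_mult'[OF 1 2] 3]]])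
        qed
        then show "((\<lambda>s. F (of_real s)) has_vector_derivative ?I s) (at s within {0..1})"
          by (rule has_vector_derivative_real_field)
      qed simp
      then have "integral {0..1} ?I
          = F (of_real 1) - F (of_real 0)" by (rule integral_unique)
      also have "\<dots> = coherent p q x"
      proof -
        have "F (of_real 1) = (exp (\<zeta> / 4) * exp (- (\<zeta> / 4))) * coherent p q x"
          by (simp add: F_def coherent_def)
        moreover have "F (of_real 0) = 0" using n by (simp add: F_def)
        ultimately show ?thesis by (simp add: exp_minus_inverse)
      qed
      finally show ?thesis .
    qed
    finally show ?thesis .
  qed
  with S show ?thesis by blast
qed

text \<open>The images of \<open>f\<close> attached to \<open>a\<close> and \<open>b\<close> are a
  priori different functions. Paired with H \<phi>, however, the weak definition of the graph gives
  both the value of \<open>f\<close> paired with \<phi>; choosing H \<phi> as a coherent state reads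
  this off as a Fourier coefficient of the Gaussian-weighted symbol.\<close>

theorem weyl_symbol_unique:
  fixes a b :: "'a \<times> 'a \<Rightarrow> complex"
  assumes a: "is_weyl_symbol (harmonic_oscillator\<inverse>) a" and b: "is_weyl_symbol (harmonic_oscillator\<inverse>) b"
  shows "a = b"
proof
  fix X0
  obtain ma mb where ma: "amplitude_of_order ma a" and mb: "amplitude_of_order mb b"
    using a b unfolding is_weyl_symbol_def amplitude_iff by blast
  let ?A = "\<lambda>X. of_real (exp (- (norm X)\<^sup>2)) * a X" and ?B = "\<lambda>X. of_real (exp (- (norm X)\<^sup>2)) * b X"
  have eq: "(LBINT X. cis (Z \<bullet> X) * ?A X) = (LBINT X. cis (Z \<bullet> X) * ?B X)" for Z
  proof -
    obtain \<mu> \<nu> where Z: "Z = (\<mu>, \<nu>)" by fastforce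
    define f where "f = coherent (- (\<nu> /\<^sub>R 2)) (\<mu> /\<^sub>R 2)"
    define k where "k = coherent (\<nu> /\<^sub>R 2) (\<mu> /\<^sub>R 2)"
    have f: "schwartz f" by (simp add: f_def coherent_schwartz)
    \<comment> \<open>The graph condition conjugates H \<phi>, so the momentum parameter is entered
      with the opposite sign.\<close>
    obtain \<phi> where \<phi>: "schwartz \<phi>" "harmonic_expr \<phi> = coherent (\<nu> /\<^sub>R 2) (- (\<mu> /\<^sub>R 2))"
      using coherent_in_range by blast
    have k: "cnj (harmonic_expr \<phi> x) = k x" for x
      unfolding \<phi>(2) cnj_coherent k_def by simp
    have pair: "of_real ((2 * pi) ^ DIM('a)) * (LBINT x. f x * cnj (\<phi> x))
        = of_real (exp ((norm \<nu>)\<^sup>2 / 4) * sqrt (4 * pi) ^ DIM('a)) *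
          (LBINT X. cis (Z \<bullet> X) * (of_real (exp (- (norm X)\<^sup>2)) * c X))"
      if c: "is_weyl_symbol (harmonic_oscillator\<inverse>) c" and m: "amplitude_of_order m c" for c m
    proof -
      obtain u where u: "(f, u) \<in> harmonic_oscillator\<inverse>" "\<And>x. has_weyl_value c f x (u x)"
        using c f unfolding is_weyl_symbol_def by blast
      have "(LBINT x. f x * cnj (\<phi> x)) = (LBINT x. u x * k x)"
        using u(1) \<phi>(1) by (simp add: harmonic_oscillator_def k[symmetric])
      then have "of_real ((2 * pi) ^ DIM('a)) * (LBINT x. f x * cnj (\<phi> x))
          = of_real ((2 * pi) ^ DIM('a)) * (LBINT x. u x * k x)"
        by (simp only:)
      also have "\<dots> = (LBINT x. of_real ((2 * pi) ^ DIM('a)) * (u x * k x))"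
        by (rule integral_mult_right_zero[symmetric])
      also have "\<dots> = (LBINT x. k x * (of_real ((2 * pi) ^ DIM('a)) * u x))"
        by (simp only: mult_ac)
      also have "\<dots> = (LBINT x. k x * (LBINT \<xi>. cis (x \<bullet> \<xi>) * inner_integral c f x \<xi>))"
        unfolding weyl_value_eq[OF m f u(2)] ..
      finally show ?thesis unfolding Z f_def k_def coherent_pairing[OF m] .
    qed
    have nz: "of_real (exp ((norm \<nu>)\<^sup>2 / 4) * sqrt (4 * pi) ^ DIM('a)) \<noteq> (0::complex)" by simp
    show ?thesis
      by (rule mult_left_cancel[OF nz, THEN iffD1]) (rule trans[OF pair[OF a ma, symmetric] pair[OF b mb]])
  qed
  obtain Ma Mb where M: "\<And>X. norm (?A X) \<le> Ma" "\<And>X. norm (?B X) \<le> Mb"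
    using gaussian_amplitude(2)[OF ma] gaussian_amplitude(2)[OF mb] by blast
  have int: "integrable lborel (\<lambda>X. cis (Z \<bullet> X) * (of_real (exp (- (norm X)\<^sup>2)) * c X))"
    if "amplitude_of_order m c" for Z c m
    by (rule integrable_dominated[OF integrable_norm[OF gaussian_amplitude(1)[OF that]]])
      (auto simp: norm_mult intro!: borel_measurable_times measurable_compose[OF _ measurable_cis]
        borel_measurable_continuous_onI gaussian_amplitude(3)[OF that] amplitude_continuous[OF that] continuous_intros)
  have "?A X0 - ?B X0 = 0"
  proof (rule fourier_injective[where \<Phi> = "\<lambda>X. ?A X - ?B X"])
    show "continuous_on UNIV (\<lambda>X. ?A X - ?B X)"
      by (intro continuous_on_diff gaussian_amplitude(3)[OF ma] gaussian_amplitude(3)[OF mb])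
    show "integrable lborel (\<lambda>X. ?A X - ?B X)"
      by (intro Bochner_Integration.integrable_diff gaussian_amplitude(1)[OF ma] gaussian_amplitude(1)[OF mb])
    show "norm (?A X - ?B X) \<le> Ma + Mb" for X
      using M[of X] norm_triangle_ineq4[of "?A X" "?B X"] by linarith
    show "(LBINT X. cis (Z \<bullet> X) * (?A X - ?B X)) = 0" for Z
      unfolding right_diff_distrib Bochner_Integration.integral_diff[OF int[OF ma] int[OF mb]] eq by simp
  qed
  then show "a X0 = b X0" by simp
qed

end

section \<open>The explicit formula\<close>

lemma exp_taylor_derivative:
  "(exp_taylor j has_real_derivative exp_taylor j t - t ^ j / fact j) (at t within S)"
proof (induction j)
  case 0
  then show ?case by (simp add: exp_taylor_def[abs_def])
next
  case (Suc j)
  have e: "exp_taylor (Suc j) = (\<lambda>t. exp_taylor j t + t ^ Suc j / fact (Suc j))"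
    by (simp add: exp_taylor_def fun_eq_iff)
  have d: "((\<lambda>t. t ^ Suc j / fact (Suc j)) has_real_derivative t ^ j / fact j) (at t within S)"
    by (rule DERIV_cong[OF DERIV_cdivide[OF DERIV_pow]]) (simp del: of_nat_Suc)
  show ?case
    unfolding e by (rule DERIV_cong[OF DERIV_add[OF Suc.IH d]]) simp
qed

text \<open>The derivative of exp (- u) p_k(u) telescopes to - exp (- u) u^k / k!, which gives an
  explicit antiderivative with u = s r.\<close>

lemma integral_power_exp:
  assumes r: "r > 0"
  shows "((\<lambda>s. s ^ k * exp (- (s * r))) has_integral fact k * ((1 - exp (- r) * exp_taylor k r) / r ^ Suc k)) {0..1}"
proof -
  define F where "F s = - (fact k / r ^ Suc k) * (exp (- (s * r)) * exp_taylor k (s * r))" for s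
  have "((\<lambda>s. s ^ k * exp (- (s * r))) has_integral F 1 - F 0) {0..1}"
  proof (rule fundamental_theorem_of_calculus)
    fix s :: real
    have 1: "((\<lambda>s. s * r) has_real_derivative r) (at s within {0..1})"
      by (auto intro!: derivative_eq_intros)
    have 2: "((\<lambda>s. exp_taylor k (s * r)) has_real_derivative (exp_taylor k (s * r) - (s * r) ^ k / fact k) * r) (at s within {0..1})"
      by (rule DERIV_chain'[OF 1 exp_taylor_derivative])
    have 3: "((\<lambda>s. exp (- (s * r))) has_real_derivative exp (- (s * r)) * - r) (at s within {0..1})"
      by (auto intro!: derivative_eq_intros)
    have "(F has_real_derivative s ^ k * exp (- (s * r))) (at s within {0..1})"
      unfolding F_def[abs_def]
      by (rule DERIV_cong[OF DERIV_cmult[OF DERIV_mult'[OF 3 2]]])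
        (use r in \<open>simp add: field_simps power_mult_distrib\<close>)
    then show "(F has_vector_derivative s ^ k * exp (- (s * r))) (at s within {0..1})"
      by (simp add: has_real_derivative_iff_has_vector_derivative)
  qed simp
  moreover have "exp_taylor k 0 = 1"
    by (simp add: exp_taylor_def power_0_left if_distrib[of "\<lambda>x. x / _"] cong: if_cong)
  ultimately show ?thesis by (simp add: F_def diff_divide_distrib right_diff_distrib)
qed

lemma resolvent_symbol_formula:
  assumes "X \<noteq> 0"
  shows "resolvent_symbol n X = of_real (harmonic_inverse_formula n X)"
proof -
  define r where "r = (norm X)\<^sup>2"
  have r: "r > 0" using assms by (simp add: r_def)
  have "((\<lambda>s. \<Sum>j\<le>n - 1. (real ((n - 1) choose j) * (- 1) ^ j) * (s ^ (2 * j) * exp (- (s * r)))) has_integral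
      (\<Sum>j\<le>n - 1. (real ((n - 1) choose j) * (- 1) ^ j) * (fact (2 * j) * ((1 - exp (- r) * exp_taylor (2 * j) r) / r ^ Suc (2 * j))))) {0..1}"
    by (intro has_integral_sum has_integral_mult_right integral_power_exp r) auto
  moreover have "(\<Sum>j\<le>n - 1. (real ((n - 1) choose j) * (- 1) ^ j) * (s ^ (2 * j) * exp (- (s * r)))) = (1 - s\<^sup>2) ^ (n - 1) * exp (- (s * r))" for s
  proof -
    have "(1 - s\<^sup>2) ^ (n - 1) = (- s\<^sup>2 + 1) ^ (n - 1)" by simp
    also have "\<dots> = (\<Sum>j\<le>n - 1. real ((n - 1) choose j) * (- s\<^sup>2) ^ j * 1 ^ (n - 1 - j))"
      by (rule binomial_ring)
    also have "\<dots> = (\<Sum>j\<le>n - 1. (real ((n - 1) choose j) * (- 1) ^ j) * s ^ (2 * j))"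
      by (intro sum.cong refl) (simp add: power_minus[of "s\<^sup>2"] power_mult mult.assoc)
    finally show ?thesis by (simp add: sum_distrib_right mult.assoc)
  qed
  moreover have "(\<Sum>j\<le>n - 1. (real ((n - 1) choose j) * (- 1) ^ j) * (fact (2 * j) * ((1 - exp (- r) * exp_taylor (2 * j) r) / r ^ Suc (2 * j))))
      = harmonic_inverse_formula n X"
  proof -
    have "r ^ Suc (2 * j) = norm X ^ (2 + 4 * j)" for j
      unfolding r_def power_mult[symmetric] by (simp add: algebra_simps)
    then show ?thesis unfolding harmonic_inverse_formula_def r_def by (simp add: mult.assoc)
  qed
  ultimately have "((\<lambda>s. (1 - s\<^sup>2) ^ (n - 1) * exp (- (s * r))) has_integral harmonic_inverse_formula n X) {0..1}"
    by simp
  from has_integral_linear[OF this bounded_linear_of_real]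
  have "((\<lambda>s. complex_of_real ((1 - s\<^sup>2) ^ (n - 1) * exp (- (s * r)))) has_integral of_real (harmonic_inverse_formula n X)) {0..1}"
    by (simp add: o_def)
  moreover have "resolvent_symbol n X = integral {0..1} (\<lambda>s. complex_of_real ((1 - s\<^sup>2) ^ (n - 1) * exp (- (s * r))))"
    by (simp add: resolvent_symbol_def gauss_mix_def exp_of_real[symmetric] r_def)
  ultimately show ?thesis by (simp add: integral_unique)
qed

theorem theorem4p9:
  fixes n :: nat
    and b :: "(real ^ 'd) \<times> (real ^ 'd) \<Rightarrow> complex"
  assumes "n > 0"
    and "CARD('d) = 2 * n"
    and "b = weyl_symbol (harmonic_oscillator\<inverse>)"
  shows "(\<forall>X. X \<noteq> 0 \<longrightarrow> b X = of_real (harmonic_inverse_formula n X)) \<and>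
         ((\<lambda>X :: (real ^ 'd) \<times> (real ^ 'd). of_real (harmonic_inverse_formula n X)) \<longlongrightarrow> b 0) (at 0)"
proof -
  have dim: "DIM(real ^ 'd) = 2 * n" using assms(2) by simp
  have b: "b = resolvent_symbol n"
    unfolding assms(3) weyl_symbol_def
    by (rule the_equality)
      (auto intro: resolvent_symbol_is_weyl_symbol[OF dim assms(1)] weyl_symbol_unique[OF dim assms(1)])
  \<comment> \<open>At the origin the formula has only a default value. Its limit there is obtained
    from the continuity of the symbol, with which it agrees everywhere else.\<close>
  have "continuous_on UNIV b"
    unfolding b by (rule amplitude_continuous[OF resolvent_symbol_amplitude])
  then have "(b \<longlongrightarrow> b 0) (at 0)"
    unfolding continuous_on_def by blast
  moreover have "\<forall>\<^sub>F X in at 0. b X = of_real (harmonic_inverse_formula n X)"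
    by (auto simp: b eventually_at_filter resolvent_symbol_formula)
  ultimately have "((\<lambda>X :: (real ^ 'd) \<times> (real ^ 'd). of_real (harmonic_inverse_formula n X)) \<longlongrightarrow> b 0) (at 0)"
    by (rule Lim_transform_eventually)
  then show ?thesis by (simp add: b resolvent_symbol_formula)
qed

end
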